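(* There exists a function $\varepsilon:\mathbb{Z}_{\ge 1}\to[0,\infty)$ with $\varepsilon(k)\to 0$ as $k\to\infty$ such that for every integer $k\ge 1$ and every finite nonempty set $X\subseteq[0,1]^k$ there exists a Hamiltonian path $P$ on $X$ such that, if $e_1\in P$ is the longest edge of $P$, then $$\sum_{e\in P\setminus\{e_1\}}|e|^k\le \varepsilon(k)\cdot k^{k/2},\qquad\text{so}\qquad S_k(P)=\sum_{e\in P}|e|^k\le k^{k/2}\cdot(1+\varepsilon(k)).$$ In particular, $S_k^{\mathrm{HP}}=k^{k/2}\cdot(1+o_k(1))$, i.e. $S_k^{\mathrm{HP}}/k^{k/2}\to 1$ as $k\to\infty$.
   Context: $|\cdot|$ is the Euclidean norm on $\mathbb{R}^k$; for an edge $e=\mathbf{a}\mathbf{b}$ with $\mathbf{a},\mathbf{b}\in\mathbb{R}^k$, $|e|:=|\mathbf{a}-\mathbf{b}|$. A Hamiltonian path on a finite nonempty set $X$ is (the edge set of) a Hamiltonian path in the complete graph on vertex set $X$; for $|X|=1$ it has no edges. For an edge set $E$ and an integer $t\ge1$, $S_t(E):=\sum_{e\in E}|e|^t$. Set $S_k^{\mathrm{HP}}(X):=\min_P S_k(P)$ over all Hamiltonian paths $P$ on $X$, and $S_k^{\mathrm{HP}}:=\sup\{S_k^{\mathrm{HP}}(X): X\subseteq[0,1]^k\text{ finite}\}$. *)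

theory Defs
  imports "HOL-Analysis.Analysis" "HOL-Library.Extended_Real"
begin

text \<open>
  The dimension \<open>k\<close> varies inside the statement, so points of \<open>\<real>\<^sup>k\<close> are functions on the index set
  \<open>{..<k}\<close>, extensional (i.e. \<open>undefined\<close>) outside of it.
\<close>

definition unit_cube :: "nat \<Rightarrow> (nat \<Rightarrow> real) set" where
  "unit_cube k = {..<k} \<rightarrow>\<^sub>E {0..1}"

definition euclid_dist :: "nat \<Rightarrow> (nat \<Rightarrow> real) \<Rightarrow> (nat \<Rightarrow> real) \<Rightarrow> real" where
  "euclid_dist k a b = L2_set (\<lambda>i. a i - b i) {..<k}"

text \<open>An edge is an unordered pair \<open>{a, b}\<close> of points.\<close>

definition edge_length :: "nat \<Rightarrow> (nat \<Rightarrow> real) set \<Rightarrow> real" where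
  "edge_length k e = (THE d. \<exists>a b. e = {a, b} \<and> d = euclid_dist k a b)"

lemma edge_length_doubleton: "edge_length k {a, b} = euclid_dist k a b"
proof -
  have sym: "euclid_dist k b a = euclid_dist k a b"
    by (simp add: euclid_dist_def L2_set_def power2_commute)
  show ?thesis
    unfolding edge_length_def
    by (rule the_equality) (auto simp: doubleton_eq_iff sym)
qed

definition path_edges :: "'a list \<Rightarrow> 'a set set" where
  "path_edges xs = {{xs ! i, xs ! Suc i} | i. Suc i < length xs}"

text \<open>
  A Hamiltonian path is identified with its edge set. In the complete graph on \<open>X\<close> any two
  distinct vertices are adjacent, so it is given by an enumeration of \<open>X\<close> without repetition.
\<close>

definition is_hamiltonian_path :: "'a set \<Rightarrow> 'a set set \<Rightarrow> bool" where
  "is_hamiltonian_path X P \<longleftrightarrow> (\<exists>xs. distinct xs \<and> set xs = X \<and> P = path_edges xs)"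

text \<open>The first argument is the dimension of the ambient space, the second one the exponent.\<close>

definition edge_power_sum :: "nat \<Rightarrow> nat \<Rightarrow> (nat \<Rightarrow> real) set set \<Rightarrow> real" where
  "edge_power_sum k t E = (\<Sum>e\<in>E. edge_length k e ^ t)"

definition S_HP_of :: "nat \<Rightarrow> (nat \<Rightarrow> real) set \<Rightarrow> real" where
  "S_HP_of k X = Min (edge_power_sum k k ` {P. is_hamiltonian_path X P})"

lemma finite_hamiltonian_paths:
  assumes "finite X"
  shows "finite {P. is_hamiltonian_path X P}"
proof (rule finite_subset)
  show "{P. is_hamiltonian_path X P} \<subseteq> Pow (Pow X)"
    by (auto simp: is_hamiltonian_path_def path_edges_def)
qed (use assms in simp)

lemma hamiltonian_paths_nonempty:
  assumes "finite X"
  shows "{P. is_hamiltonian_path X P} \<noteq> {}"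
  using finite_distinct_list[OF assms] by (auto simp: is_hamiltonian_path_def)

text \<open>
  The supremum is taken in the extended reals, so that it is meaningful without knowing
  beforehand that the set of values is bounded.
\<close>

definition S_HP :: "nat \<Rightarrow> ereal" where
  "S_HP k = (SUP X\<in>{X. X \<subseteq> unit_cube k \<and> finite X \<and> X \<noteq> {}}. ereal (S_HP_of k X))"

end

(* Upper bound. A path cover of X is a partition into paths, and its cost at scale r charges
   |e|^k for every edge and r^k for every path. The cost of an optimal cover grows from scale r_j
   to r_(j+1) = q r_j by at most (r_(j+1)^k - r_j^k) p_j, with p_j the number of paths at scale r_j,
   so it suffices to bound sum_j r_j^k p_j over a geometric sequence of scales up to 0.31 sqrt k.

   Fix a scale r and an axis-parallel line. If the ends of two paths of the optimal cover lie
   within 0.48 r of it, the points of X near the line between them cannot form a fine chain: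
   rerouting through the chain would merge the two paths at a cost below r^k. Hence the distance
   to X has integral of order r^2 along that piece of the line. Integrating over all parallel lines
   (around each end they fill at least a fixed proportion of a cube of side 1.6 r / sqrt k) bounds
   r^k p_j by the integral over a slightly enlarged cube of dist(z, X) / r restricted to
   dist(z, X) <= r. These integrands sum geometrically over the scales, so the bound holds for
   the sum over all scales at once, and it is exponentially smaller than k^(k/2).

   The remaining paths are joined greedily by their ends. If N joining edges have length >= rho,
   then X contains N + 1 points at mutual distance >= rho; dividing the cube into boxes and
   applying the Plotkin bound inside each box shows that, up to 0.86 sqrt k, these edges contribute
   exponentially less than k^(k/2), and three points cannot be 0.86 sqrt k apart.

   Lower bound: two opposite vertices of the cube. *)

theory Submission
  imports Defs "HOL-Real_Asymp.Real_Asymp"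
begin

section \<open>Path covers and their cost\<close>

text \<open>A volume bound at each scale separately is not enough, because the number of scales
  needed depends on X. The weight dist / r is chosen since its sum over all scales above dist is
  bounded at every point, and the lines serve to produce it. The obstacle is that the points of a
  chain already lie on paths: rerouting has to delete them there, which is cheap only beside short
  edges. So the line argument runs with \<open>gap\<close> instead of the distance; the difference
  matters only in small cubes around points of X, whose volume is controlled by the edges of the
  covers and absorbed. The constants: ends are r apart, so two ends within c r of a line are sure to
  be separated along it only if c < 1/2, hence 0.48; a box of half-side 0.8 r / sqrt k has mean
  square radius at most 0.214 r^2, just below (0.48 r)^2. Up to polynomial factors the final bound
  is ((21/20) * (1 + 1.6 * 0.31) / 1.6 * sqrt k)^k, and (21/20) * (1 + 1.6 c) / 1.6 stays below 1
  only for top scales c sqrt k with c < 0.327; from 0.31 sqrt k on, packing with few boxes takes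
  over.\<close>

fun esum :: "('a \<Rightarrow> 'a \<Rightarrow> real) \<Rightarrow> 'a list \<Rightarrow> real" where
  "esum c (x # y # ys) = c x y + esum c (y # ys)"
| "esum c _ = 0"

lemma esum_append:
  assumes "xs \<noteq> []" "ys \<noteq> []"
  shows "esum c (xs @ ys) = esum c xs + c (last xs) (hd ys) + esum c ys"
  using assms
proof (induction c xs rule: esum.induct)
  case (1 c x y zs)
  then show ?case by simp
next
  case ("2_2" c v)
  then show ?case by (cases ys) auto
qed simp

lemma esum_rev:
  assumes "\<And>x y. c x y = c y x"
  shows "esum c (rev xs) = esum c xs"
proof (induction xs)
  case (Cons x xs)
  have "esum c (rev xs @ [x]) = esum c (rev xs) + c (last (rev xs)) x" if "xs \<noteq> []"
    using that by (subst esum_append) auto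
  then show ?case
    using Cons assms[of x] by (cases xs) (auto simp: last_rev simp del: append_assoc)
qed simp

lemma esum_nonneg:
  assumes "\<And>x y. c x y \<ge> 0"
  shows "esum c xs \<ge> 0"
  by (induction xs rule: induct_list012) (use assms in auto)

lemma esum_mono:
  assumes "\<And>x y. x \<in> set xs \<Longrightarrow> y \<in> set xs \<Longrightarrow> c x y \<le> c' x y"
  shows "esum c xs \<le> esum c' xs"
  using assms by (induction xs rule: induct_list012) (auto intro: add_mono)

lemma esum_diff: "esum (\<lambda>x y. c x y - c' x y) xs = esum c xs - esum c' xs"
  by (induction xs rule: induct_list012) auto

lemma esum_mult: "esum (\<lambda>x y. a * c x y) xs = a * esum c xs"
  by (induction xs rule: induct_list012) (auto simp: distrib_left)

lemma esum_const_le: "0 \<le> a \<Longrightarrow> esum (\<lambda>x y. a) xs \<le> a * real (length xs)"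
  by (induction xs rule: induct_list012) (auto simp: algebra_simps)

lemma esum_add: "esum (\<lambda>x y. c x y + c' x y) xs = esum c xs + esum c' xs"
  by (induction xs rule: induct_list012) auto

lemma esum_sum:
  "finite I \<Longrightarrow> esum (\<lambda>x y. \<Sum>i\<in>I. c i x y) xs = (\<Sum>i\<in>I. esum (c i) xs)"
  by (induction xs rule: induct_list012) (auto simp: sum.distrib)

text \<open>
  The vertices at odd positions, except the last vertex, each with the longer of its two edges.
  No two of them are adjacent, so any set of them can be deleted from the path at the cost of
  one new edge of length at most \<open>2 * q\<close> per deleted vertex.
\<close>

fun mids :: "('a \<Rightarrow> 'a \<Rightarrow> real) \<Rightarrow> 'a list \<Rightarrow> ('a \<times> real) list" where
  "mids d (x # u # y # ys) = (u, max (d x u) (d u y)) # mids d (y # ys)"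
| "mids d _ = []"

lemma mids_in_tl: "fst ` set (mids d p) \<subseteq> set (tl p)"
  by (induction d p rule: mids.induct) (auto dest: list.set_sel(2))

lemma last_notin_mids: "distinct p \<Longrightarrow> p \<noteq> [] \<Longrightarrow> last p \<notin> fst ` set (mids d p)"
proof (induction d p rule: mids.induct)
  case (1 d x u y ys)
  then have "last (y # ys) \<notin> fst ` set (mids d (y # ys))" by auto
  moreover have "last (y # ys) \<noteq> u"
    using 1 last_in_set[of "y # ys"] by auto
  ultimately show ?case by auto
qed auto

lemma distinct_mids: "distinct p \<Longrightarrow> distinct (map fst (mids d p))"
proof (induction d p rule: mids.induct)
  case (1 d x u y ys)
  have "u \<notin> fst ` set (mids d (y # ys))"
    using mids_in_tl[of d "y # ys"] 1 by auto
  then show ?case using 1 by auto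
qed auto

text \<open>Paths are oriented lists, so that \<open>last\<close> selects one end of each; these are
  the ends that are counted and joined.\<close>

definition path_cover :: "'a set \<Rightarrow> 'a list list \<Rightarrow> bool" where
  "path_cover X pss \<longleftrightarrow> distinct (concat pss) \<and> set (concat pss) = X \<and> [] \<notin> set pss"

definition cover_cost :: "('a \<Rightarrow> 'a \<Rightarrow> real) \<Rightarrow> real \<Rightarrow> 'a list list \<Rightarrow> real" where
  "cover_cost c l pss = (\<Sum>p\<leftarrow>pss. esum c p + l)"

definition opt_cover :: "('a \<Rightarrow> 'a \<Rightarrow> real) \<Rightarrow> real \<Rightarrow> 'a set \<Rightarrow> 'a list list \<Rightarrow> bool" where
  "opt_cover c l X pss \<longleftrightarrow> path_cover X pss \<and> (\<forall>qss. path_cover X qss \<longrightarrow> cover_cost c l pss \<le> cover_cost c l qss)"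

lemma cover_cost_simps [simp]:
  "cover_cost c l [] = 0"
  "cover_cost c l (p # pss) = esum c p + l + cover_cost c l pss"
  by (auto simp: cover_cost_def)

lemma distinct_path_cover:
  assumes "path_cover X pss" shows "distinct pss"
  using assms unfolding path_cover_def distinct_concat_iff
  by (metis removeAll_id)

lemma path_cover_last_in:
  assumes "path_cover X pss" "p \<in> set pss"
  shows "last p \<in> set p" "last p \<in> X"
proof -
  have "p \<noteq> []" using assms by (auto simp: path_cover_def)
  then show "last p \<in> set p" by simp
  then show "last p \<in> X" using assms by (auto simp: path_cover_def)
qed

lemma mset_remove1_remove1:
  assumes "A \<in> set xs" "B \<in> set xs" "A \<noteq> B"
  shows "mset xs = mset (A # B # remove1 B (remove1 A xs))"
proof -
  have B': "B \<in># mset (remove1 A xs)" using assms by (simp add: in_diff_count)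
  have "mset xs = add_mset A (mset (remove1 A xs))" using assms by simp
  also have "mset (remove1 A xs) = add_mset B (mset (remove1 B (remove1 A xs)))"
    using insert_DiffM[OF B'] by simp
  finally show ?thesis by simp
qed

lemma path_cover_perm:
  assumes "mset pss = mset qss" "path_cover X pss"
  shows "path_cover X qss"
proof -
  have "mset (concat pss) = mset (concat qss)"
    using assms(1) by (metis mset_concat mset_map sum_mset_sum_list)
  then show ?thesis
    using assms unfolding path_cover_def
    by (metis mset_eq_imp_distinct_iff mset_eq_setD)
qed

lemma cover_cost_perm: "mset pss = mset qss \<Longrightarrow> cover_cost c l pss = cover_cost c l qss"
  unfolding cover_cost_def sum_mset_sum_list[symmetric] mset_map by simp

lemma path_cover_length:
  assumes "path_cover X pss"
  shows "length pss \<le> card X"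
proof -
  have "card X = length (concat pss)"
    using assms by (metis distinct_card path_cover_def)
  moreover have "[] \<notin> set pss \<Longrightarrow> length pss \<le> length (concat pss)" for pss :: "'a list list"
  proof (induction pss)
    case (Cons a pss)
    then show ?case by (cases a) auto
  qed simp
  ultimately show ?thesis using assms by (auto simp: path_cover_def)
qed

lemma finite_path_covers: "finite X \<Longrightarrow> finite {pss. path_cover X pss}"
proof -
  assume fin: "finite X"
  let ?L = "{p. set p \<subseteq> X \<and> length p \<le> card X}"
  have "{pss. path_cover X pss} \<subseteq> {pss. set pss \<subseteq> ?L \<and> length pss \<le> card X}"
  proof safe
    fix pss assume a: "path_cover X pss"
    then show "length pss \<le> card X" by (rule path_cover_length)
    fix p assume p: "p \<in> set pss"
    then have sub: "set p \<subseteq> X" and "distinct p"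
      using a by (auto simp: path_cover_def distinct_concat_iff)
    then show "length p \<le> card X" "\<And>x. x \<in> set p \<Longrightarrow> x \<in> X"
      using card_mono[OF fin sub] by (auto simp: distinct_card)
  qed
  then show ?thesis
    by (rule finite_subset) (simp add: finite_lists_length_le fin)
qed

lemma path_cover_singletons:
  assumes "distinct xs" "set xs = X"
  shows "path_cover X (map (\<lambda>x. [x]) xs)" "cover_cost c l (map (\<lambda>x. [x]) xs) = l * card X"
proof -
  have [simp]: "concat (map (\<lambda>x. [x]) ys) = ys" for ys :: "'a list" by (induction ys) auto
  show "path_cover X (map (\<lambda>x. [x]) xs)" using assms by (auto simp: path_cover_def)
  have "cover_cost c l (map (\<lambda>x. [x]) ys) = l * length ys" for ys :: "'a list"
    by (induction ys) (auto simp: algebra_simps)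
  then show "cover_cost c l (map (\<lambda>x. [x]) xs) = l * card X"
    using assms by (metis distinct_card)
qed

lemma opt_cover_exists:
  assumes "finite X"
  shows "\<exists>pss. opt_cover c l X pss"
proof -
  obtain xs where xs: "distinct xs" "set xs = X" using finite_distinct_list[OF assms] by auto
  let ?S = "{pss. path_cover X pss}"
  have "?S \<noteq> {}" using path_cover_singletons(1)[OF xs] by auto
  then obtain pss where "pss \<in> ?S" "\<And>y. y \<in> ?S \<Longrightarrow> \<not> cover_cost c l y < cover_cost c l pss"
    using ex_min_if_finite[of "cover_cost c l ` ?S"] finite_path_covers[OF assms] by auto
  then show ?thesis unfolding opt_cover_def by (auto simp: not_less)
qed

lemma cover_cost_mono_const: "cover_cost c l' pss = cover_cost c l pss + (l' - l) * length pss"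
  by (induction pss) (auto simp: algebra_simps)

lemma opt_cover_card_le:
  assumes "finite X" "opt_cover c l X pss"
  shows "cover_cost c l pss \<le> l * card X"
proof -
  obtain xs where xs: "distinct xs" "set xs = X" using finite_distinct_list[OF assms(1)] by auto
  show ?thesis using path_cover_singletons(1)[OF xs] path_cover_singletons(2)[OF xs, of c l] assms(2) unfolding opt_cover_def by metis
qed

text \<open>Cut at exactly the edges with \<open>c x y > l\<close>: each is traded for one more path
  at the charge \<open>l\<close>, so every edge is paid at the rate
  \<open>min (c x y) l\<close>.\<close>

lemma cut_path:
  assumes "p \<noteq> []"
  shows "\<exists>pss. concat pss = p \<and> [] \<notin> set pss \<and> cover_cost c l pss = esum (\<lambda>x y. min (c x y) l) p + l"
  using assms
proof (induction c p rule: esum.induct)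
  case (1 c x y ys)
  then obtain pss where pss: "concat pss = y # ys" "[] \<notin> set pss"
    "cover_cost c l pss = esum (\<lambda>x y. min (c x y) l) (y # ys) + l" by auto
  then obtain p' qss where c: "pss = p' # qss" by (cases pss) auto
  with pss obtain ps where p': "p' = y # ps" by (cases p') auto
  show ?case
  proof (cases "c x y \<le> l")
    case True
    show ?thesis
      by (rule exI[of _ "(x # p') # qss"]) (use pss c p' True in auto)
  next
    case False
    show ?thesis
      by (rule exI[of _ "[x] # pss"]) (use pss False in auto)
  qed
qed (auto intro: exI[of _ "[[_]]"])

lemma cut_cover:
  assumes "[] \<notin> set pss"
  shows "\<exists>qss. concat qss = concat pss \<and> [] \<notin> set qss \<and>
    cover_cost c l qss = cover_cost (\<lambda>x y. min (c x y) l) l pss"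
  using assms
proof (induction pss)
  case (Cons p pss)
  then obtain qss where qss: "concat qss = concat pss" "[] \<notin> set qss"
    "cover_cost c l qss = cover_cost (\<lambda>x y. min (c x y) l) l pss" by auto
  obtain rss where rss: "concat rss = p" "[] \<notin> set rss"
    "cover_cost c l rss = esum (\<lambda>x y. min (c x y) l) p + l"
    using cut_path[of p c l] Cons.prems by auto
  have "cover_cost c l (rss @ qss) = cover_cost c l rss + cover_cost c l qss"
    by (simp add: cover_cost_def)
  then show ?case
    by (intro exI[of _ "rss @ qss"]) (use qss rss in auto)
qed (auto intro: exI[of _ "[]"])

text \<open>The competitor is \<open>qss\<close> cut at its overlong edges. Applied to
  \<open>pss\<close> itself this bounds the edges of an optimal cover; applied to the optimal cover
  of a larger scale it bounds the excess of that cover's edges over \<open>l\<close>.\<close>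

lemma opt_cover_cut:
  assumes "opt_cover c l X pss" "path_cover X qss"
  shows "cover_cost c l pss \<le> cover_cost (\<lambda>x y. min (c x y) l) l qss"
proof -
  obtain rss where "concat rss = concat qss" "[] \<notin> set rss"
    "cover_cost c l rss = cover_cost (\<lambda>x y. min (c x y) l) l qss"
    using cut_cover[of qss c l] assms(2) by (auto simp: path_cover_def)
  then show ?thesis using assms unfolding opt_cover_def path_cover_def by metis
qed

section \<open>Merging two paths by an exchange\<close>

locale semimetric =
  fixes d :: "'a \<Rightarrow> 'a \<Rightarrow> real"
  assumes d_nonneg: "d x y \<ge> 0" and d_self: "d x x = 0" and d_sym: "d x y = d y x"
    and d_tri: "d x z \<le> d x y + d y z"
begin


abbreviation pw :: "nat \<Rightarrow> 'a \<Rightarrow> 'a \<Rightarrow> real" where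
  "pw k \<equiv> \<lambda>x y. d x y ^ k"

lemma mids_weight_nonneg: "(u, q) \<in> set (mids d p) \<Longrightarrow> q \<ge> 0"
proof (induction p rule: induct_list012)
  case (3 x v zs)
  then show ?case by (cases zs) (auto simp: le_max_iff_disj d_nonneg)
qed auto

text \<open>\<open>C\<close> is arbitrary outside \<open>p\<close>, so that one set can be removed
  from a whole cover. The two edges lost at a deleted vertex stay counted in the bound.\<close>

lemma filter_mids_esum:
  assumes "distinct p" "C \<inter> set p \<subseteq> fst ` set (mids d p)"
  shows "esum (pw k) (filter (\<lambda>x. x \<notin> C) p)
    \<le> esum (pw k) p + (\<Sum>(u,q)\<leftarrow>filter (\<lambda>(u,q). u \<in> C) (mids d p). (2 * q) ^ k)"
  using assms
proof (induction p rule: induct_list012)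
  case (3 x u zs)
  show ?case
  proof (cases zs)
    case Nil
    then show ?thesis using 3 by auto
  next
    case (Cons y ys)
    have tl: "fst ` set (mids d (y # ys)) \<subseteq> set ys" using mids_in_tl[of d "y # ys"] by simp
    have C': "C \<inter> set (y # ys) \<subseteq> fst ` set (mids d (y # ys))"
      using 3 Cons tl by auto
    have "x \<notin> fst ` set (mids d (x # u # zs))" "y \<notin> fst ` set (mids d (y # ys))"
      using mids_in_tl[of d "x # u # zs"] tl "3.prems"(1) Cons by auto
    then have x: "x \<notin> C" and y: "y \<notin> C" using "3.prems"(2) C' by auto
    define F where "F = filter (\<lambda>x. x \<notin> C) ys"
    have IH: "esum (pw k) (y # F) \<le> esum (pw k) (y # ys) +
        (\<Sum>(u,q)\<leftarrow>filter (\<lambda>(u,q). u \<in> C) (mids d (y # ys)). (2 * q) ^ k)"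
      using "3.IH"(1)[unfolded Cons] C' "3.prems"(1) Cons y by (simp add: F_def)
    have "d x y ^ k \<le> (2 * max (d x u) (d u y)) ^ k"
      using d_tri[of x y u] by (intro power_mono) (auto simp: d_nonneg)
    then show ?thesis
      using IH x y Cons zero_le_power[OF d_nonneg[of x u], of k] zero_le_power[OF d_nonneg[of u y], of k]
      by (cases "u \<in> C") (simp_all add: F_def[symmetric])
  qed
qed auto

definition midset :: "'a list list \<Rightarrow> ('a \<times> real) set" where
  "midset pss = (\<Union>p\<in>set pss. set (mids d p))"

lemma finite_midset: "finite (midset pss)"
  by (auto simp: midset_def)

lemma midset_perm: "set pss = set qss \<Longrightarrow> midset pss = midset qss"
  by (auto simp: midset_def)

lemma distinct_concat_mids:
  "distinct (concat pss) \<Longrightarrow> distinct (map fst (concat (map (mids d) pss)))"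
proof (induction pss)
  case (Cons p pss)
  have *: "fst ` set (mids d p) \<subseteq> set p" for p
    using mids_in_tl[of d p] by (cases p) auto
  have "fst ` set (mids d p) \<inter> fst ` set (concat (map (mids d) pss)) = {}"
  proof -
    have "fst ` set (concat (map (mids d) pss)) \<subseteq> set (concat pss)"
      using * by (auto simp: image_UN)
    moreover have "set p \<inter> set (concat pss) = {}" using Cons.prems by auto
    ultimately show ?thesis using *[of p] by blast
  qed
  then show ?case using Cons distinct_mids[of p d] by (auto simp: image_Un)
qed simp

lemma inj_on_midset: "distinct (concat pss) \<Longrightarrow> inj_on fst (midset pss)"
  using distinct_concat_mids[of pss] by (auto simp: midset_def distinct_map)

lemma filter_cover_cost:
  assumes "distinct (concat pss)" "C \<inter> set (concat pss) \<subseteq> fst ` midset pss"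
  shows "cover_cost (pw k) l (map (filter (\<lambda>x. x \<notin> C)) pss)
    \<le> cover_cost (pw k) l pss + (\<Sum>(u,q)\<leftarrow>filter (\<lambda>(u,q). u \<in> C) (concat (map (mids d) pss)). (2 * q) ^ k)"
  using assms
proof (induction pss)
  case (Cons p pss)
  have *: "fst ` set (mids d p) \<subseteq> set p" for p
    using mids_in_tl[of d p] by (cases p) auto
  then have **: "fst ` midset pss \<subseteq> set (concat pss)" unfolding midset_def set_concat by blast
  have disj: "set p \<inter> set (concat pss) = {}" using Cons.prems by auto
  have m: "midset (p # pss) = set (mids d p) \<union> midset pss" by (auto simp: midset_def)
  have sub: "C \<inter> (set p \<union> set (concat pss)) \<subseteq> fst ` set (mids d p) \<union> fst ` midset pss"
    using Cons.prems(2) unfolding m image_Un by simp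
  have 1: "C \<inter> set p \<subseteq> fst ` set (mids d p)"
    using sub disj ** by blast
  have 2: "C \<inter> set (concat pss) \<subseteq> fst ` midset pss"
    using sub disj *[of p] by blast
  have "esum (pw k) (filter (\<lambda>x. x \<notin> C) p)
    \<le> esum (pw k) p + (\<Sum>(u,q)\<leftarrow>filter (\<lambda>(u,q). u \<in> C) (mids d p). (2 * q) ^ k)"
    by (rule filter_mids_esum[OF _ 1]) (use Cons.prems in simp)
  moreover have "distinct (concat pss)" using Cons.prems by simp
  note Cons.IH[OF this 2]
  ultimately show ?case by simp
qed simp

lemma sum_list_filter_mids:
  fixes f :: "real \<Rightarrow> real"
  assumes "distinct (concat pss)" "set ps \<subseteq> midset pss" "distinct (map fst ps)"
  shows "(\<Sum>(u,q)\<leftarrow>filter (\<lambda>(u,q). u \<in> set (map fst ps)) (concat (map (mids d) pss)). f q)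
    = (\<Sum>(u,q)\<leftarrow>ps. f q)"
proof -
  let ?M = "filter (\<lambda>(u,q). u \<in> set (map fst ps)) (concat (map (mids d) pss))"
  have "distinct ?M" "distinct ps"
    using distinct_concat_mids[OF assms(1)] assms(3) by (auto simp: distinct_map)
  moreover have "set ?M = set ps"
  proof -
    have M: "set (concat (map (mids d) pss)) = midset pss" by (auto simp: midset_def)
    have "x \<in> set ps" if "x \<in> midset pss" "fst x \<in> fst ` set ps" for x
      using that assms(2) inj_on_midset[OF assms(1)] by (auto dest: inj_onD)
    then have "{x \<in> midset pss. fst x \<in> fst ` set ps} = set ps" using assms(2) by blast
    moreover have "set ?M = {x \<in> midset pss. fst x \<in> fst ` set ps}"
      unfolding set_filter M set_map by (simp add: case_prod_beta)
    ultimately show ?thesis by simp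
  qed
  moreover have gen: "sum_list (map g xs) = sum_list (map g ys)"
    if "distinct xs" "distinct ys" "set xs = set ys" for xs ys and g :: "'a \<times> real \<Rightarrow> real"
    using that by (simp add: sum_list_distinct_conv_sum_set)
  ultimately show ?thesis by - (rule gen)
qed

text \<open>The price of moving the vertices of \<open>ps\<close> into a new path: the edges between
  them there, plus the bridges left behind at their old places.\<close>

definition walk_cost :: "nat \<Rightarrow> ('a \<times> real) list \<Rightarrow> real" where
  "walk_cost k ps = esum (pw k) (map fst ps) + (\<Sum>(u,q)\<leftarrow>ps. (2 * q) ^ k)"

text \<open>Delete the vertices of \<open>ps\<close> from their paths and merge \<open>A\<close>,
  \<open>ps\<close> and the reverse of \<open>B\<close> into one path. This saves one charge
  \<open>l\<close>, so by optimality the new edges and bridges cost at least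
  \<open>l\<close>.\<close>

lemma exchange_distinct:
  assumes opt: "opt_cover (pw k) l X pss" and A: "A \<in> set pss" and B: "B \<in> set pss" and "A \<noteq> B"
    and ps: "set ps \<subseteq> midset pss" "distinct (map fst ps)"
  shows "l \<le> esum (pw k) (last A # map fst ps @ [last B]) + (\<Sum>(u,q)\<leftarrow>ps. (2 * q) ^ k)"
proof -
  have cover: "path_cover X pss" using opt by (simp add: opt_cover_def)
  define rs where "rs = remove1 B (remove1 A pss)"
  have ms: "mset pss = mset (A # B # rs)"
    unfolding rs_def by (rule mset_remove1_remove1[OF A B \<open>A \<noteq> B\<close>])
  then have opt': "opt_cover (pw k) l X (A # B # rs)"
    using opt path_cover_perm[OF ms] cover_cost_perm[OF ms] by (auto simp: opt_cover_def)
  have ps': "set ps \<subseteq> midset (A # B # rs)"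
    using ps(1) midset_perm mset_eq_setD[OF ms] by metis
  have cov: "path_cover X (A # B # rs)" using opt' by (simp add: opt_cover_def)
  then have dist: "distinct (concat (A # B # rs))" and ne: "A \<noteq> []" "B \<noteq> []" "[] \<notin> set rs"
    by (auto simp: path_cover_def)
  define C where "C = set (map fst ps)"
  let ?F = "filter (\<lambda>x. x \<notin> C)"
  have *: "fst ` set (mids d p) \<subseteq> set p" for p
    using mids_in_tl[of d p] by (cases p) auto
  have CX: "C \<subseteq> fst ` midset (A # B # rs)" using ps' by (auto simp: C_def)
  \<comment> \<open>The last vertex of a path is never deletable, so no path becomes empty and the
    ends of \<open>A\<close> and \<open>B\<close> survive.\<close>
  have lastC: "last p \<notin> C" if "p \<in> set (A # B # rs)" for p
  proof
    assume "last p \<in> C"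
    then obtain r where r: "r \<in> set (A # B # rs)" "last p \<in> fst ` set (mids d r)"
      using CX unfolding midset_def by blast
    have pr: "p \<noteq> []" using that ne by auto
    then have pr: "p \<noteq> []" "last p \<in> set p" by auto
    show False
    proof (cases "p = r")
      case True
      then show ?thesis using r pr last_notin_mids[of p d] dist that
        by (auto simp: distinct_concat_iff)
    next
      case False
      have "set p \<inter> set r = {}"
        using dist that r(1) False unfolding distinct_concat_iff by blast
      then show ?thesis using r(2) * pr by blast
    qed
  qed
  have lastF: "?F p \<noteq> []" "last (?F p) = last p" if "p \<in> set (A # B # rs)" for p
  proof -
    have "p \<noteq> []" using that ne by auto
    then obtain p' where p': "p = p' @ [last p]" by (metis append_butlast_last_id)
    have "?F p = ?F p' @ [last p]" using lastC[OF that] by (subst p') simp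
    then show "?F p \<noteq> []" "last (?F p) = last p" by auto
  qed
  define N where "N = ?F A @ map fst ps @ rev (?F B)"
  define qs where "qs = N # map ?F rs"
  have "path_cover X qs"
  proof -
    have c: "concat (map ?F rs) = ?F (concat rs)" by (simp add: filter_concat)
    have X: "C \<subseteq> X" "X = set A \<union> set B \<union> set (concat rs)"
    proof -
      show X: "X = set A \<union> set B \<union> set (concat rs)" using cov by (auto simp: path_cover_def)
      have "fst ` midset (A # B # rs) \<subseteq> (\<Union>p\<in>set (A # B # rs). set p)"
        using * unfolding midset_def by blast
      then have "C \<subseteq> (\<Union>p\<in>set (A # B # rs). set p)" using CX by (rule subset_trans[rotated])
      then show "C \<subseteq> X" unfolding X by auto
    qed
    have qs: "concat qs = ?F A @ map fst ps @ rev (?F B) @ ?F (concat rs)"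
      by (simp add: qs_def N_def c)
    have "set (concat qs) = (set A - C) \<union> C \<union> (set B - C) \<union> (set (concat rs) - C)"
      unfolding qs by (auto simp: C_def)
    then have "set (concat qs) = X" using X by blast
    moreover have "distinct (concat qs)"
    proof -
      have "set (map fst ps) = C" by (simp add: C_def)
      moreover have "distinct A" "distinct B" "distinct (concat rs)" "set A \<inter> set B = {}"
        "set A \<inter> set (concat rs) = {}" "set B \<inter> set (concat rs) = {}"
        using dist by auto
      ultimately show ?thesis
        unfolding qs distinct_append set_append set_rev set_filter using ps(2)
        by (simp only: distinct_filter distinct_rev) blast
    qed
    moreover have "[] \<notin> set qs"
    proof
      assume "[] \<in> set qs"
      then consider "N = []" | p where "p \<in> set rs" "?F p = []" by (fastforce simp: qs_def)
      then show False using lastF(1)[of A] lastF(1) by cases (simp_all add: N_def)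
    qed
    ultimately show ?thesis by (simp add: path_cover_def)
  qed
  then have "cover_cost (pw k) l (A # B # rs) \<le> cover_cost (pw k) l qs"
    using opt' by (simp add: opt_cover_def)
  also have "esum (pw k) N = esum (pw k) (?F A) + esum (pw k) (last A # map fst ps @ [last B]) + esum (pw k) (?F B)"
  proof -
    have rF: "esum (pw k) (rev (?F B)) = esum (pw k) (?F B)" by (rule esum_rev) (simp add: d_sym)
    have h: "hd (rev (?F B)) = last B" using lastF[of B] by (simp add: hd_rev)
    have rn: "rev (?F B) \<noteq> []" using lastF[of B] by simp
    show ?thesis
    proof (cases "ps = []")
      case True
      then show ?thesis unfolding N_def
        using esum_append[of "?F A" "rev (?F B)" "pw k"] rF h rn lastF[of A] by simp
    next
      case False
      then obtain u us where us: "map fst ps = u # us" by (cases ps) auto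
      have "esum (pw k) N = esum (pw k) (?F A) + pw k (last A) u + esum (pw k) ((u # us) @ rev (?F B))"
        unfolding N_def us using esum_append[of "?F A" "(u # us) @ rev (?F B)" "pw k"] lastF[of A] by simp
      also have "esum (pw k) ((u # us) @ rev (?F B)) = esum (pw k) (u # us) + pw k (last (u # us)) (last B) + esum (pw k) (?F B)"
        using esum_append[of "u # us" "rev (?F B)" "pw k"] rF h rn by simp
      finally show ?thesis unfolding us using esum_append[of "u # us" "[last B]" "pw k"] by simp
    qed
  qed
  then have "cover_cost (pw k) l qs = cover_cost (pw k) l (map ?F (A # B # rs)) - l
      + esum (pw k) (last A # map fst ps @ [last B])"
    by (simp add: qs_def)
  also have "cover_cost (pw k) l (map ?F (A # B # rs)) \<le> cover_cost (pw k) l (A # B # rs)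
      + (\<Sum>(u,q)\<leftarrow>filter (\<lambda>(u,q). u \<in> C) (concat (map (mids d) (A # B # rs))). (2 * q) ^ k)"
    by (rule filter_cover_cost) (use dist CX in auto)
  also have "(\<Sum>(u,q)\<leftarrow>filter (\<lambda>(u,q). u \<in> C) (concat (map (mids d) (A # B # rs))). (2 * q) ^ k) = (\<Sum>(u,q)\<leftarrow>ps. (2 * q) ^ k)"
    unfolding C_def by (rule sum_list_filter_mids) (use dist ps' ps in auto)
  finally show ?thesis by simp
qed

text \<open>The exchange with an empty chain: two closer ends would be joined directly.\<close>

lemma lasts_separated:
  assumes "opt_cover (pw k) (r ^ k) X pss" "A \<in> set pss" "B \<in> set pss" "A \<noteq> B" "k > 0"
  shows "r \<le> d (last A) (last B)"
proof -
  have "r ^ k \<le> d (last A) (last B) ^ k"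
    using exchange_distinct[OF assms(1-4), of "[]"] by simp
  then show ?thesis using power_le_imp_le_base[of r "k - 1"] assms(5) d_nonneg by simp
qed

text \<open>A chain picked along a line may visit a vertex twice. Cutting out the loop between two
  visits keeps both ends of the chain and does not raise its cost, which reduces the claim to
  distinct vertices.\<close>

lemma exchange:
  assumes opt: "opt_cover (pw k) l X pss" and A: "A \<in> set pss" and B: "B \<in> set pss" and "A \<noteq> B"
    and ps: "set ps \<subseteq> midset pss" "ps \<noteq> []"
  shows "l \<le> pw k (last A) (fst (hd ps)) + walk_cost k ps + pw k (fst (last ps)) (last B)"
  using ps
proof (induction "length ps" arbitrary: ps rule: less_induct)
  case less
  have q: "q \<ge> 0" if "(u, q) \<in> set ps" for u q
  proof -
    have "(u, q) \<in> midset pss" using that less.prems by auto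
    then show ?thesis using mids_weight_nonneg unfolding midset_def by blast
  qed
  show ?case
  proof (cases "distinct ps")
    case True
    have "distinct (map fst ps)"
      using True less.prems(1) inj_on_midset[of pss] opt
      by (auto simp: distinct_map opt_cover_def path_cover_def intro: inj_on_subset)
    from exchange_distinct[OF opt A B \<open>A \<noteq> B\<close> less.prems(1) this]
    have "l \<le> esum (pw k) (last A # map fst ps @ [last B]) + (\<Sum>(u,q)\<leftarrow>ps. (2 * q) ^ k)" .
    moreover obtain u us where us: "map fst ps = u # us" using less.prems(2) by (cases ps) auto
    moreover have "fst (hd ps) = u" "fst (last ps) = last (u # us)"
      using us less.prems(2) last_map[of ps fst] by (cases ps; simp)+
    ultimately show ?thesis
      using esum_append[of "u # us" "[last B]" "pw k"] by (simp add: walk_cost_def)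
  next
    case False
    then obtain xs ys zs a where dec: "ps = xs @ [a] @ ys @ [a] @ zs"
      using not_distinct_decomp by blast
    define ps' where "ps' = xs @ [a] @ zs"
    have "l \<le> pw k (last A) (fst (hd ps')) + walk_cost k ps' + pw k (fst (last ps')) (last B)"
      by (rule less.hyps) (use less.prems dec in \<open>auto simp: ps'_def\<close>)
    moreover have "hd ps' = hd ps" "last ps' = last ps" by (auto simp: dec ps'_def hd_append)
    moreover have "walk_cost k ps' \<le> walk_cost k ps"
    proof -
      let ?f = "map fst"
      have nn: "esum (pw k) zs \<ge> 0" for zs by (rule esum_nonneg) (simp add: d_nonneg)
      have e1: "esum (pw k) (?f xs @ fst a # vs) = esum (pw k) (?f xs @ [fst a]) + esum (pw k) (fst a # vs)" for vs
        using esum_append[of "?f xs" "fst a # vs" "pw k"] esum_append[of "?f xs" "[fst a]" "pw k"]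
        by (cases "xs = []") auto
      have e2: "esum (pw k) ((fst a # ?f ys) @ fst a # ?f zs) \<ge> esum (pw k) (fst a # ?f zs)"
        using esum_append[of "fst a # ?f ys" "fst a # ?f zs" "pw k"] nn d_nonneg
        by (simp add: add_nonneg_nonneg)
      have "(\<Sum>(u,q)\<leftarrow>ys @ [a]. (2 * q) ^ k) \<ge> 0"
      proof (rule sum_list_nonneg)
        fix x assume "x \<in> set (map (\<lambda>(u,q). (2 * q) ^ k) (ys @ [a]))"
        then obtain v where v: "v \<in> set (ys @ [a])" "x = (2 * snd v) ^ k"
          unfolding case_prod_beta set_map by blast
        then have "v \<in> set ps" unfolding dec by auto
        with v(2) show "0 \<le> x" using q[of "fst v" "snd v"] by simp
      qed
      then show ?thesis
        using e1[of "?f zs"] e1[of "?f ys @ fst a # ?f zs"] e2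
        unfolding walk_cost_def ps'_def dec map_append sum_list_append append_Cons append_Nil list.map append_assoc sum_list.Cons
        by simp
    qed
    ultimately show ?thesis by simp
  qed
qed

end

section \<open>The gap function of a path cover\<close>

context semimetric
begin

text \<open>
  The substitute for the distance to \<open>X\<close>: a deletable vertex
  at distance less than \<open>gap\<close> has an edge of length at least \<open>gap\<close>, so that rerouting
  through it is not cheap.
\<close>

definition gap :: "real \<Rightarrow> 'a list list \<Rightarrow> 'a \<Rightarrow> real" where
  "gap r pss z = Min (insert r ((\<lambda>(u, q). max (d z u) q) ` midset pss))"

lemma gap_le: "gap r pss z \<le> r"
  unfolding gap_def using finite_midset by (intro Min_le) auto

lemma gap_le_mid: "(u, q) \<in> midset pss \<Longrightarrow> gap r pss z \<le> max (d z u) q"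
  unfolding gap_def using finite_midset by (intro Min_le) auto

lemma gap_cases:
  obtains "gap r pss z = r" | u q where "(u, q) \<in> midset pss" "gap r pss z = max (d z u) q"
proof -
  have "gap r pss z \<in> insert r ((\<lambda>(u, q). max (d z u) q) ` midset pss)"
    unfolding gap_def using finite_midset by (intro Min_in) auto
  then show ?thesis using that by auto
qed

lemma gap_nonneg: "r \<ge> 0 \<Longrightarrow> gap r pss z \<ge> 0"
  by (rule gap_cases[of r pss z]) (auto simp: le_max_iff_disj d_nonneg)

lemma gap_lipschitz: "gap r pss z \<le> gap r pss w + d z w"
proof (rule gap_cases[of r pss w])
  assume "gap r pss w = r"
  then show ?thesis using gap_le[of r pss z] d_nonneg[of z w] by simp
next
  fix u q assume u: "(u, q) \<in> midset pss" "gap r pss w = max (d w u) q"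
  have "gap r pss z \<le> max (d z u) q" by (rule gap_le_mid[OF u(1)])
  also have "\<dots> \<le> max (d w u) q + d z w" using d_tri[of z u w] d_nonneg[of z w] by auto
  finally show ?thesis using u(2) by simp
qed

text \<open>The vertices after the first come in pairs of a deletable vertex \<open>u\<close> and
  its successor \<open>y\<close>. Both have gap at most the weight \<open>q\<close> of
  \<open>u\<close>, because \<open>y\<close> is itself within \<open>q\<close> of \<open>u\<close>.
  So every edge is charged at most twice, and a vertex left over at the end pays
  \<open>r ^ n\<close>.\<close>

lemma sum_list_gap_path:
  assumes "set (mids d p) \<subseteq> midset pss" "r \<ge> 0"
  shows "(\<Sum>x\<leftarrow>tl p. gap r pss x ^ n) \<le> r ^ n + 2 * esum (pw n) p"
  using assms(1)
proof (induction p rule: induct_list012)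
  case (3 x u zs)
  show ?case
  proof (cases zs)
    case Nil
    have "gap r pss u ^ n \<le> r ^ n"
      by (intro power_mono gap_le gap_nonneg assms)
    then show ?thesis using Nil zero_le_power[OF d_nonneg[of x u], of n] by simp
  next
    case (Cons y ys)
    define q where "q = max (d x u) (d u y)"
    have uq: "(u, q) \<in> midset pss" using "3.prems" Cons by (simp add: q_def)
    have IH: "(\<Sum>x\<leftarrow>ys. gap r pss x ^ n) \<le> r ^ n + 2 * esum (pw n) (y # ys)"
      using "3.IH"(1) "3.prems" Cons by simp
    have "gap r pss u \<le> q" "gap r pss y \<le> q"
      using gap_le_mid[OF uq, of r u] gap_le_mid[OF uq, of r y] d_self[of u] d_sym[of y u] d_nonneg[of x u]
      by (auto simp: q_def)
    then have "gap r pss u ^ n \<le> q ^ n" "gap r pss y ^ n \<le> q ^ n"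
      by (auto intro!: power_mono gap_nonneg assms)
    moreover have "q ^ n \<le> pw n x u + pw n u y"
      using zero_le_power[OF d_nonneg[of x u], of n] zero_le_power[OF d_nonneg[of u y], of n]
      by (auto simp: q_def max_def)
    ultimately show ?thesis using IH Cons by simp
  qed
qed (use assms(2) in auto)

lemma sum_gap_le:
  assumes "path_cover X pss" "r \<ge> 0"
  shows "(\<Sum>x\<in>X. gap r pss x ^ n) \<le> 2 * r ^ n * length pss + 2 * (\<Sum>p\<leftarrow>pss. esum (pw n) p)"
proof -
  have *: "(\<Sum>x\<leftarrow>p. gap r pss x ^ n) \<le> 2 * r ^ n + 2 * esum (pw n) p" if "p \<in> set pss" for p
  proof -
    have "p \<noteq> []" using that assms by (auto simp: path_cover_def)
    then have "(\<Sum>x\<leftarrow>p. gap r pss x ^ n) = gap r pss (hd p) ^ n + (\<Sum>x\<leftarrow>tl p. gap r pss x ^ n)"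
      by (cases p) auto
    also have "gap r pss (hd p) ^ n \<le> r ^ n" by (intro power_mono gap_le gap_nonneg assms)
    also have "(\<Sum>x\<leftarrow>tl p. gap r pss x ^ n) \<le> r ^ n + 2 * esum (pw n) p"
      by (rule sum_list_gap_path) (use that assms in \<open>auto simp: midset_def\<close>)
    finally show ?thesis by simp
  qed
  have "(\<Sum>x\<in>X. gap r pss x ^ n) = (\<Sum>x\<leftarrow>concat pss. gap r pss x ^ n)"
    using assms(1) by (auto simp: path_cover_def sum_list_distinct_conv_sum_set)
  also have "\<dots> = (\<Sum>p\<leftarrow>pss. \<Sum>x\<leftarrow>p. gap r pss x ^ n)"
  proof -
    have "(\<Sum>x\<leftarrow>concat qss. f x) = (\<Sum>p\<leftarrow>qss. \<Sum>x\<leftarrow>p. f x)" for f :: "'a \<Rightarrow> real" and qss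
      by (induction qss) auto
    then show ?thesis .
  qed
  also have "\<dots> \<le> (\<Sum>p\<leftarrow>pss. 2 * r ^ n + 2 * esum (pw n) p)"
    by (rule sum_list_mono) (rule *)
  also have "\<dots> = 2 * r ^ n * length pss + 2 * (\<Sum>p\<leftarrow>pss. esum (pw n) p)"
    by (simp add: sum_list_addf sum_list_triv sum_list_const_mult)
  finally show ?thesis .
qed

end

section \<open>Gaps along a line\<close>

text \<open>The line enters only as an isometric copy of the reals. Positive weights
  \<open>mid_pos\<close> bound the steps of a chain from below, so that walking along the line
  terminates.\<close>

locale semimetric_line = semimetric +
  fixes z :: "real \<Rightarrow> 'a" and r :: real and k :: nat and X :: "'a set" and pss :: "'a list list"
  assumes line: "d (z s) (z t) = \<bar>s - t\<bar>" and r_pos: "r > 0" and k2: "k \<ge> 2"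
    and opt: "opt_cover (\<lambda>x y. d x y ^ k) (r ^ k) X pss"
    and mid_pos: "(u, q) \<in> midset pss \<Longrightarrow> q > 0"
begin

abbreviation "g \<equiv> \<lambda>s. gap r pss (z s)"
text \<open>The mesh of a fine chain: an end within 0.48 r of the line then reaches a chain vertex
  at distance at most 0.48 r + 2 h = 0.49 r.\<close>

abbreviation "h \<equiv> r / 200"
abbreviation "near \<equiv> \<lambda>s. \<exists>v\<in>X. d (z s) v \<le> r"
abbreviation "W \<equiv> \<lambda>s. ennreal (g s * indicator {s. near s} s)"

lemma h_less_r: "h < r"
  using r_pos by simp

lemma g_lip: "\<bar>g s - g t\<bar> \<le> \<bar>s - t\<bar>"
  using gap_lipschitz[of r pss "z s" "z t"] gap_lipschitz[of r pss "z t" "z s"] line[of s t] line[of t s]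
  by linarith

lemma g_cont: "continuous_on A g"
proof (rule continuous_on_subset)
  show "continuous_on UNIV g"
    unfolding continuous_on_iff dist_real_def
    using g_lip by (meson order_le_less_trans)
qed simp

lemma g_borel [measurable]: "g \<in> borel_measurable borel"
  using borel_measurable_continuous_onI[OF g_cont] .

lemma mid_in_X: "(u, q) \<in> midset pss \<Longrightarrow> u \<in> X"
proof -
  assume "(u, q) \<in> midset pss"
  then obtain p where p: "p \<in> set pss" "(u, q) \<in> set (mids d p)" by (auto simp: midset_def)
  have "u \<in> set (tl p)" using mids_in_tl[of d p] p(2) by force
  then have "u \<in> set p" by (cases p) auto
  then show "u \<in> X" using p(1) opt by (auto simp: opt_cover_def path_cover_def)
qed

lemma g_less_mid:
  assumes "g s < r"
  obtains u q where "(u, q) \<in> midset pss" "g s = max (d (z s) u) q"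
  using gap_cases[of r pss "z s"] assms by auto

lemma near_of_g: "g s < r \<Longrightarrow> \<exists>v\<in>X. d (z s) v \<le> g s"
proof -
  assume "g s < r"
  then obtain u q where "(u, q) \<in> midset pss" "g s = max (d (z s) u) q" by (rule g_less_mid)
  then show ?thesis using mid_in_X[of u q] by (intro bexI[of _ u]) auto
qed

lemma finite_X: "finite X"
  using opt by (auto simp: opt_cover_def path_cover_def)

lemma near_borel [measurable]: "{s. near s} \<in> sets borel"
proof -
  have "continuous_on UNIV (\<lambda>s. d (z s) v)" for v
    unfolding continuous_on_iff dist_real_def
  proof (intro ballI allI impI)
    fix x e :: real assume "0 < e"
    have "\<bar>d (z x') v - d (z x) v\<bar> \<le> \<bar>x' - x\<bar>" for x'
      using d_tri[of "z x'" v "z x"] d_tri[of "z x" v "z x'"] line[of x x'] line[of x' x] by linarith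
    then show "\<exists>da>0. \<forall>x'\<in>UNIV. \<bar>x' - x\<bar> < da \<longrightarrow> \<bar>d (z x') v - d (z x) v\<bar> < e"
      using \<open>0 < e\<close> by (meson order_le_less_trans)
  qed
  then have "closed {s. d (z s) v \<le> r}" for v
    by (intro closed_Collect_le) auto
  then have "closed (\<Union>v\<in>X. {s. d (z s) v \<le> r})"
    by (intro closed_UN finite_X) auto
  moreover have "{s. near s} = (\<Union>v\<in>X. {s. d (z s) v \<le> r})" by auto
  ultimately show ?thesis by auto
qed

lemma nn_integral_lower:
  fixes F :: "real \<Rightarrow> ennreal"
  assumes "a \<le> b" "c \<ge> 0" "\<And>x. x \<in> {a..<b} \<Longrightarrow> F x \<ge> ennreal c" "{a..<b} \<subseteq> S"
  shows "ennreal (c * (b - a)) \<le> (\<integral>\<^sup>+x\<in>S. F x \<partial>lborel)"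
proof -
  have "ennreal (c * (b - a)) = (\<integral>\<^sup>+x. ennreal c * indicator {a..<b} x \<partial>lborel)"
    using assms(1,2) by (subst nn_integral_cmult_indicator) (auto simp: ennreal_mult)
  also have "\<dots> \<le> (\<integral>\<^sup>+x\<in>S. F x \<partial>lborel)"
    using assms(3,4) by (intro nn_integral_mono) (auto simp: indicator_def)
  finally show ?thesis .
qed

text \<open>Walk along the line with step \<open>e / 2\<close>, where \<open>e\<close> is the
  current gap. The gap changes by at most \<open>e / 2\<close>, so consecutive chosen vertices are
  at most \<open>3 * e\<close> apart, and moving one of them costs at most
  \<open>2 * 3 ^ k * e ^ k\<close>. Over the step the integral of the gap is at least
  \<open>e\<^sup>2 / 4\<close>, and \<open>e < h\<close> turns the other k - 2 factors into powers
  of \<open>h\<close>. The deletion of the final vertex is the separate term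
  \<open>(2 * h) ^ k\<close>.\<close>

lemma chain:
  assumes "s \<le> t" "\<And>x. x \<in> {s..t} \<Longrightarrow> g x < h"
    and "(u, q) \<in> midset pss" "g s = max (d (z s) u) q"
  shows "\<exists>ps. ps \<noteq> [] \<and> set ps \<subseteq> midset pss \<and> hd ps = (u, q) \<and> d (z t) (fst (last ps)) \<le> 2 * h \<and>
     ennreal (walk_cost k ps) \<le> ennreal (8 * 3 ^ k * h ^ (k - 2)) * (\<integral>\<^sup>+x\<in>{s..<t}. ennreal (g x) \<partial>lborel) + ennreal ((2 * h) ^ k)"
proof -
  \<comment> \<open>Every gap below \<open>r\<close> is at least the least weight, so each step
    advances by at least \<open>q0 / 2\<close>; the induction is on the number of such steps. The
    inserted 1 only covers an empty \<open>midset\<close>.\<close>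
  define q0 where "q0 = Min (insert 1 (snd ` midset pss))"
  have q0: "q0 > 0" "\<And>u q. (u, q) \<in> midset pss \<Longrightarrow> q0 \<le> q"
  proof -
    show "q0 > 0" unfolding q0_def using finite_midset mid_pos by (subst Min_gr_iff) auto
    show "q0 \<le> q" if "(u, q) \<in> midset pss" for u q
      unfolding q0_def using that finite_midset by (intro Min_le) (auto intro: rev_image_eqI)
  qed
  obtain N :: nat where "t - s \<le> N * (q0 / 2)"
    using reals_Archimedean3[of "q0/2"] q0(1) less_imp_le by (metis half_gt_zero)
  then show ?thesis using assms
  proof (induction N arbitrary: s u q)
    case 0
    then have "t = s" by simp
    then have "g s < h" "d (z t) u \<le> g s" "q \<le> g s" using 0 by auto
    moreover have "q > 0" using mid_pos 0 by blast
    ultimately have le: "2 * q \<le> 2 * h" "0 \<le> 2 * q" "d (z t) u \<le> 2 * h" using r_pos by linarith+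
    then have "(2 * q) ^ k \<le> (2 * h) ^ k" by (intro power_mono)
    with le(3) show ?case using 0
      by (intro exI[of _ "[(u, q)]"]) (auto simp: walk_cost_def intro!: add_increasing ennreal_leI)
  next
    case (Suc N)
    define e where "e = g s"
    have eh: "e < h" using Suc.prems(3)[of s] Suc.prems(2) by (simp add: e_def)
    have du: "d (z s) u \<le> e" and qe: "q \<le> e" using Suc.prems by (auto simp: e_def)
    have qpos: "q > 0" using mid_pos Suc.prems by blast
    have q0e: "q0 \<le> e" using q0(2) Suc.prems qe by fastforce
    show ?case
    proof (cases "t - s < e / 2")
      case True
      have "d (z t) u \<le> d (z t) (z s) + d (z s) u" by (rule d_tri)
      then have "d (z t) u \<le> 2 * h" using True du eh line[of t s] Suc.prems(2) by simp
      moreover have "(2 * q) ^ k \<le> (2 * h) ^ k" using qe qpos eh by (intro power_mono) auto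
      ultimately show ?thesis using Suc.prems
        by (intro exI[of _ "[(u, q)]"]) (auto simp: walk_cost_def intro!: add_increasing ennreal_leI)
    next
      case False
      define s' where "s' = s + e / 2"
      have s': "s \<le> s'" "s' \<le> t" using False qe qpos by (auto simp: s'_def)
      have gs': "g s' \<le> 3 / 2 * e" 
      proof -
        have "\<bar>s' - s\<bar> = e / 2" using qe qpos by (simp add: s'_def)
        then show ?thesis using g_lip[of s' s] by (simp add: e_def abs_le_iff)
      qed
      have "g s' < h" using Suc.prems(3) s' by simp
      then obtain u' q' where u': "(u', q') \<in> midset pss" "g s' = max (d (z s') u') q'"
        using g_less_mid[of s'] by (metis h_less_r order_less_trans)
      have "\<exists>ps. ps \<noteq> [] \<and> set ps \<subseteq> midset pss \<and> hd ps = (u', q') \<and> d (z t) (fst (last ps)) \<le> 2 * h \<and>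
         ennreal (walk_cost k ps) \<le> ennreal (8 * 3 ^ k * h ^ (k - 2)) * (\<integral>\<^sup>+x\<in>{s'..<t}. ennreal (g x) \<partial>lborel) + ennreal ((2 * h) ^ k)"
      proof (rule Suc.IH)
        show "t - s' \<le> real N * (q0 / 2)" using Suc.prems(1) q0e by (simp add: s'_def algebra_simps)
        show "s' \<le> t" by fact
        show "g x < h" if "x \<in> {s'..t}" for x using Suc.prems(3) that s' by auto
      qed (use u' in auto)
      then obtain ps where ps: "ps \<noteq> []" "set ps \<subseteq> midset pss" "hd ps = (u', q')"
        "d (z t) (fst (last ps)) \<le> 2 * h"
        "ennreal (walk_cost k ps) \<le> ennreal (8 * 3 ^ k * h ^ (k - 2)) * (\<integral>\<^sup>+x\<in>{s'..<t}. ennreal (g x) \<partial>lborel) + ennreal ((2 * h) ^ k)"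
        by blast
      obtain ps' where psc: "ps = (u', q') # ps'" using ps(1,3) by (cases ps) auto
      have w: "walk_cost k ((u, q) # ps) = pw k u u' + (2 * q) ^ k + walk_cost k ps"
        by (simp add: walk_cost_def psc)
      have "d u u' \<le> d u (z s) + d (z s) (z s') + d (z s') u'"
        using d_tri[of u u' "z s"] d_tri[of "z s" u' "z s'"] by simp
      then have "d u u' \<le> 3 * e"
        using du gs' u'(2) line[of s s'] d_sym[of u "z s"] s'(1) by (auto simp: s'_def)
      then have "pw k u u' \<le> (3 * e) ^ k" by (intro power_mono d_nonneg)
      moreover have "(2 * q) ^ k \<le> (3 * e) ^ k" using qe qpos by (intro power_mono) auto
      ultimately have "pw k u u' + (2 * q) ^ k \<le> 2 * 3 ^ k * e ^ k" by (simp add: power_mult_distrib)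
      also have "e ^ k = e ^ (k - 2) * e\<^sup>2" using k2 by (metis le_add_diff_inverse2 power_add)
      also have "2 * 3 ^ k * (e ^ (k - 2) * e\<^sup>2) \<le> 2 * 3 ^ k * (h ^ (k - 2) * e\<^sup>2)"
      proof -
        have "e ^ (k - 2) * e\<^sup>2 \<le> h ^ (k - 2) * e\<^sup>2"
          using eh qe qpos by (intro mult_right_mono power_mono) auto
        then show ?thesis by simp
      qed
      finally have c: "pw k u u' + (2 * q) ^ k \<le> (8 * 3 ^ k * h ^ (k - 2)) * (e / 2 * (s' - s))"
        by (simp add: s'_def power2_eq_square algebra_simps)
      have I0: "ennreal (e / 2 * (s' - s)) \<le> (\<integral>\<^sup>+x\<in>{s..<s'}. ennreal (g x) \<partial>lborel)"
      proof (rule nn_integral_lower)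
        show "ennreal (e / 2) \<le> ennreal (g x)" if "x \<in> {s..<s'}" for x
        proof (rule ennreal_leI)
          have "\<bar>s - x\<bar> \<le> e / 2" using that by (auto simp: s'_def)
          then show "e / 2 \<le> g x" using g_lip[of s x] unfolding e_def by linarith
        qed
      qed (use s' qe qpos in auto)
      have I1: "ennreal (pw k u u' + (2 * q) ^ k) \<le> ennreal (8 * 3 ^ k * h ^ (k - 2)) * (\<integral>\<^sup>+x\<in>{s..<s'}. ennreal (g x) \<partial>lborel)"
      proof -
        have "ennreal (pw k u u' + (2 * q) ^ k) \<le> ennreal (8 * 3 ^ k * h ^ (k - 2)) * ennreal (e / 2 * (s' - s))"
          using ennreal_leI[OF c] r_pos s'(1) qe qpos by (subst (asm) ennreal_mult) auto
        also have "\<dots> \<le> ennreal (8 * 3 ^ k * h ^ (k - 2)) * (\<integral>\<^sup>+x\<in>{s..<s'}. ennreal (g x) \<partial>lborel)"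
          by (rule mult_left_mono[OF I0]) simp
        finally show ?thesis .
      qed
      have split: "(\<integral>\<^sup>+x\<in>{s..<t}. ennreal (g x) \<partial>lborel) = (\<integral>\<^sup>+x\<in>{s..<s'}. ennreal (g x) \<partial>lborel) + (\<integral>\<^sup>+x\<in>{s'..<t}. ennreal (g x) \<partial>lborel)"
        using s' by (subst nn_integral_add[symmetric]) (auto intro!: nn_integral_cong simp: indicator_def)
      have wn: "walk_cost k ps \<ge> 0"
      proof -
        have "(\<Sum>(u,q)\<leftarrow>ps. (2 * q) ^ k) \<ge> 0"
        proof (rule sum_list_nonneg)
          fix x assume "x \<in> set (map (\<lambda>(u,q). (2 * q) ^ k) ps)"
          then obtain v w where "(v, w) \<in> midset pss" "x = (2 * w) ^ k" using ps(2) by auto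
          then show "0 \<le> x" using mid_pos[of v w] by simp
        qed
        then show ?thesis using esum_nonneg[of "pw k" "map fst ps"] d_nonneg by (simp add: walk_cost_def)
      qed
      have "ennreal (walk_cost k ((u, q) # ps)) = ennreal (pw k u u' + (2 * q) ^ k) + ennreal (walk_cost k ps)"
        unfolding w using wn d_nonneg qpos by (subst ennreal_plus) auto
      also have "\<dots> \<le> ennreal (8 * 3 ^ k * h ^ (k - 2)) * (\<integral>\<^sup>+x\<in>{s..<t}. ennreal (g x) \<partial>lborel) + ennreal ((2 * h) ^ k)"
        unfolding split distrib_left using add_mono[OF I1 ps(5)] by (simp add: ac_simps)
      finally show ?thesis
        by (intro exI[of _ "(u, q) # ps"]) (use ps Suc.prems in auto)
    qed
  qed
qed

text \<open>At the first point where the gap reaches \<open>h\<close>, the gap is at least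
  \<open>h / 2\<close> on both sides up to distance \<open>h / 2\<close>. The points there also
  count for \<open>W\<close>, being within \<open>r\<close> of X: just before the hit the gap is
  below \<open>h\<close>, so X is close, and if the hit is at \<open>a\<close> itself then
  \<open>v\<close> is close.\<close>

lemma hit:
  assumes "a + h \<le> T" "s \<in> {a..T}" "g s \<ge> h" "v \<in> X" "d (z a) v \<le> 12 / 25 * r"
  shows "ennreal (h\<^sup>2 / 4) \<le> (\<integral>\<^sup>+x\<in>{a..<T}. W x \<partial>lborel)"
proof -
  define S where "S = {x\<in>{a..T}. h \<le> g x}"
  have "closed S"
    unfolding S_def using continuous_closed_preimage[OF g_cont, of "{a..T}" "{h..}"]
    by (simp add: vimage_def Int_def)
  moreover have ne: "S \<noteq> {}" "bdd_below S" using assms by (auto simp: S_def intro: bdd_belowI[of _ a])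
  ultimately have s0: "Inf S \<in> S" by (intro closed_contains_Inf)
  define s0 where "s0 = Inf S"
  have low: "g x < h" if "x \<in> {a..<s0}" for x
  proof (rule ccontr)
    assume "\<not> g x < h"
    then have "x \<in> S" using that s0 by (auto simp: S_def s0_def)
    then show False using cInf_lower[OF _ ne(2)] that by (fastforce simp: s0_def)
  qed
  have s0: "s0 \<in> {a..T}" "h \<le> g s0" using s0 by (auto simp: S_def s0_def)
  have near: "near x" if x: "\<bar>x - s0\<bar> \<le> h / 2" for x
  proof (cases "s0 = a")
    case True
    have "d (z x) v \<le> d (z x) (z a) + d (z a) v" by (rule d_tri)
    then have "d (z x) v \<le> r" using line[of x a] True x assms(5) r_pos by simp
    then show ?thesis using assms(4) by auto
  next
    case False
    define y where "y = max a (s0 - h / 2)"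
    have y: "y \<in> {a..<s0}" using False s0 r_pos by (auto simp: y_def)
    moreover have "\<bar>x - y\<bar> \<le> \<bar>x - s0\<bar> + (s0 - y)" using y by auto
    moreover have "s0 - y \<le> h / 2" using r_pos by (simp add: y_def max_def)
    ultimately have y: "y \<in> {a..<s0}" "\<bar>x - y\<bar> \<le> h" using x by simp_all
    have "g y < h" using low y by simp
    then obtain v where v: "v \<in> X" "d (z y) v \<le> h" using near_of_g[of y] r_pos by fastforce
    have "d (z x) v \<le> d (z x) (z y) + d (z y) v" by (rule d_tri)
    then have "d (z x) v \<le> r" using line[of x y] y(2) v r_pos by simp
    then show ?thesis using v by auto
  qed
  have big: "W x \<ge> ennreal (h / 2)" if x: "\<bar>x - s0\<bar> \<le> h / 2" for x
  proof -
    have "h / 2 \<le> g x" using g_lip[of s0 x] s0(2) x abs_minus_commute[of s0 x] by linarith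
    then show ?thesis using near[OF x] by (intro ennreal_leI) (simp add: indicator_def)
  qed
  \<comment> \<open>An interval of length \<open>h / 2\<close> after the hit, or before it if
    \<open>T\<close> is too near; \<open>a + h \<le> T\<close> leaves room for one of the
    two.\<close>
  define b where "b = (if s0 + h / 2 \<le> T then s0 else s0 - h / 2)"
  have "ennreal (h / 2 * (b + h / 2 - b)) \<le> (\<integral>\<^sup>+x\<in>{a..<T}. W x \<partial>lborel)"
  proof (rule nn_integral_lower)
    show "ennreal (h / 2) \<le> W x" if "x \<in> {b..<b + h / 2}" for x
      by (rule big) (use that r_pos in \<open>auto simp: b_def abs_le_iff split: if_splits\<close>)
    show "{b..<b + h / 2} \<subseteq> {a..<T}"
      using s0(1) assms(1) r_pos by (auto simp: b_def)
  qed (use r_pos in auto)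
  then show ?thesis by (simp add: power2_eq_square)
qed

text \<open>Beyond all of X the gap cannot be small, so the walk from \<open>a\<close> must hit.
  This pays for the last end on a line, which has no successor.\<close>

lemma ray:
  assumes "v \<in> X" "d (z a) v \<le> 12 / 25 * r"
  shows "ennreal (h\<^sup>2 / 4) \<le> (\<integral>\<^sup>+x\<in>{a..}. W x \<partial>lborel)"
proof -
  define R where "R = Max (insert 0 ((\<lambda>u. d (z a) u) ` X))"
  have R: "R \<ge> 0" "\<And>u. u \<in> X \<Longrightarrow> d (z a) u \<le> R"
    unfolding R_def using finite_X by auto
  define s where "s = a + R + h"
  have "g s \<ge> h"
  proof (rule ccontr)
    assume "\<not> h \<le> g s"
    then obtain v where v: "v \<in> X" "d (z s) v < h" using near_of_g[of s] r_pos by fastforce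
    have "d (z s) (z a) \<le> d (z s) v + d (z a) v" using d_tri[of "z s" "z a" v] d_sym[of v "z a"] by simp
    then show False using v(2) R(2)[OF v(1)] R(1) line[of s a] r_pos by (simp add: s_def)
  qed
  then have "ennreal (h\<^sup>2 / 4) \<le> (\<integral>\<^sup>+x\<in>{a..<s + h}. W x \<partial>lborel)"
    by (intro hit[of a _ s v] assms) (use R(1) r_pos in \<open>auto simp: s_def\<close>)
  also have "\<dots> \<le> (\<integral>\<^sup>+x\<in>{a..}. W x \<partial>lborel)"
    by (intro nn_integral_mono) (auto simp: indicator_def)
  finally show ?thesis .
qed

text \<open>If the gap reaches \<open>h\<close> between \<open>a\<close> and \<open>b\<close>,
  \<open>hit\<close> applies. Otherwise a chain runs from \<open>a\<close> to \<open>b\<close>, and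
  a small integral would make it cheap: with two hops of length at most 0.49 r the exchange would
  cost at most \<open>2 * (49 / 100) ^ k + 2 * (3 / 200) ^ k + (1 / 100) ^ k\<close> times
  \<open>r ^ k\<close>, which is too little already for \<open>k = 2\<close>.\<close>

lemma segment:
  assumes A: "A \<in> set pss" and B: "B \<in> set pss" and "A \<noteq> B" and "a < b"
    and dA: "d (z a) (last A) \<le> 12 / 25 * r" and dB: "d (z b) (last B) \<le> 12 / 25 * r"
  shows "ennreal (h\<^sup>2 / 4) \<le> (\<integral>\<^sup>+x\<in>{a..<b}. W x \<partial>lborel)"
proof -
  have lastX: "last p \<in> X" if "p \<in> set pss" for p
    using path_cover_last_in(2) that opt by (auto simp: opt_cover_def)
  have sep: "r \<le> d (last A) (last B)"
    by (rule lasts_separated[OF opt A B \<open>A \<noteq> B\<close>]) (use k2 in simp)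
  have "d (last A) (last B) \<le> d (z a) (last A) + d (z a) (z b) + d (z b) (last B)"
    using d_tri[of "last A" "last B" "z a"] d_tri[of "z a" "last B" "z b"] d_sym[of "last A" "z a"] by simp
  \<comment> \<open>Ends are \<open>r\<close> apart and each is within 0.48 r of its point on the
    line, so these points are at least 0.04 r apart.\<close>
  then have ab: "a + h \<le> b" using sep dA dB line[of a b] \<open>a < b\<close> r_pos by simp
  show ?thesis
  proof (cases "\<exists>s\<in>{a..b}. g s \<ge> h")
    case True
    then show ?thesis using hit[OF ab _ _ lastX[OF A] dA] by blast
  next
    case False
    then have low: "g x < h" if "x \<in> {a..b}" for x using that by force
    show ?thesis
    proof (rule ccontr)
      assume less: "\<not> ?thesis"
      have near: "near x" if "x \<in> {a..b}" for x
      proof -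
        have "g x < r" using low[OF that] r_pos by simp
        then show ?thesis using near_of_g[of x] by force
      qed
      have "(\<integral>\<^sup>+x\<in>{a..<b}. W x \<partial>lborel) = (\<integral>\<^sup>+x\<in>{a..<b}. ennreal (g x) \<partial>lborel)"
        using near by (intro nn_integral_cong) (auto simp: indicator_def)
      with less have I: "(\<integral>\<^sup>+x\<in>{a..<b}. ennreal (g x) \<partial>lborel) \<le> ennreal (h\<^sup>2 / 4)" by simp
      have ga: "g a < h" using low \<open>a < b\<close> by simp
      then obtain u q where u: "(u, q) \<in> midset pss" "g a = max (d (z a) u) q"
        using g_less_mid[of a] r_pos by (metis h_less_r order_less_trans)
      obtain ps where ps: "ps \<noteq> []" "set ps \<subseteq> midset pss" "hd ps = (u, q)" "d (z b) (fst (last ps)) \<le> 2 * h"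
        "ennreal (walk_cost k ps) \<le> ennreal (8 * 3 ^ k * h ^ (k - 2)) * (\<integral>\<^sup>+x\<in>{a..<b}. ennreal (g x) \<partial>lborel) + ennreal ((2 * h) ^ k)"
        using chain[of a b u q] low u \<open>a < b\<close> by auto
      note ps(5)
      also have "ennreal (8 * 3 ^ k * h ^ (k - 2)) * (\<integral>\<^sup>+x\<in>{a..<b}. ennreal (g x) \<partial>lborel) + ennreal ((2 * h) ^ k)
          \<le> ennreal (8 * 3 ^ k * h ^ (k - 2)) * ennreal (h\<^sup>2 / 4) + ennreal ((2 * h) ^ k)"
        by (intro add_right_mono mult_left_mono I) simp
      also have "\<dots> = ennreal (8 * 3 ^ k * h ^ (k - 2) * (h\<^sup>2 / 4) + (2 * h) ^ k)"
        using r_pos by (subst ennreal_mult[symmetric]) (auto simp: ennreal_plus[symmetric] simp del: ennreal_plus)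
      finally have "walk_cost k ps \<le> 8 * 3 ^ k * h ^ (k - 2) * (h\<^sup>2 / 4) + (2 * h) ^ k"
        using r_pos by (subst (asm) ennreal_le_iff) (auto intro!: add_nonneg_nonneg)
      also have "8 * 3 ^ k * h ^ (k - 2) * (h\<^sup>2 / 4) = 2 * 3 ^ k * (h ^ (k - 2) * h\<^sup>2)" by simp
      also have "h ^ (k - 2) * h\<^sup>2 = h ^ k" using k2 by (metis le_add_diff_inverse2 power_add)
      also have "2 * 3 ^ k * h ^ k + (2 * h) ^ k = (2 * (3 / 200) ^ k + (1 / 100) ^ k) * r ^ k"
      proof -
        have "3 ^ k * h ^ k = (3 / 200 * r) ^ k" by (simp flip: power_mult_distrib)
        moreover have "(2 * h) ^ k = (1 / 100 * r) ^ k" by simp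
        ultimately show ?thesis by (simp only: power_mult_distrib) (simp add: algebra_simps)
      qed
      finally have wc: "walk_cost k ps \<le> (2 * (3 / 200) ^ k + (1 / 100) ^ k) * r ^ k" .
      have "d (last A) u \<le> d (last A) (z a) + d (z a) u" by (rule d_tri)
      then have "d (last A) u \<le> 49 / 100 * r" using dA u(2) ga d_sym[of "last A" "z a"] r_pos by simp
      then have e1: "pw k (last A) u \<le> (49 / 100) ^ k * r ^ k"
        unfolding power_mult_distrib[symmetric] by (intro power_mono d_nonneg)
      have "d (fst (last ps)) (last B) \<le> d (fst (last ps)) (z b) + d (z b) (last B)" by (rule d_tri)
      then have "d (fst (last ps)) (last B) \<le> 49 / 100 * r" using dB ps(4) d_sym[of "fst (last ps)" "z b"] r_pos by simp
      then have e2: "pw k (fst (last ps)) (last B) \<le> (49 / 100) ^ k * r ^ k"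
        unfolding power_mult_distrib[symmetric] by (intro power_mono d_nonneg)
      have "r ^ k \<le> (49 / 100) ^ k * r ^ k + (2 * (3 / 200) ^ k + (1 / 100) ^ k) * r ^ k + (49 / 100) ^ k * r ^ k"
        using exchange[OF opt A B \<open>A \<noteq> B\<close> ps(2,1)] e1 e2 wc unfolding ps(3) fst_conv by linarith
      then have "1 * r ^ k \<le> (2 * (49 / 100) ^ k + 2 * (3 / 200) ^ k + (1 / 100) ^ k) * r ^ k"
        by (simp add: algebra_simps)
      then have "1 \<le> 2 * (49 / 100) ^ k + 2 * (3 / 200) ^ k + (1 / 100 :: real) ^ k"
        using r_pos by (subst (asm) mult_le_cancel_right_pos) auto
      also have "\<dots> \<le> 2 * (49 / 100)\<^sup>2 + 2 * (3 / 200)\<^sup>2 + (1 / 100 :: real)\<^sup>2"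
        using k2 by (intro add_mono mult_left_mono power_decreasing) auto
      also have "\<dots> < 1" by (simp add: power2_eq_square)
      finally show False by simp
    qed
  qed
qed

text \<open>The points \<open>y A\<close> are distinct since ends are \<open>r\<close> apart. In
  their order along the line, each but the last is charged to the segment up to the next one, and
  the last to the remaining ray.\<close>

lemma line_count:
  fixes y :: "'a list \<Rightarrow> real"
  assumes "\<A> \<subseteq> set pss" "\<And>A. A \<in> \<A> \<Longrightarrow> d (z (y A)) (last A) \<le> 12 / 25 * r"
  shows "ennreal (h\<^sup>2 / 4) * of_nat (card \<A>) \<le> (\<integral>\<^sup>+x. W x \<partial>lborel)"
proof (cases "\<A> = {}")
  case True
  then show ?thesis by simp
next
  case ne: False
  have fin: "finite \<A>" using assms(1) finite_subset by blast
  have inj: "inj_on y \<A>"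
  proof (rule inj_onI, rule ccontr)
    fix A B assume AB: "A \<in> \<A>" "B \<in> \<A>" "y A = y B" "A \<noteq> B"
    have "r \<le> d (last A) (last B)"
      by (rule lasts_separated[OF opt _ _ \<open>A \<noteq> B\<close>]) (use AB assms k2 in auto)
    moreover have "d (last A) (last B) \<le> d (z (y A)) (last A) + d (z (y A)) (last B)"
      using d_tri[of "last A" "last B" "z (y A)"] d_sym[of "last A"] by simp
    ultimately show False using assms(2)[OF AB(1)] assms(2)[OF AB(2)] AB(3) r_pos by simp
  qed
  define T where "T = y ` \<A>"
  have T: "finite T" "T \<noteq> {}" using fin ne by (auto simp: T_def)
  have pair: "ennreal (h\<^sup>2 / 4) \<le> (\<integral>\<^sup>+x\<in>{s..<t}. W x \<partial>lborel)" if "s \<in> T" "t \<in> T" "s < t" for s t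
  proof -
    obtain A B where AB: "A \<in> \<A>" "B \<in> \<A>" "s = y A" "t = y B"
      using \<open>s \<in> T\<close> \<open>t \<in> T\<close> unfolding T_def by blast
    moreover have "A \<noteq> B" using AB that by auto
    ultimately show ?thesis using segment[of A B s t] \<open>s < t\<close> assms by blast
  qed
  have top: "ennreal (h\<^sup>2 / 4) \<le> (\<integral>\<^sup>+x\<in>{s..}. W x \<partial>lborel)" if "s \<in> T" for s
  proof -
    obtain A where A: "A \<in> \<A>" "s = y A" using \<open>s \<in> T\<close> by (auto simp: T_def)
    have "A \<in> set pss" using A assms by auto
    then have "last A \<in> X" using path_cover_last_in(2) opt by (auto simp: opt_cover_def)
    then show ?thesis using ray assms(2)[OF A(1)] A(2) by blast
  qed
  have "ennreal (h\<^sup>2 / 4) * of_nat (card T) \<le> (\<integral>\<^sup>+x\<in>{Min T..}. W x \<partial>lborel)"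
    using T pair top
  proof (induction T rule: finite_linorder_min_induct)
    case (insert b T)
    show ?case
    proof (cases "T = {}")
      case True
      then show ?thesis using insert.prems by simp
    next
      case False
      have IH: "ennreal (h\<^sup>2 / 4) * of_nat (card T) \<le> (\<integral>\<^sup>+x\<in>{Min T..}. W x \<partial>lborel)"
        using insert.prems False by (intro insert.IH) auto
      have bT: "b < Min T" using insert.hyps False by simp
      have "Min (insert b T) = b" using insert.hyps False bT by simp
      moreover have "b \<notin> T" using insert.hyps by auto
      moreover have "(\<integral>\<^sup>+x\<in>{b..}. W x \<partial>lborel) = (\<integral>\<^sup>+x\<in>{b..<Min T}. W x \<partial>lborel) + (\<integral>\<^sup>+x\<in>{Min T..}. W x \<partial>lborel)"
      proof (subst nn_integral_add[symmetric])
        have "W \<in> borel_measurable borel" by measurable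
        then show "(\<lambda>x. W x * indicator {b..<Min T} x) \<in> borel_measurable lborel"
          "(\<lambda>x. W x * indicator {Min T..} x) \<in> borel_measurable lborel"
          by (auto intro!: borel_measurable_times)
      qed (use bT in \<open>auto intro!: nn_integral_cong simp: indicator_def\<close>)
      moreover have "ennreal (h\<^sup>2 / 4) \<le> (\<integral>\<^sup>+x\<in>{b..<Min T}. W x \<partial>lborel)"
        using insert.prems False insert.hyps bT by auto
      ultimately show ?thesis using IH insert.hyps by (simp add: distrib_left add_mono)
    qed
  qed simp
  also have "\<dots> \<le> (\<integral>\<^sup>+x. W x \<partial>lborel)"
    by (intro nn_integral_mono) (auto simp: indicator_def)
  finally show ?thesis using inj by (simp add: T_def card_image)
qed

end

section \<open>Integration over parallel lines\<close>

text \<open>Exhibits a genuine edge behind each weight, from which weights in the cube are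
  positive.\<close>

lemma (in semimetric) mids_neighbour:
  "distinct p \<Longrightarrow> (u, q) \<in> set (mids d p) \<Longrightarrow> \<exists>x\<in>set p. x \<noteq> u \<and> u \<in> set p \<and> d x u \<le> q"
proof (induction p rule: induct_list012)
  case (3 x v zs)
  show ?case
  proof (cases zs)
    case (Cons y ys)
    consider "u = v" "q = max (d x v) (d v y)" | "(u, q) \<in> set (mids d zs)"
      using "3.prems"(2) Cons by auto
    then show ?thesis
    proof cases
      case 1
      then show ?thesis using "3.prems"(1) by (intro bexI[of _ x]) auto
    next
      case 2
      then show ?thesis using "3.IH"(1) "3.prems"(1) by auto
    qed
  qed (use 3 in auto)
qed auto

interpretation euclid: semimetric "euclid_dist k" for k
proof
  fix x y z :: "nat \<Rightarrow> real"
  show "euclid_dist k x y \<ge> 0" by (simp add: euclid_dist_def L2_set_nonneg)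
  show "euclid_dist k x x = 0" by (simp add: euclid_dist_def L2_set_def)
  show "euclid_dist k x y = euclid_dist k y x" by (simp add: euclid_dist_def L2_set_def power2_commute)
  show "euclid_dist k x z \<le> euclid_dist k x y + euclid_dist k y z"
    using L2_set_triangle_ineq[of "\<lambda>i. x i - y i" "\<lambda>i. y i - z i" "{..<k}"] by (simp add: euclid_dist_def)
qed

lemma euclid_dist_component: "i < k \<Longrightarrow> \<bar>x i - y i\<bar> \<le> euclid_dist k x y"
  unfolding euclid_dist_def using member_le_L2_set[of "{..<k}" i "\<lambda>i. \<bar>x i - y i\<bar>"]
  by (simp add: L2_set_def)

lemma euclid_dist_pos:
  assumes "x \<in> unit_cube k" "y \<in> unit_cube k" "x \<noteq> y"
  shows "euclid_dist k x y > 0"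
proof -
  obtain i where i: "i < k" "x i \<noteq> y i"
    using assms unfolding unit_cube_def by (metis PiE_ext lessThan_iff)
  then show ?thesis using euclid_dist_component[OF i(1), of x y] by simp
qed

lemma euclid_dist_measurable [measurable]:
  "(\<lambda>x. euclid_dist k x v) \<in> borel_measurable (PiM {..<k} (\<lambda>_. lborel))"
  unfolding euclid_dist_def L2_set_def by measurable

lemma gap_measurable [measurable]:
  "euclid.gap k r pss \<in> borel_measurable (PiM {..<k} (\<lambda>_. lborel))"
proof -
  \<comment> \<open>\<open>None\<close> encodes the constant \<open>r\<close>, which makes the gap a
    minimum over one finite family of measurable functions.\<close>
  let ?f = "\<lambda>i x. case i of None \<Rightarrow> r | Some (u, q) \<Rightarrow> max (euclid_dist k x u) q"
  have "(\<lambda>x. Min ((\<lambda>i. ?f i x) ` (insert None (Some ` euclid.midset k pss)))) \<in> borel_measurable (PiM {..<k} (\<lambda>_. lborel))"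
    using euclid.finite_midset by (intro borel_measurable_Min) auto
  moreover have "euclid.gap k r pss x = Min ((\<lambda>i. ?f i x) ` (insert None (Some ` euclid.midset k pss)))" for x
    by (simp add: euclid.gap_def image_image case_prod_beta)
  ultimately show ?thesis by presburger
qed

interpretation lborels: product_sigma_finite "\<lambda>_::nat. lborel :: real measure"
  by standard

lemma indicator_box:
  "finite I \<Longrightarrow> indicator {x. \<forall>i\<in>I. x i \<in> S i} x = (\<Prod>i\<in>I. indicator (S i) (x i) :: ennreal)"
  by (induction I rule: finite_induct) (auto simp: indicator_def)

lemma nn_integral_box:
  fixes I :: "nat set"
  assumes "finite I" "\<And>i. i \<in> I \<Longrightarrow> l i \<le> u i"
  shows "(\<integral>\<^sup>+x. indicator {x. \<forall>i\<in>I. x i \<in> {l i..u i}} x \<partial>PiM I (\<lambda>_. lborel)) = ennreal (\<Prod>i\<in>I. u i - l i)"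
proof -
  have "(\<integral>\<^sup>+x. indicator {x. \<forall>i\<in>I. x i \<in> {l i..u i}} x \<partial>PiM I (\<lambda>_. lborel))
      = (\<Prod>i\<in>I. \<integral>\<^sup>+t. indicator {l i..u i} t \<partial>lborel)"
    unfolding indicator_box[OF assms(1)] by (rule lborels.product_nn_integral_prod[OF assms(1)]) simp
  also have "\<dots> = ennreal (\<Prod>i\<in>I. u i - l i)"
    using assms by (simp add: prod_ennreal)
  finally show ?thesis .
qed

lemma indicator_box_measurable [measurable]:
  fixes I :: "nat set"
  assumes "finite I" "\<And>i. i \<in> I \<Longrightarrow> S i \<in> sets borel"
  shows "(\<lambda>x. indicator {x. \<forall>i\<in>I. x i \<in> S i} x :: ennreal) \<in> borel_measurable (PiM I (\<lambda>_. lborel))"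
  unfolding indicator_box[OF assms(1)] using assms(2) by measurable

text \<open>The mean of \<open>(t - c)\<^sup>2\<close> is \<open>a\<^sup>2 / 3\<close>. The length
  \<open>2 * a\<close> is kept as a factor of its own so that it combines with the other coordinates
  to \<open>(2 * a) ^ m\<close>.\<close>

lemma nn_integral_square_interval:
  assumes "a > 0" "s > 0"
  shows "(\<integral>\<^sup>+t. ennreal ((t - c)\<^sup>2 / s) * indicator {c - a..c + a} t \<partial>lborel) = ennreal (a\<^sup>2 / (3 * s)) * ennreal (2 * a)"
proof -
  have "(\<integral>\<^sup>+t. ennreal ((t - c)\<^sup>2 / s) * indicator {c - a..c + a} t \<partial>lborel)
      = ennreal ((c + a - c) ^ 3 / (3 * s) - (c - a - c) ^ 3 / (3 * s))"
    using assms by (intro nn_integral_FTC_Icc)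
      (auto intro!: derivative_eq_intros simp: power2_eq_square)
  also have "(c + a - c) ^ 3 / (3 * s) - (c - a - c) ^ 3 / (3 * s) = a\<^sup>2 / (3 * s) * (2 * a)"
    using assms by (simp add: power3_eq_cube power2_eq_square field_simps)
  also have "ennreal (a\<^sup>2 / (3 * s) * (2 * a)) = ennreal (a\<^sup>2 / (3 * s)) * ennreal (2 * a)"
    using assms by (intro ennreal_mult) auto
  finally show ?thesis .
qed

text \<open>Markov's inequality for the squared distance to the centre of the box.\<close>

lemma box_ball_measure:
  fixes c :: "nat \<Rightarrow> real"
  assumes a: "a > 0" and s: "s > 0" and th: "real m * a\<^sup>2 / 3 \<le> \<theta> * s\<^sup>2"
  defines "K \<equiv> {y. (\<forall>i\<in>{..<m}. y i \<in> {c i - a..c i + a}) \<and> (\<Sum>i<m. (y i - c i)\<^sup>2) \<le> s\<^sup>2}"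
  shows "ennreal ((1 - \<theta>) * (2 * a) ^ m) \<le> (\<integral>\<^sup>+y. indicator K y \<partial>PiM {..<m} (\<lambda>_. lborel))"
    and "(\<lambda>y. indicator K y :: ennreal) \<in> borel_measurable (PiM {..<m} (\<lambda>_. lborel))"
proof -
  let ?M = "PiM {..<m} (\<lambda>_. lborel :: real measure)"
  let ?B = "{y. \<forall>i\<in>{..<m}. y i \<in> {c i - a..c i + a}}"
  have KB: "indicator K y = indicator ?B y * (indicator {y. (\<Sum>i<m. (y i - c i)\<^sup>2) \<le> s\<^sup>2} y :: ennreal)" for y
    by (auto simp: K_def indicator_def)
  have Bm: "(\<lambda>y. indicator ?B y :: ennreal) \<in> borel_measurable ?M"
    by (rule indicator_box_measurable) auto
  have "(\<lambda>y. indicator {t. t \<le> s\<^sup>2} (\<Sum>i<m. (y i - c i)\<^sup>2) :: ennreal) \<in> borel_measurable ?M"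
    by measurable
  then have "(\<lambda>y. indicator {y. (\<Sum>i<m. (y i - c i)\<^sup>2) \<le> s\<^sup>2} y :: ennreal) \<in> borel_measurable ?M"
    by (simp add: indicator_def)
  then show Km: "(\<lambda>y. indicator K y :: ennreal) \<in> borel_measurable ?M"
    unfolding KB using Bm by (rule borel_measurable_times_ennreal[rotated])
  have term_m: "(\<lambda>y. ennreal ((y i - c i)\<^sup>2 / s\<^sup>2) * indicator ?B y) \<in> borel_measurable ?M" if "i < m" for i
    using that Bm by (intro borel_measurable_times_ennreal) measurable
  have tm: "(\<integral>\<^sup>+y. ennreal ((y i - c i)\<^sup>2 / s\<^sup>2) * indicator ?B y \<partial>?M) = ennreal (a\<^sup>2 / (3 * s\<^sup>2) * (2 * a) ^ m)"
    if i: "i < m" for i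
  proof -
    let ?f = "\<lambda>j t. (if j = i then ennreal ((t - c i)\<^sup>2 / s\<^sup>2) else 1) * indicator {c j - a..c j + a} t"
    have "ennreal ((y i - c i)\<^sup>2 / s\<^sup>2) * indicator ?B y = (\<Prod>j\<in>{..<m}. ?f j (y j))" for y
      using i by (subst indicator_box) (auto simp: prod.distrib)
    then have "(\<integral>\<^sup>+y. ennreal ((y i - c i)\<^sup>2 / s\<^sup>2) * indicator ?B y \<partial>?M) = (\<integral>\<^sup>+y. (\<Prod>j\<in>{..<m}. ?f j (y j)) \<partial>?M)"
      by simp
    also have "\<dots> = (\<Prod>j\<in>{..<m}. \<integral>\<^sup>+t. ?f j t \<partial>lborel)"
      by (rule lborels.product_nn_integral_prod) auto
    also have "(\<integral>\<^sup>+t. ?f j t \<partial>lborel) = (if j = i then ennreal (a\<^sup>2 / (3 * s\<^sup>2)) else 1) * ennreal (2 * a)" for j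
      using nn_integral_square_interval[OF a, of "s\<^sup>2" "c i"] s a by (cases "j = i") auto
    then have "(\<Prod>j\<in>{..<m}. \<integral>\<^sup>+t. ?f j t \<partial>lborel) = ennreal (a\<^sup>2 / (3 * s\<^sup>2)) * ennreal (2 * a) ^ m"
      using i by (simp add: prod.distrib)
    also have "\<dots> = ennreal (a\<^sup>2 / (3 * s\<^sup>2)) * ennreal ((2 * a) ^ m)"
      using a by (simp only: ennreal_power)
    also have "\<dots> = ennreal (a\<^sup>2 / (3 * s\<^sup>2) * (2 * a) ^ m)"
      using a by (intro ennreal_mult[symmetric]) auto
    finally show ?thesis .
  qed
  have "ennreal ((2 * a) ^ m) = (\<integral>\<^sup>+y. indicator ?B y \<partial>?M)"
    using a by (subst nn_integral_box) auto
  also have "\<dots> \<le> (\<integral>\<^sup>+y. indicator K y + (\<Sum>i<m. ennreal ((y i - c i)\<^sup>2 / s\<^sup>2) * indicator ?B y) \<partial>?M)"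
  proof (rule nn_integral_mono)
    fix y
    show "indicator ?B y \<le> indicator K y + (\<Sum>i<m. ennreal ((y i - c i)\<^sup>2 / s\<^sup>2) * indicator ?B y)"
    proof (cases "y \<in> ?B \<and> y \<notin> K")
      case True
      then have "(\<Sum>i<m. (y i - c i)\<^sup>2) > s\<^sup>2" by (auto simp: K_def)
      then have "1 \<le> (\<Sum>i<m. (y i - c i)\<^sup>2 / s\<^sup>2)"
        using s by (simp flip: sum_divide_distrib)
      then have "1 \<le> ennreal (\<Sum>i<m. (y i - c i)\<^sup>2 / s\<^sup>2)" by simp
      also have "\<dots> = (\<Sum>i<m. ennreal ((y i - c i)\<^sup>2 / s\<^sup>2))" by (subst sum_ennreal) auto
      finally show ?thesis using True by simp
    next
      case False
      then show ?thesis by (cases "y \<in> ?B") auto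
    qed
  qed
  also have "\<dots> = (\<integral>\<^sup>+y. indicator K y \<partial>?M) + (\<Sum>i<m. ennreal (a\<^sup>2 / (3 * s\<^sup>2) * (2 * a) ^ m))"
  proof (subst nn_integral_add)
    show "(\<lambda>y. \<Sum>i<m. ennreal ((y i - c i)\<^sup>2 / s\<^sup>2) * indicator ?B y) \<in> borel_measurable ?M"
      using term_m by (intro borel_measurable_sum) simp
    have "(\<integral>\<^sup>+y. (\<Sum>i<m. ennreal ((y i - c i)\<^sup>2 / s\<^sup>2) * indicator ?B y) \<partial>?M)
      = (\<Sum>i<m. \<integral>\<^sup>+y. ennreal ((y i - c i)\<^sup>2 / s\<^sup>2) * indicator ?B y \<partial>?M)"
      by (rule nn_integral_sum) (use term_m in simp)
    also have "\<dots> = (\<Sum>i<m. ennreal (a\<^sup>2 / (3 * s\<^sup>2) * (2 * a) ^ m))"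
      using tm by (intro sum.cong) auto
    finally show "(\<integral>\<^sup>+y. indicator K y \<partial>?M) + (\<integral>\<^sup>+y. (\<Sum>i<m. ennreal ((y i - c i)\<^sup>2 / s\<^sup>2) * indicator ?B y) \<partial>?M)
      = (\<integral>\<^sup>+y. indicator K y \<partial>?M) + (\<Sum>i<m. ennreal (a\<^sup>2 / (3 * s\<^sup>2) * (2 * a) ^ m))" by simp
  qed (rule Km)
  also have "(\<Sum>i<m. ennreal (a\<^sup>2 / (3 * s\<^sup>2) * (2 * a) ^ m)) = ennreal ((real m * a\<^sup>2 / 3) / s\<^sup>2 * (2 * a) ^ m)"
    using a s by (subst sum_ennreal) (auto simp: field_simps)
  also have "\<dots> \<le> ennreal (\<theta> * (2 * a) ^ m)"
    using th a s by (intro ennreal_leI mult_right_mono) (auto simp: field_simps)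
  finally have "ennreal ((2 * a) ^ m) \<le> ennreal (\<theta> * (2 * a) ^ m) + (\<integral>\<^sup>+y. indicator K y \<partial>?M)"
    by (simp add: add.commute)
  then have "ennreal ((2 * a) ^ m) - ennreal (\<theta> * (2 * a) ^ m) \<le> (\<integral>\<^sup>+y. indicator K y \<partial>?M)"
    by (simp add: ennreal_minus_le_iff)
  moreover have "0 \<le> real m * a\<^sup>2 / 3" by simp
  with th have "\<theta> * s\<^sup>2 \<ge> 0" by linarith
  then have "\<theta> \<ge> 0" using s by (simp add: zero_le_mult_iff)
  ultimately show "ennreal ((1 - \<theta>) * (2 * a) ^ m) \<le> (\<integral>\<^sup>+y. indicator K y \<partial>?M)"
    using a by (simp add: ennreal_minus left_diff_distrib)
qed

section \<open>From the gap to the distance\<close>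

text \<open>The distance from \<open>x\<close> to the finite set \<open>X\<close>, not to the
  cube.\<close>

definition cube_dist :: "nat \<Rightarrow> (nat \<Rightarrow> real) set \<Rightarrow> (nat \<Rightarrow> real) \<Rightarrow> real" where
  "cube_dist k X x = Min (euclid_dist k x ` X)"

lemma cube_dist_measurable [measurable]:
  "finite X \<Longrightarrow> cube_dist k X \<in> borel_measurable (PiM {..<k} (\<lambda>_. lborel))"
  unfolding cube_dist_def by (intro borel_measurable_Min) auto

lemma cube_dist_le: "finite X \<Longrightarrow> v \<in> X \<Longrightarrow> cube_dist k X x \<le> euclid_dist k x v"
  unfolding cube_dist_def by simp

lemma cube_dist_attained:
  assumes "finite X" "X \<noteq> {}"
  obtains v where "v \<in> X" "cube_dist k X x = euclid_dist k x v"
proof -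
  have "cube_dist k X x \<in> euclid_dist k x ` X" unfolding cube_dist_def using assms by (intro Min_in) auto
  then show ?thesis using that by auto
qed

text \<open>The last coordinate is the direction of the lines, and only there does the cube have to
  grow by the full \<open>R\<close>; this costs one factor \<open>1 + 2 * R\<close>. The other
  coordinates grow by half the side of the boxes around the ends, which fixes the base of the
  exponential bound.\<close>

definition enlarged_box :: "nat \<Rightarrow> real \<Rightarrow> (nat \<Rightarrow> real) set" where
  "enlarged_box k R = {x. \<forall>i\<in>{..<k}. x i \<in> {- (if Suc i = k then R else 4 / 5 * R / sqrt k) .. 1 + (if Suc i = k then R else 4 / 5 * R / sqrt k)}}"

lemma enlarged_box_measurable [measurable]:
  "(\<lambda>x. indicator (enlarged_box k R) x :: ennreal) \<in> borel_measurable (PiM {..<k} (\<lambda>_. lborel))"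
  unfolding enlarged_box_def by (rule indicator_box_measurable) auto

lemma enlarged_box_measure:
  assumes "k > 0" "R \<ge> 0"
  shows "(\<integral>\<^sup>+x. indicator (enlarged_box k R) x \<partial>PiM {..<k} (\<lambda>_. lborel))
    = ennreal ((1 + 8 / 5 * R / sqrt k) ^ (k - 1) * (1 + 2 * R))"
proof -
  obtain m where k: "k = Suc m" using assms(1) by (cases k) auto
  have nn: "0 \<le> R / sqrt k" using assms by simp
  have "(\<integral>\<^sup>+x. indicator (enlarged_box k R) x \<partial>PiM {..<k} (\<lambda>_. lborel))
    = ennreal (\<Prod>i<k. 1 + (if Suc i = k then R else 4 / 5 * R / sqrt k) - - (if Suc i = k then R else 4 / 5 * R / sqrt k))"
    unfolding enlarged_box_def by (rule nn_integral_box) (use assms nn in auto)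
  also have "(\<Prod>i<k. 1 + (if Suc i = k then R else 4 / 5 * R / sqrt k) - - (if Suc i = k then R else 4 / 5 * R / sqrt k))
     = (\<Prod>i<m. 1 + 8 / 5 * R / sqrt k) * (1 + 2 * R)"
    by (simp add: k add.commute)
  finally show ?thesis by (simp add: k)
qed

definition near_weight :: "nat \<Rightarrow> real \<Rightarrow> (nat \<Rightarrow> real) set \<Rightarrow> (nat \<Rightarrow> real) \<Rightarrow> real" where
  "near_weight k r X x = (if cube_dist k X x \<le> r then cube_dist k X x else 0)"

lemma near_weight_measurable [measurable]:
  "finite X \<Longrightarrow> near_weight k r X \<in> borel_measurable (PiM {..<k} (\<lambda>_. lborel))"
  unfolding near_weight_def by measurable


lemma euclid_dist_fun_upd:
  "euclid_dist (Suc m) (y(m := s)) c = sqrt ((\<Sum>i<m. (y i - c i)\<^sup>2) + (s - c m)\<^sup>2)"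
  by (simp add: euclid_dist_def L2_set_def)

lemma euclid_dist_vertical: "euclid_dist (Suc m) (y(m := s)) (y(m := t)) = \<bar>s - t\<bar>"
  by (simp add: euclid_dist_fun_upd)

lemma path_cover_mid_pos:
  assumes "X \<subseteq> unit_cube k" "path_cover X pss" "(u, q) \<in> euclid.midset k pss"
  shows "q > 0"
proof -
  obtain p where p: "p \<in> set pss" "(u, q) \<in> set (mids (euclid_dist k) p)"
    using assms(3) by (auto simp: euclid.midset_def)
  have "distinct p" "set p \<subseteq> X" using p(1) assms(2) by (auto simp: path_cover_def distinct_concat_iff)
  then obtain x where x: "x \<in> set p" "x \<noteq> u" "u \<in> set p" "euclid_dist k x u \<le> q"
    using euclid.mids_neighbour p(2) by blast
  then show ?thesis using euclid_dist_pos[of x k u] \<open>set p \<subseteq> X\<close> assms(1) by (meson order_less_le_trans subsetD)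
qed

text \<open>Double counting over the lines parallel to the last axis: \<open>y\<close> is the foot
  of a line and \<open>K (last A)\<close> the set of feet in the box around an end whose lines pass
  within 0.48 r of it. Summing the measures of these sets counts, for each line, the ends near it,
  which \<open>line_count\<close> bounds; then Fubini.\<close>

lemma cover_measure_box:
  assumes X: "X \<subseteq> unit_cube k" and k: "k \<ge> 2" and r: "r > 0"
    and opt: "opt_cover (\<lambda>x y. euclid_dist k x y ^ k) (r ^ k) X pss"
  shows "ennreal ((r / 200)\<^sup>2 / 4 * (2 / 27 * (8 / 5 * r / sqrt k) ^ (k - 1))) * of_nat (length pss)
    \<le> (\<integral>\<^sup>+x. ennreal (euclid.gap k r pss x * indicator {x. \<exists>v\<in>X. euclid_dist k x v \<le> r} x)
          * indicator {x. \<forall>i<k - 1. x i \<in> {- (4 / 5 * r / sqrt k)..1 + 4 / 5 * r / sqrt k}} x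
        \<partial>PiM {..<k} (\<lambda>_. lborel))"
proof -
  obtain m where m: "k = Suc m" using k by (cases k) auto
  define a where "a = 4 / 5 * r / sqrt k"
  have a: "a > 0" using r k by (simp add: a_def)
  define s where "s = 12 / 25 * r"
  define K where "K = (\<lambda>c::nat \<Rightarrow> real. {y. (\<forall>i\<in>{..<m}. y i \<in> {c i - a..c i + a}) \<and> (\<Sum>i<m. (y i - c i)\<^sup>2) \<le> s\<^sup>2})"
  let ?W = "\<lambda>x. ennreal (euclid.gap k r pss x * indicator {x. \<exists>v\<in>X. euclid_dist k x v \<le> r} x)"
  let ?B = "{x. \<forall>i<k - 1. x i \<in> {- a..1 + a}}"
  let ?M = "PiM {..<m} (\<lambda>_. lborel :: real measure)"
  have cover: "path_cover X pss" using opt by (simp add: opt_cover_def)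
  have finX: "finite X" using cover by (auto simp: path_cover_def)
  have Kmeas: "ennreal ((1 - 25 / 27) * (2 * a) ^ m) \<le> (\<integral>\<^sup>+y. indicator (K c) y \<partial>?M)"
    and Kb: "(\<lambda>y. indicator (K c) y :: ennreal) \<in> borel_measurable ?M" for c
  proof -
    \<comment> \<open>The ratio is (0.8^2 / 3) / 0.48^2 = 25 / 27, so at least 2 / 27 of the box
      survives.\<close>
    have "real m * a\<^sup>2 / 3 \<le> 25 / 27 * s\<^sup>2"
      using m by (simp add: a_def s_def power_mult_distrib power_divide field_simps)
    then show "ennreal ((1 - 25 / 27) * (2 * a) ^ m) \<le> (\<integral>\<^sup>+y. indicator (K c) y \<partial>?M)"
      and "(\<lambda>y. indicator (K c) y :: ennreal) \<in> borel_measurable ?M"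
      unfolding K_def using box_ball_measure[of a s m "25 / 27" c] a r by (auto simp: s_def)
  qed
  note lastX = path_cover_last_in(2)[OF cover]
  have count: "ennreal ((r / 200)\<^sup>2 / 4) * of_nat (card {A \<in> set pss. y \<in> K (last A)})
      \<le> (\<integral>\<^sup>+t. ?W (y(m := t)) * indicator ?B (y(m := t)) \<partial>lborel)" for y
  proof (cases "{A \<in> set pss. y \<in> K (last A)} = {}")
    case True
    show ?thesis unfolding True by simp
  next
    case False
    interpret semimetric_line "euclid_dist k" "\<lambda>t. y(m := t)" r k X pss
      by standard (use r k opt path_cover_mid_pos[OF X cover] in \<open>auto simp: m euclid_dist_vertical\<close>)
    have "ennreal ((r / 200)\<^sup>2 / 4) * of_nat (card {A \<in> set pss. y \<in> K (last A)}) \<le> (\<integral>\<^sup>+t. ?W (y(m := t)) \<partial>lborel)"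
    proof -
      have "ennreal ((r / 200)\<^sup>2 / 4) * of_nat (card {A \<in> set pss. y \<in> K (last A)})
        \<le> (\<integral>\<^sup>+t. ennreal (g t * indicator {t. near t} t) \<partial>lborel)"
      proof (rule line_count[where y = "\<lambda>A. last A m"])
        fix A assume "A \<in> {A \<in> set pss. y \<in> K (last A)}"
        then have "(\<Sum>i<m. (y i - last A i)\<^sup>2) \<le> s\<^sup>2" by (simp add: K_def)
        then have "sqrt (\<Sum>i<m. (y i - last A i)\<^sup>2) \<le> s"
          using r by (intro real_le_lsqrt) (auto simp: s_def)
        moreover have "euclid_dist k (y(m := last A m)) (last A) = sqrt (\<Sum>i<m. (y i - last A i)\<^sup>2)"
          unfolding m euclid_dist_fun_upd by simp
        ultimately show "euclid_dist k (y(m := last A m)) (last A) \<le> 12 / 25 * r"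
          by (simp add: s_def)
      qed auto
      then show ?thesis by (simp add: indicator_def)
    qed
    moreover have "y(m := t) \<in> ?B" for t
    proof -
      obtain A where A: "A \<in> set pss" "y \<in> K (last A)" using False by auto
      have "last A i \<in> {0..1}" if "i < m" for i
        using lastX[OF A(1)] X that m by (auto simp: unit_cube_def PiE_iff)
      moreover have "y i \<in> {last A i - a..last A i + a}" if "i < m" for i using A(2) that by (simp add: K_def)
      ultimately have "y i \<in> {- a..1 + a}" if "i < m" for i using that a by fastforce
      then show ?thesis by (simp add: m)
    qed
    ultimately show ?thesis by simp
  qed
  have Wm: "(\<lambda>x. ?W x * indicator ?B x) \<in> borel_measurable (PiM {..<k} (\<lambda>_. lborel))"
  proof -
    have eq: "indicator {x. \<exists>v\<in>X. euclid_dist k x v \<le> r} x = (if \<exists>v\<in>X. euclid_dist k x v \<le> r then 1 else 0 :: real)" for x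
      by (simp add: indicator_def)
    have 1: "(\<lambda>x. if \<exists>v\<in>X. euclid_dist k x v \<le> r then 1 else 0 :: real) \<in> borel_measurable (PiM {..<k} (\<lambda>_. lborel))"
      using finX by measurable
    have 2: "indicator ?B x = (indicator {x. \<forall>i\<in>{..<k}. x i \<in> (if i < k - 1 then {- a..1 + a} else UNIV)} x :: ennreal)" for x
      by (auto simp: indicator_def)
    have 3: "(\<lambda>x. indicator {x. \<forall>i\<in>{..<k}. x i \<in> (if i < k - 1 then {- a..1 + a} else UNIV)} x :: ennreal) \<in> borel_measurable (PiM {..<k} (\<lambda>_. lborel))"
      by (rule indicator_box_measurable) auto
    show ?thesis unfolding eq 2
      by (intro borel_measurable_times_ennreal measurable_compose[OF _ measurable_ennreal] borel_measurable_times gap_measurable 1 3)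
  qed
  have ins: "{..<k} = insert m {..<m}" using m by auto
  have "ennreal ((r / 200)\<^sup>2 / 4 * (2 / 27 * (2 * a) ^ m)) * of_nat (length pss)
      = (\<Sum>A\<in>set pss. ennreal ((r / 200)\<^sup>2 / 4) * ennreal ((1 - 25 / 27) * (2 * a) ^ m))"
  proof -
    have "ennreal ((r / 200)\<^sup>2 / 4 * (2 / 27 * (2 * a) ^ m)) = ennreal ((r / 200)\<^sup>2 / 4) * ennreal ((1 - 25 / 27) * (2 * a) ^ m)"
      using a by (subst ennreal_mult[symmetric]) auto
    then show ?thesis using distinct_card[OF distinct_path_cover[OF cover]]
      by (simp only: sum_constant) (simp only: mult.commute)
  qed
  also have "\<dots> \<le> (\<Sum>A\<in>set pss. ennreal ((r / 200)\<^sup>2 / 4) * (\<integral>\<^sup>+y. indicator (K (last A)) y \<partial>?M))"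
    by (intro sum_mono mult_left_mono Kmeas) simp
  also have "\<dots> = (\<integral>\<^sup>+y. (\<Sum>A\<in>set pss. ennreal ((r / 200)\<^sup>2 / 4) * indicator (K (last A)) y) \<partial>?M)"
  proof -
    have "(\<integral>\<^sup>+y. (\<Sum>A\<in>set pss. ennreal ((r / 200)\<^sup>2 / 4) * indicator (K (last A)) y) \<partial>?M)
      = (\<Sum>A\<in>set pss. \<integral>\<^sup>+y. ennreal ((r / 200)\<^sup>2 / 4) * indicator (K (last A)) y \<partial>?M)"
      by (rule nn_integral_sum) (intro borel_measurable_times_ennreal Kb borel_measurable_const)
    also have "\<dots> = (\<Sum>A\<in>set pss. ennreal ((r / 200)\<^sup>2 / 4) * (\<integral>\<^sup>+y. indicator (K (last A)) y \<partial>?M))"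
      by (intro sum.cong refl nn_integral_cmult Kb)
    finally show ?thesis by simp
  qed
  also have "\<dots> = (\<integral>\<^sup>+y. ennreal ((r / 200)\<^sup>2 / 4) * of_nat (card {A \<in> set pss. y \<in> K (last A)}) \<partial>?M)"
  proof (rule nn_integral_cong)
    fix y
    have "(\<Sum>A\<in>set pss. indicator (K (last A)) y :: ennreal) = of_nat (card {A \<in> set pss. y \<in> K (last A)})"
      by (simp add: indicator_def sum.If_cases Int_def)
    then show "(\<Sum>A\<in>set pss. ennreal ((r / 200)\<^sup>2 / 4) * indicator (K (last A)) y)
       = ennreal ((r / 200)\<^sup>2 / 4) * of_nat (card {A \<in> set pss. y \<in> K (last A)})"
      by (simp flip: sum_distrib_left)
  qed
  also have "\<dots> \<le> (\<integral>\<^sup>+y. (\<integral>\<^sup>+t. ?W (y(m := t)) * indicator ?B (y(m := t)) \<partial>lborel) \<partial>?M)"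
    by (rule nn_integral_mono) (rule count)
  also have "\<dots> = (\<integral>\<^sup>+x. ?W x * indicator ?B x \<partial>PiM {..<k} (\<lambda>_. lborel))"
    unfolding ins by (rule lborels.product_nn_integral_insert[symmetric]) (use Wm in \<open>auto simp: ins\<close>)
  finally show ?thesis by (simp add: a_def m mult.assoc)
qed


text \<open>Either the gap at \<open>x\<close> is at most \<open>1 + 1 / eps\<close> times the
  distance to X, or the nearest point \<open>v\<close> is closer than \<open>eps\<close> times its
  own gap. In the second case the gap at \<open>x\<close> is at most twice that at \<open>v\<close>,
  and \<open>x\<close> lies in a cube of side \<open>2 * eps\<close> times the gap at
  \<open>v\<close>; these cubes form the error term.\<close>

lemma cover_measure:
  assumes X: "X \<subseteq> unit_cube k" "X \<noteq> {}" and k: "k \<ge> 2" and r: "r > 0" "r \<le> R" and eps: "eps > 0" "eps \<le> 1"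
    and opt: "opt_cover (\<lambda>x y. euclid_dist k x y ^ k) (r ^ k) X pss"
  shows "ennreal ((r / 200)\<^sup>2 / 4 * (2 / 27 * (8 / 5 * r / sqrt k) ^ (k - 1))) * of_nat (length pss)
    \<le> ennreal (1 + 1 / eps) * (\<integral>\<^sup>+x. ennreal (near_weight k r X x) * indicator (enlarged_box k R) x \<partial>PiM {..<k} (\<lambda>_. lborel))
      + ennreal (\<Sum>x\<in>X. 2 * euclid.gap k r pss x * (2 * eps * euclid.gap k r pss x) ^ k)"
proof -
  let ?M = "PiM {..<k} (\<lambda>_. lborel :: real measure)"
  let ?g = "euclid.gap k r pss"
  let ?W = "\<lambda>x. ennreal (?g x * indicator {x. \<exists>v\<in>X. euclid_dist k x v \<le> r} x)"
  let ?B = "{x. \<forall>i<k - 1. x i \<in> {- (4 / 5 * r / sqrt k)..1 + 4 / 5 * r / sqrt k}}"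
  let ?C = "\<lambda>v. {x. \<forall>i\<in>{..<k}. x i \<in> {v i - eps * ?g v..v i + eps * ?g v}}"
  have finX: "finite X" using opt by (auto simp: opt_cover_def path_cover_def)
  have g0: "?g x \<ge> 0" for x using euclid.gap_nonneg r by simp
  have pointwise: "?W x * indicator ?B x \<le> ennreal (1 + 1 / eps) * (ennreal (near_weight k r X x) * indicator (enlarged_box k R) x)
      + (\<Sum>v\<in>X. ennreal (2 * ?g v) * indicator (?C v) x)" for x
  proof (cases "(\<exists>v\<in>X. euclid_dist k x v \<le> r) \<and> x \<in> ?B")
    case False
    then show ?thesis by (auto simp: indicator_def)
  next
    case True
    obtain v where v: "v \<in> X" "cube_dist k X x = euclid_dist k x v"
      using cube_dist_attained[OF finX X(2)] by blast
    obtain v' where "v' \<in> X" "euclid_dist k x v' \<le> r" using True by auto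
    then have near: "cube_dist k X x \<le> r" using cube_dist_le[OF finX] by (meson order_trans)
    have EB: "x \<in> enlarged_box k R"
      unfolding enlarged_box_def mem_Collect_eq
    proof (intro ballI)
      fix i assume i: "i \<in> {..<k}"
      show "x i \<in> {- (if Suc i = k then R else 4 / 5 * R / sqrt k) .. 1 + (if Suc i = k then R else 4 / 5 * R / sqrt k)}"
      proof (cases "Suc i = k")
        case True
        have "v i \<in> {0..1}" using v(1) X(1) i by (auto simp: unit_cube_def PiE_iff)
        moreover have "\<bar>x i - v i\<bar> \<le> r" using euclid_dist_component[of i k x v] i v near by simp
        ultimately show ?thesis using True r by (auto simp: abs_le_iff)
      next
        case False
        then have "x i \<in> {- (4 / 5 * r / sqrt k)..1 + 4 / 5 * r / sqrt k}" using True i by auto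
        moreover have "4 / 5 * r / sqrt k \<le> 4 / 5 * R / sqrt k" using r by (simp add: divide_right_mono)
        ultimately show ?thesis using False by auto
      qed
    qed
    show ?thesis
    proof (cases "?g x \<le> (1 + 1 / eps) * cube_dist k X x")
      case le: True
      have "?W x * indicator ?B x = ennreal (?g x)" using True by (simp add: indicator_def)
      also have "\<dots> \<le> ennreal ((1 + 1 / eps) * cube_dist k X x)" by (rule ennreal_leI) (rule le)
      also have "\<dots> = ennreal (1 + 1 / eps) * ennreal (cube_dist k X x)"
        using eps v(2) euclid.d_nonneg by (intro ennreal_mult) auto
      also have "\<dots> = ennreal (1 + 1 / eps) * (ennreal (near_weight k r X x) * indicator (enlarged_box k R) x)"
        using near EB by (simp add: near_weight_def)
      finally show ?thesis by (simp add: add_increasing2)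
    next
      case False
      let ?d = "euclid_dist k x v"
      have d0: "?d \<ge> 0" by (rule euclid.d_nonneg)
      have gx: "?g x \<le> ?g v + ?d" by (rule euclid.gap_lipschitz)
      have "?d / eps < ?g v" using False gx v(2) by (simp add: algebra_simps)
      then have dv: "?d < eps * ?g v" using eps by (simp add: field_simps)
      also have "\<dots> \<le> ?g v" using mult_right_mono[OF eps(2) g0[of v]] by simp
      finally have g2: "?g x \<le> 2 * ?g v" using gx by simp
      have "x \<in> ?C v"
      proof -
        have "x i \<in> {v i - eps * ?g v..v i + eps * ?g v}" if "i < k" for i
          using euclid_dist_component[OF that, of x v] dv by (auto simp: abs_le_iff)
        then show ?thesis by auto
      qed
      then have "ennreal (?g x) \<le> ennreal (2 * ?g v) * indicator (?C v) x"
        using g2 by (simp add: ennreal_leI)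
      also have "\<dots> \<le> (\<Sum>v\<in>X. ennreal (2 * ?g v) * indicator (?C v) x)"
        using finX v(1) by (intro member_le_sum) auto
      finally show ?thesis using True by (simp add: indicator_def add_increasing)
    qed
  qed
  have Cm: "(\<lambda>x. indicator (?C v) x :: ennreal) \<in> borel_measurable ?M" for v
    by (rule indicator_box_measurable) auto
  have NW: "(\<lambda>x. ennreal (near_weight k r X x) * indicator (enlarged_box k R) x) \<in> borel_measurable ?M"
    by (intro borel_measurable_times_ennreal enlarged_box_measurable
        measurable_compose[OF near_weight_measurable[OF finX] measurable_ennreal])
  have "ennreal ((r / 200)\<^sup>2 / 4 * (2 / 27 * (8 / 5 * r / sqrt k) ^ (k - 1))) * of_nat (length pss)
    \<le> (\<integral>\<^sup>+x. ?W x * indicator ?B x \<partial>?M)"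
    by (rule cover_measure_box[OF X(1) k r(1) opt])
  also have "\<dots> \<le> (\<integral>\<^sup>+x. ennreal (1 + 1 / eps) * (ennreal (near_weight k r X x) * indicator (enlarged_box k R) x)
      + (\<Sum>v\<in>X. ennreal (2 * ?g v) * indicator (?C v) x) \<partial>?M)"
    by (rule nn_integral_mono) (rule pointwise)
  also have "\<dots> = ennreal (1 + 1 / eps) * (\<integral>\<^sup>+x. ennreal (near_weight k r X x) * indicator (enlarged_box k R) x \<partial>?M)
      + (\<Sum>v\<in>X. ennreal (2 * ?g v) * (\<integral>\<^sup>+x. indicator (?C v) x \<partial>?M))"
    using NW Cm by (simp only: nn_integral_add nn_integral_cmult nn_integral_sum borel_measurable_times_ennreal
        borel_measurable_const borel_measurable_sum)
  also have "(\<Sum>v\<in>X. ennreal (2 * ?g v) * (\<integral>\<^sup>+x. indicator (?C v) x \<partial>?M)) = (\<Sum>v\<in>X. ennreal (2 * ?g v * (2 * eps * ?g v) ^ k))"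
  proof (rule sum.cong)
    fix v
    have "eps * ?g v \<ge> 0" using g0 eps by simp
    then have "(\<integral>\<^sup>+x. indicator (?C v) x \<partial>?M) = ennreal ((2 * eps * ?g v) ^ k)"
      by (subst nn_integral_box) (auto simp: algebra_simps)
    then show "ennreal (2 * ?g v) * (\<integral>\<^sup>+x. indicator (?C v) x \<partial>?M) = ennreal (2 * ?g v * (2 * eps * ?g v) ^ k)"
      using g0 eps by (simp only:) (rule ennreal_mult[symmetric], auto)
  qed simp
  also have "\<dots> = ennreal (\<Sum>x\<in>X. 2 * ?g x * (2 * eps * ?g x) ^ k)"
    using g0 eps by (intro sum_ennreal) auto
  finally show ?thesis .
qed

section \<open>Summation over the scales\<close>

text \<open>The surviving terms start at most at 1 and shrink by 20/21, whence 21. The induction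
  also carries \<open>20 * ?u J\<close>, the rest of the geometric series.\<close>

lemma sum_geometric_cutoff:
  fixes t r0 :: real
  assumes "t \<ge> 0" "r0 > 0"
  shows "(\<Sum>j\<le>J. if t \<le> r0 * (21/20) ^ j then t / (r0 * (21/20) ^ j) else 0) \<le> 21"
proof -
  let ?u = "\<lambda>j. t / (r0 * (21/20) ^ j)"
  let ?S = "\<lambda>J. \<Sum>j\<le>J. if t \<le> r0 * (21/20) ^ j then ?u j else 0"
  have "if t \<le> r0 * (21/20) ^ J then ?S J \<le> 21 - 20 * ?u J else ?S J = 0" for J
  proof (induction J)
    case 0
    then show ?case using assms by (auto simp: field_simps)
  next
    case (Suc J)
    have u: "?u (Suc J) = 20 / 21 * ?u J" by (simp add: field_simps)
    show ?case
    proof (cases "t \<le> r0 * (21/20) ^ Suc J")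
      case True
      then have le1: "?u (Suc J) \<le> 1" using assms by (simp add: pos_divide_le_eq)
      show ?thesis
      proof (cases "t \<le> r0 * (21/20) ^ J")
        case True
        with Suc have "?S J \<le> 21 - 20 * ?u J" by simp
        then have "?S J + ?u (Suc J) \<le> 21 - 20 * ?u (Suc J)" unfolding u by simp
        then show ?thesis using \<open>t \<le> r0 * (21/20) ^ Suc J\<close> by simp
      next
        case False
        with Suc have "?S J = 0" by simp
        moreover have "?u (Suc J) \<le> 21 - 20 * ?u (Suc J)" using le1 by simp
        ultimately show ?thesis using True by simp
      qed
    next
      case False
      have "r0 * (21/20) ^ J \<le> r0 * (21/20 :: real) ^ Suc J" using assms by simp
      then have "\<not> t \<le> r0 * (21/20) ^ J" using False by linarith
      then have "?S J = 0" using Suc by simp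
      then show ?thesis using False by simp
    qed
  qed
  moreover have "?u J \<ge> 0" using assms by simp
  ultimately show ?thesis by (smt (verit))
qed

text \<open>An edge much longer than \<open>r0\<close> is charged to a scale \<open>i\<close> just
  below its length. There its excess over the scale is a fixed proportion of \<open>t ^ k\<close>,
  and the ratio of \<open>t\<close> to the scale \<open>j\<close> supplies the decay in
  \<open>j - i\<close>. The constant 12 exceeds (21/20)^2 / (1 - (20/21)^2).\<close>

lemma edge_scale_bound:
  fixes t r0 :: real
  assumes t: "t \<ge> 0" "t \<le> r0 * (21/20) ^ j" and r0: "r0 > 0" and k: "k \<ge> 2"
  shows "t ^ (k + 1) / (r0 * (21/20) ^ j) \<le> (21/20) ^ (k + 1) * r0 ^ k * (20/21) ^ j
    + 12 * (\<Sum>i<j. (20/21) ^ (j - i) * (t ^ k - min (t ^ k) ((r0 * (21/20) ^ i) ^ k)))"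
proof -
  let ?q = "21/20 :: real" and ?w = "20/21 :: real"
  let ?f = "\<lambda>i. ?w ^ (j - i) * (t ^ k - min (t ^ k) ((r0 * ?q ^ i) ^ k))"
  have f0: "?f i \<ge> 0" for i by simp
  have wq: "?w ^ n * ?q ^ n = 1" for n by (simp flip: power_mult_distrib)
  show ?thesis
  proof (cases "t \<le> r0 * ?q")
    case True
    have "t ^ (k + 1) / (r0 * ?q ^ j) \<le> (r0 * ?q) ^ (k + 1) / (r0 * ?q ^ j)"
      using True t r0 by (intro divide_right_mono power_mono) auto
    also have "\<dots> = ?q ^ (k + 1) * r0 ^ k * (1 / ?q ^ j)"
    proof -
      have "(r0 * ?q) ^ (k + 1) = r0 * (?q ^ (k + 1) * r0 ^ k)" by (simp only: power_mult_distrib power_add power_one_right mult_ac)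
      then show ?thesis using r0 by simp
    qed
    also have "1 / ?q ^ j = ?w ^ j" using wq[of j] by (simp add: field_simps)
    finally have "t ^ (k + 1) / (r0 * ?q ^ j) \<le> ?q ^ (k + 1) * r0 ^ k * ?w ^ j" .
    moreover have "0 \<le> 12 * (\<Sum>i<j. ?f i)" using sum_nonneg[of "{..<j}" ?f] f0 by simp
    ultimately show ?thesis by linarith
  next
    case False
    define n where "n = (LEAST n. t \<le> r0 * ?q ^ n)"
    have n: "t \<le> r0 * ?q ^ n" unfolding n_def by (rule LeastI) (rule t(2))
    have nj: "n \<le> j" unfolding n_def by (rule Least_le) (rule t(2))
    have "n \<noteq> 0" "n \<noteq> 1"
    proof -
      show "n \<noteq> 0"
      proof
        assume "n = 0"
        then have "t \<le> r0" using n by simp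
        then show False using False r0 by simp
      qed
      show "n \<noteq> 1" using n False by auto
    qed
    \<comment> \<open>Two scales below the first one that reaches \<open>t\<close>, hence below
      \<open>t\<close> by at least a factor 21/20. With \<open>k \<ge> 2\<close> this leaves a
      definite excess.\<close>
    then obtain i where i: "n = Suc (Suc i)" by (metis One_nat_def not0_implies_Suc)
    have ij: "i < j" using nj i by simp
    have "\<not> t \<le> r0 * ?q ^ Suc i"
      using not_less_Least[of "Suc i" "\<lambda>n. t \<le> r0 * ?q ^ n"] i unfolding n_def by simp
    then have low: "r0 * ?q ^ i \<le> ?w * t" by simp
    have "(r0 * ?q ^ i) ^ k \<le> (?w * t) ^ k" using low r0 by (intro power_mono) auto
    also have "\<dots> = ?w ^ k * t ^ k" by (rule power_mult_distrib)
    also have "\<dots> \<le> ?w ^ 2 * t ^ k"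
      using k t by (intro mult_right_mono power_decreasing) auto
    finally have lam: "(r0 * ?q ^ i) ^ k \<le> ?w\<^sup>2 * t ^ k" .
    have "(r0 * ?q ^ i) ^ k \<le> t ^ k" 
    proof -
      have "?w\<^sup>2 * t ^ k \<le> 1 * t ^ k" using t by (intro mult_right_mono) (auto simp: power2_eq_square)
      then show ?thesis using lam by simp
    qed
    then have diff: "t ^ k - min (t ^ k) ((r0 * ?q ^ i) ^ k) \<ge> (1 - ?w\<^sup>2) * t ^ k"
      using lam by (simp add: min_absorb2 left_diff_distrib)
    have "t / (r0 * ?q ^ j) \<le> r0 * ?q ^ n / (r0 * ?q ^ j)" using n r0 by (intro divide_right_mono) auto
    also have "\<dots> = ?q\<^sup>2 * ?w ^ (j - i)"
    proof -
      have "?q ^ j = ?q ^ (j - i) * ?q ^ i" using ij by (simp flip: power_add)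
      then show ?thesis using r0 wq[of "j - i"] by (simp add: i power2_eq_square field_simps)
    qed
    finally have "t / (r0 * ?q ^ j) \<le> ?q\<^sup>2 * ?w ^ (j - i)" .
    then have "t ^ k * (t / (r0 * ?q ^ j)) \<le> t ^ k * (?q\<^sup>2 * ?w ^ (j - i))" using t by (intro mult_left_mono) auto
    also have "\<dots> = ?w ^ (j - i) * (?q\<^sup>2 / (1 - ?w\<^sup>2) * ((1 - ?w\<^sup>2) * t ^ k))" by (simp add: power2_eq_square)
    also have "\<dots> \<le> ?w ^ (j - i) * (12 * (t ^ k - min (t ^ k) ((r0 * ?q ^ i) ^ k)))"
      using diff t by (intro mult_left_mono mult_mono) (auto simp: power2_eq_square)
    also have "\<dots> = 12 * ?f i" by simp
    also have "?f i \<le> (\<Sum>i<j. ?f i)" using ij f0 by (intro member_le_sum) auto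
    then have "12 * ?f i \<le> 12 * (\<Sum>i<j. ?f i)" by simp
    finally have "t ^ k * (t / (r0 * ?q ^ j)) \<le> 12 * (\<Sum>i<j. ?f i)" .
    moreover have "0 \<le> ?q ^ (k + 1) * r0 ^ k * ?w ^ j" using r0 by simp
    moreover have "t ^ (k + 1) / (r0 * ?q ^ j) = t ^ k * (t / (r0 * ?q ^ j))" by simp
    ultimately show ?thesis by linarith
  qed
qed

text \<open>Each \<open>P l\<close> occurs for \<open>i \<le> l < j\<close>; the powers of 20/21 sum
  to at most 21 over \<open>i\<close> and to at most 20 over \<open>j\<close>, and 420 = 20 * 21.
  The recursion for \<open>T\<close> realises this, with \<open>20 * T J\<close> as the part still
  to come.\<close>

lemma geometric_convolution_bound:
  fixes P :: "nat \<Rightarrow> real"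
  assumes P: "\<And>l. P l \<ge> 0"
  shows "(\<Sum>j\<le>J. \<Sum>i<j. (20/21) ^ (j - i) * (\<Sum>l\<in>{i..<j}. P l)) \<le> 420 * (\<Sum>l<J. P l)"
proof -
  let ?w = "20/21 :: real"
  define T where "T = (\<lambda>j. \<Sum>i<j. ?w ^ (j - i) * (\<Sum>l\<in>{i..<j}. P l))"
  have T0: "T j \<ge> 0" for j unfolding T_def using P by (intro sum_nonneg mult_nonneg_nonneg) auto
  have geo: "(\<Sum>i<Suc j. ?w ^ (Suc j - i)) \<le> 20" for j
  proof -
    have "(\<Sum>i<Suc j. ?w ^ (Suc j - i)) = (\<Sum>i<Suc j. ?w ^ Suc i)"
      by (rule sum.reindex_bij_witness[of _ "\<lambda>i. j - i" "\<lambda>i. j - i"]) (auto simp: Suc_diff_le)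
    also have "\<dots> = 20 * (1 - ?w ^ Suc j)"
      by (induction j) auto
    finally show ?thesis by simp
  qed
  have step: "T (Suc j) \<le> ?w * T j + 20 * P j" for j
  proof -
    have "T (Suc j) = (\<Sum>i<Suc j. ?w ^ (Suc j - i) * (\<Sum>l\<in>{i..<j}. P l) + ?w ^ (Suc j - i) * P j)"
      unfolding T_def by (intro sum.cong) (auto simp: distrib_left)
    also have "\<dots> = (\<Sum>i<Suc j. ?w ^ (Suc j - i) * (\<Sum>l\<in>{i..<j}. P l)) + (\<Sum>i<Suc j. ?w ^ (Suc j - i)) * P j"
      by (simp only: sum.distrib sum_distrib_right)
    also have "(\<Sum>i<Suc j. ?w ^ (Suc j - i) * (\<Sum>l\<in>{i..<j}. P l)) = ?w * T j"
      by (simp add: T_def sum_distrib_left Suc_diff_le mult.assoc)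
    finally show ?thesis using mult_right_mono[OF geo[of j] P[of j]] by simp
  qed
  have "(\<Sum>j\<le>J. T j) + 20 * T J \<le> 420 * (\<Sum>l<J. P l)"
  proof (induction J)
    case 0
    show ?case by (simp add: T_def)
  next
    case (Suc J)
    then show ?case using step[of J] by simp
  qed
  then show ?thesis using T0[of J] by (simp add: T_def)
qed

section \<open>Optimal covers at successive scales\<close>

lemma esum_mono_edges:
  assumes "\<And>x y. (x, y) \<in> set (zip xs (tl xs)) \<Longrightarrow> c x y \<le> c' x y"
  shows "esum c xs \<le> esum c' xs"
  using assms by (induction xs rule: induct_list012) (auto intro: add_mono)

lemma edges_le_of_esum_le_min:
  assumes "esum c xs \<le> esum (\<lambda>x y. min (c x y) l) xs" "(x, y) \<in> set (zip xs (tl xs))"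
  shows "c x y \<le> l"
  using assms
proof (induction xs rule: induct_list012)
  case (3 a b zs)
  have "esum (\<lambda>x y. min (c x y) l) (b # zs) \<le> esum c (b # zs)" by (rule esum_mono) simp
  then have "c a b \<le> l" "esum c (b # zs) \<le> esum (\<lambda>x y. min (c x y) l) (b # zs)"
    using "3.prems"(1) by auto
  then show ?case using "3.IH"(2) "3.prems"(2) by auto
qed auto

lemma cover_cost_mono: 
  assumes "\<And>x y. c x y \<le> c' x y" shows "cover_cost c l pss \<le> cover_cost c' l pss"
  by (induction pss) (auto intro!: add_mono esum_mono assms)

text \<open>Cutting an edge with \<open>c x y > l\<close> would lower the cost. The comparison is
  made for the whole cover and then localised, since cutting never raises the cost of the other
  paths.\<close>

lemma opt_cover_edge_le:
  assumes opt: "opt_cover c l X pss" and p: "p \<in> set pss" and e: "(x, y) \<in> set (zip p (tl p))"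
  shows "c x y \<le> l"
proof (rule edges_le_of_esum_le_min[OF _ e])
  let ?c' = "\<lambda>x y. min (c x y) l"
  have le: "cover_cost c l pss \<le> cover_cost ?c' l pss"
    using opt_cover_cut[OF opt] opt by (simp add: opt_cover_def)
  obtain us vs where pss: "pss = us @ p # vs" using split_list[OF p] by blast
  have "cover_cost ?c' l us \<le> cover_cost c l us" "cover_cost ?c' l vs \<le> cover_cost c l vs"
    by (intro cover_cost_mono; simp)+
  moreover have "cover_cost b l pss = cover_cost b l us + (esum b p + l) + cover_cost b l vs" for b
    by (simp add: pss cover_cost_def)
  ultimately show "esum c p \<le> esum ?c' p" using le by simp
qed

lemma cover_cost_split: "cover_cost c l pss = (\<Sum>p\<leftarrow>pss. esum c p) + l * length pss"
  by (induction pss) (auto simp: algebra_simps)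

text \<open>The cover \<open>qss\<close> of the larger scale, cut at the smaller one, competes with
  \<open>pss\<close>. What the cutting saves is thus paid for by the growth of the cost between the
  scales.\<close>

lemma opt_cover_excess:
  assumes "opt_cover c l X pss" "opt_cover c l' X qss" "l \<le> l'"
  shows "(\<Sum>p\<leftarrow>qss. esum (\<lambda>x y. c x y - min (c x y) l) p) \<le> cover_cost c l' qss - cover_cost c l pss"
proof -
  have "cover_cost c l pss \<le> cover_cost (\<lambda>x y. min (c x y) l) l qss"
    using opt_cover_cut[OF assms(1)] assms(2) by (simp add: opt_cover_def)
  also have "\<dots> \<le> (\<Sum>p\<leftarrow>qss. esum (\<lambda>x y. min (c x y) l) p) + l' * length qss"
    unfolding cover_cost_split using assms(3) by (simp add: mult_right_mono)
  finally show ?thesis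
    unfolding cover_cost_split esum_diff sum_list_subtractf by simp
qed

lemma opt_cover_cost_step:
  assumes "opt_cover c l X pss" "opt_cover c l' X qss"
  shows "cover_cost c l' qss \<le> cover_cost c l pss + (l' - l) * length pss"
  using assms cover_cost_mono_const[of c l' pss l] by (auto simp: opt_cover_def)

lemma sum_list_length_cover:
  assumes "path_cover X pss" "a \<ge> 0"
  shows "(\<Sum>p\<leftarrow>pss. esum (\<lambda>x y. a) p) \<le> a * card X"
proof -
  have "(\<Sum>p\<leftarrow>pss. esum (\<lambda>x y. a) p) \<le> (\<Sum>p\<leftarrow>pss. a * length p)"
    by (intro sum_list_mono esum_const_le assms)
  also have "\<dots> = a * length (concat pss)"
    by (induction pss) (auto simp: algebra_simps)
  also have "length (concat pss) = card X"
    using assms(1) by (metis distinct_card path_cover_def)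
  finally show ?thesis .
qed


text \<open>The bottom scale \<open>r0\<close> stays free; it is chosen later, depending on X, so
  small that the cover by single points costs no more than the main term.\<close>

locale scales =
  fixes k :: nat and X :: "(nat \<Rightarrow> real) set" and J :: nat and cov :: "nat \<Rightarrow> (nat \<Rightarrow> real) list list"
    and R r0 :: real
  assumes k2: "k \<ge> 2" and X: "X \<subseteq> unit_cube k" "X \<noteq> {}"
    and r0: "r0 > 0" and R: "R = r0 * (21/20) ^ J"
    and opt: "opt_cover (\<lambda>x y. euclid_dist k x y ^ k) ((r0 * (21/20) ^ j) ^ k) X (cov j)"
begin

abbreviation "rad \<equiv> \<lambda>j. r0 * (21/20) ^ j"
abbreviation "lam \<equiv> \<lambda>j. rad j ^ k"
abbreviation "pwk \<equiv> \<lambda>x y. euclid_dist k x y ^ k"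
abbreviation "P \<equiv> \<lambda>j. lam j * length (cov j)"
abbreviation "cost \<equiv> \<lambda>j. cover_cost pwk (lam j) (cov j)"
abbreviation "longer \<equiv> \<lambda>j. \<Sum>p\<leftarrow>cov j. esum (\<lambda>x y. euclid_dist k x y ^ (k + 1)) p"
abbreviation "V \<equiv> (1 + 8 / 5 * R / sqrt k) ^ (k - 1) * (1 + 2 * R)"

lemma rad_pos: "rad j > 0" using r0 by simp

lemma finX: "finite X" using opt[of 0] by (auto simp: opt_cover_def path_cover_def)

lemma cover: "path_cover X (cov j)" using opt[of j] by (simp add: opt_cover_def)

lemma lam_Suc: "lam (Suc j) = (21/20) ^ k * lam j"
proof -
  have "rad (Suc j) = 21/20 * rad j" by simp
  then show ?thesis by (simp only: power_mult_distrib)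
qed

lemma lam_mono: "i \<le> j \<Longrightarrow> lam i \<le> lam j"
  using r0 by (intro power_mono mult_left_mono power_increasing) auto

lemma P_nonneg: "P j \<ge> 0" using rad_pos[of j] by simp

lemma cost_diff: "i \<le> j \<Longrightarrow> cost j - cost i \<le> (21/20) ^ k * (\<Sum>l\<in>{i..<j}. P l)"
proof (induction j rule: dec_induct)
  case (step j)
  have "cost (Suc j) \<le> cost j + (lam (Suc j) - lam j) * length (cov j)"
    by (rule opt_cover_cost_step[OF opt opt])
  also have "(lam (Suc j) - lam j) * length (cov j) \<le> (21/20) ^ k * P j"
    unfolding lam_Suc using P_nonneg[of j] by (simp add: algebra_simps)
  finally show ?case using step by (simp add: distrib_left)
qed simp

lemma cost_0: "cost 0 \<le> lam 0 * card X"
  by (rule opt_cover_card_le[OF finX opt])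

text \<open>\<open>edge_scale_bound\<close> charges edges to their excess over lower scales,
  \<open>opt_cover_excess\<close> bounds that by the growth of the cost, and the growth is a sum of
  the \<open>P l\<close>. So long edges are controlled by path numbers at lower scales. The exponent
  is \<open>k + 1\<close> because the error cubes have volume of order gap^k and carry the gap once
  more as weight.\<close>

lemma longer_bound:
  "longer j / rad j \<le> (21/20) ^ (k + 1) * lam 0 * card X * (20/21) ^ j
    + 12 * (21/20) ^ k * (\<Sum>i<j. (20/21) ^ (j - i) * (\<Sum>l\<in>{i..<j}. P l))"
proof -
  let ?a = "(21/20) ^ (k + 1) * r0 ^ k * (20/21) ^ j :: real"
  let ?ex = "\<lambda>i x y. pwk x y - min (pwk x y) (lam i)"
  have edge: "esum (\<lambda>x y. euclid_dist k x y ^ (k + 1)) p / rad j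
     \<le> esum (\<lambda>x y. ?a) p + (\<Sum>i<j. 12 * (20/21) ^ (j - i) * esum (?ex i) p)" if p: "p \<in> set (cov j)" for p
  proof -
    have "esum (\<lambda>x y. euclid_dist k x y ^ (k + 1)) p / rad j = esum (\<lambda>x y. euclid_dist k x y ^ (k + 1) / rad j) p"
      using esum_mult[of "1 / rad j" "\<lambda>x y. euclid_dist k x y ^ (k + 1)" p] by simp
    also have "\<dots> \<le> esum (\<lambda>x y. ?a + (\<Sum>i<j. 12 * (20/21) ^ (j - i) * ?ex i x y)) p"
    proof (rule esum_mono_edges)
      fix x y assume "(x, y) \<in> set (zip p (tl p))"
      then have "pwk x y \<le> lam j" by (rule opt_cover_edge_le[OF opt p])
      then have "euclid_dist k x y \<le> rad j"
        using power_le_imp_le_base[of "euclid_dist k x y" "k - 1" "rad j"] k2 rad_pos[of j] by simp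
      from edge_scale_bound[OF euclid.d_nonneg this r0 k2]
      show "euclid_dist k x y ^ (k + 1) / rad j \<le> ?a + (\<Sum>i<j. 12 * (20/21) ^ (j - i) * ?ex i x y)"
        by (simp only: sum_distrib_left mult.assoc)
    qed
    also have "\<dots> = esum (\<lambda>x y. ?a) p + (\<Sum>i<j. 12 * (20/21) ^ (j - i) * esum (?ex i) p)"
      by (simp only: esum_add esum_sum[OF finite_lessThan] esum_mult)
    finally show ?thesis .
  qed
  have "longer j / rad j = (\<Sum>p\<leftarrow>cov j. esum (\<lambda>x y. euclid_dist k x y ^ (k + 1)) p / rad j)"
    using sum_list_const_mult[of "1 / rad j" "esum (\<lambda>x y. euclid_dist k x y ^ (k + 1))" "cov j"] by simp
  also have "\<dots> \<le> (\<Sum>p\<leftarrow>cov j. esum (\<lambda>x y. ?a) p + (\<Sum>i<j. 12 * (20/21) ^ (j - i) * esum (?ex i) p))"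
    by (intro sum_list_mono edge)
  also have "\<dots> = (\<Sum>p\<leftarrow>cov j. esum (\<lambda>x y. ?a) p) + (\<Sum>i<j. 12 * (20/21) ^ (j - i) * (\<Sum>p\<leftarrow>cov j. esum (?ex i) p))"
  proof -
    have "(\<Sum>p\<leftarrow>ps. f p + (\<Sum>i<j. b i * h i p)) = (\<Sum>p\<leftarrow>ps. f p) + (\<Sum>i<j. b i * (\<Sum>p\<leftarrow>ps. h i p))"
      for f :: "(nat \<Rightarrow> real) list \<Rightarrow> real" and b h and ps
      by (induction ps) (auto simp: distrib_left sum.distrib)
    then show ?thesis .
  qed
  also have "(\<Sum>p\<leftarrow>cov j. esum (\<lambda>x y. ?a) p) \<le> ?a * card X"
    by (rule sum_list_length_cover[OF cover]) (use r0 in simp)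
  also have "(\<Sum>i<j. 12 * (20/21) ^ (j - i) * (\<Sum>p\<leftarrow>cov j. esum (?ex i) p))
      \<le> (\<Sum>i<j. 12 * (20/21) ^ (j - i) * ((21/20) ^ k * (\<Sum>l\<in>{i..<j}. P l)))"
  proof (intro sum_mono mult_left_mono)
    fix i assume "i \<in> {..<j}"
    then have ij: "i \<le> j" by simp
    show "(\<Sum>p\<leftarrow>cov j. esum (?ex i) p) \<le> (21/20) ^ k * (\<Sum>l\<in>{i..<j}. P l)"
      using opt_cover_excess[OF opt opt lam_mono[OF ij]] cost_diff[OF ij] by linarith
  qed simp
  also have "\<dots> = 12 * (21/20) ^ k * (\<Sum>i<j. (20/21) ^ (j - i) * (\<Sum>l\<in>{i..<j}. P l))"
    by (simp only: sum_distrib_left mult_ac)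
  finally show ?thesis by (simp add: mult_ac)
qed

lemma sum_longer_bound:
  "(\<Sum>j\<le>J. longer j / rad j) \<le> 21 * (21/20) ^ (k + 1) * lam 0 * card X + 5040 * (21/20) ^ k * (\<Sum>j\<le>J. P j)"
proof -
  have "(\<Sum>j\<le>J. longer j / rad j) \<le> (\<Sum>j\<le>J. (21/20) ^ (k + 1) * lam 0 * card X * (20/21) ^ j
    + 12 * (21/20) ^ k * (\<Sum>i<j. (20/21) ^ (j - i) * (\<Sum>l\<in>{i..<j}. P l)))"
    by (intro sum_mono longer_bound)
  also have "\<dots> = (21/20) ^ (k + 1) * lam 0 * card X * (\<Sum>j\<le>J. (20/21) ^ j)
      + 12 * (21/20) ^ k * (\<Sum>j\<le>J. \<Sum>i<j. (20/21) ^ (j - i) * (\<Sum>l\<in>{i..<j}. P l))"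
    by (simp only: sum.distrib sum_distrib_left)
  also have "\<dots> \<le> (21/20) ^ (k + 1) * lam 0 * card X * 21 + 12 * (21/20) ^ k * (420 * (\<Sum>j\<le>J. P j))"
  proof (intro add_mono mult_left_mono)
    have "(\<Sum>j\<le>J. (20/21) ^ j) = 21 - 20 * (20/21 :: real) ^ J" by (induction J) auto
    then show "(\<Sum>j\<le>J. (20/21) ^ j) \<le> (21 :: real)" by simp
    have "(\<Sum>l<J. P l) \<le> (\<Sum>j\<le>J. P j)" by (intro sum_mono2) (use P_nonneg in auto)
    then show "(\<Sum>j\<le>J. \<Sum>i<j. (20/21) ^ (j - i) * (\<Sum>l\<in>{i..<j}. P l)) \<le> 420 * (\<Sum>j\<le>J. P j)"
      using order_trans[OF geometric_convolution_bound[of P J, OF P_nonneg] mult_left_mono] by simp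
  qed (use r0 in auto)
  finally show ?thesis by simp
qed

text \<open>Divide \<open>cover_measure\<close> by the radius and sum. On the left the powers of the
  radius combine to \<open>lam j\<close>; in the integral every point of the largest box receives at
  most 21 by \<open>sum_geometric_cutoff\<close>; the error cubes are bounded through
  \<open>sum_gap_le\<close>.\<close>

lemma measure_bound:
  assumes eps: "0 < eps" "eps \<le> 1"
  shows "1 / 2160000 * (8 / 5 / sqrt k) ^ (k - 1) * (\<Sum>j\<le>J. P j)
    \<le> 21 * (1 + 1 / eps) * V + 4 * (2 * eps) ^ k * ((\<Sum>j\<le>J. P j) + (\<Sum>j\<le>J. longer j / rad j))"
proof -
  let ?M = "PiM {..<k} (\<lambda>_. lborel :: real measure)"
  let ?g = "\<lambda>j. euclid.gap k (rad j) (cov j)"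
  let ?c = "\<lambda>j. (rad j / 200)\<^sup>2 / 4 * (2 / 27 * (8 / 5 * rad j / sqrt k) ^ (k - 1))"
  let ?Y = "\<lambda>j. \<Sum>x\<in>X. 2 * ?g j x * (2 * eps * ?g j x) ^ k"
  let ?I = "\<lambda>j. \<integral>\<^sup>+x. ennreal (near_weight k (rad j) X x) * indicator (enlarged_box k R) x \<partial>?M"
  have Rpos: "R > 0" using r0 R by simp
  have radR: "rad j \<le> R" if "j \<le> J" for j
    using that r0 unfolding R by (intro mult_left_mono power_increasing) auto
  have g0: "?g j x \<ge> 0" for j x using euclid.gap_nonneg rad_pos[of j] by simp
  have Y0: "?Y j \<ge> 0" for j using g0 eps by (intro sum_nonneg mult_nonneg_nonneg) auto
  have step: "ennreal (?c j / rad j * length (cov j)) \<le> ennreal (1 + 1 / eps) * (ennreal (1 / rad j) * ?I j) + ennreal (?Y j / rad j)"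
    if "j \<le> J" for j
  proof -
    have "ennreal (?c j) * of_nat (length (cov j)) \<le> ennreal (1 + 1 / eps) * ?I j + ennreal (?Y j)"
      by (rule cover_measure[OF X k2 rad_pos radR[OF that] eps opt])
    then have "ennreal (1 / rad j) * (ennreal (?c j) * of_nat (length (cov j))) \<le> ennreal (1 / rad j) * (ennreal (1 + 1 / eps) * ?I j + ennreal (?Y j))"
      by (rule mult_left_mono) simp
    moreover have "ennreal (1 / rad j) * (ennreal (?c j) * of_nat (length (cov j))) = ennreal (?c j / rad j * length (cov j))"
    proof -
      have "?c j \<ge> 0" using rad_pos[of j] by simp
      then have "ennreal (1 / rad j) * (ennreal (?c j) * ennreal (real (length (cov j)))) = ennreal (1 / rad j * (?c j * length (cov j)))"
        using rad_pos[of j] by (simp only: ennreal_mult[symmetric] of_nat_0_le_iff mult_nonneg_nonneg zero_le_divide_1_iff order_less_imp_le)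
      moreover have "1 / rad j * (?c j * length (cov j)) = ?c j / rad j * length (cov j)" by simp
      ultimately show ?thesis by (simp only: ennreal_of_nat_eq_real_of_nat)
    qed
    moreover have "ennreal (1 / rad j) * ennreal (?Y j) = ennreal (?Y j / rad j)"
      using Y0[of j] rad_pos[of j] by (subst ennreal_mult[symmetric]) auto
    ultimately show ?thesis by (simp only: distrib_left mult.left_commute)
  qed
  have NW: "(\<lambda>x. ennreal (near_weight k r X x) * indicator (enlarged_box k R) x) \<in> borel_measurable ?M" for r
    by (intro borel_measurable_times_ennreal enlarged_box_measurable
        measurable_compose[OF near_weight_measurable[OF finX] measurable_ennreal])
  have "(\<Sum>j\<le>J. ennreal (1 / rad j) * ?I j) = (\<Sum>j\<le>J. \<integral>\<^sup>+x. ennreal (1 / rad j) * (ennreal (near_weight k (rad j) X x) * indicator (enlarged_box k R) x) \<partial>?M)"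
    by (intro sum.cong refl nn_integral_cmult[symmetric] NW)
  also have "\<dots> = (\<integral>\<^sup>+x. (\<Sum>j\<le>J. ennreal (1 / rad j) * (ennreal (near_weight k (rad j) X x) * indicator (enlarged_box k R) x)) \<partial>?M)"
    by (intro nn_integral_sum[symmetric] borel_measurable_times_ennreal[OF borel_measurable_const NW])
  also have "\<dots> \<le> (\<integral>\<^sup>+x. ennreal 21 * indicator (enlarged_box k R) x \<partial>?M)"
  proof (rule nn_integral_mono)
    fix x
    have cd: "cube_dist k X x \<ge> 0" using cube_dist_attained[OF finX X(2), of k x] euclid.d_nonneg by metis
    have "(\<Sum>j\<le>J. ennreal (1 / rad j) * ennreal (near_weight k (rad j) X x)) = (\<Sum>j\<le>J. ennreal (near_weight k (rad j) X x / rad j))"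
      using rad_pos[THEN less_imp_le] cd
      by (intro sum.cong refl) (subst ennreal_mult[symmetric], auto simp: near_weight_def)
    also have "\<dots> = ennreal (\<Sum>j\<le>J. near_weight k (rad j) X x / rad j)"
      using rad_pos[THEN less_imp_le] cd by (intro sum_ennreal) (auto simp: near_weight_def)
    also have "(\<Sum>j\<le>J. near_weight k (rad j) X x / rad j) = (\<Sum>j\<le>J. if cube_dist k X x \<le> rad j then cube_dist k X x / rad j else 0)"
      by (intro sum.cong refl) (simp add: near_weight_def)
    also have "ennreal \<dots> \<le> ennreal 21"
      by (intro ennreal_leI sum_geometric_cutoff cd r0)
    finally have "(\<Sum>j\<le>J. ennreal (1 / rad j) * ennreal (near_weight k (rad j) X x)) \<le> ennreal 21" .
    then show "(\<Sum>j\<le>J. ennreal (1 / rad j) * (ennreal (near_weight k (rad j) X x) * indicator (enlarged_box k R) x))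
       \<le> ennreal 21 * indicator (enlarged_box k R) x"
      by (cases "x \<in> enlarged_box k R") auto
  qed
  also have "\<dots> = ennreal 21 * ennreal V"
    using enlarged_box_measure[of k R] k2 Rpos enlarged_box_measurable[of k R] by (simp add: nn_integral_cmult)
  finally have I: "(\<Sum>j\<le>J. ennreal (1 / rad j) * ?I j) \<le> ennreal 21 * ennreal V" .
  have V0: "V \<ge> 0" using Rpos by simp
  have "ennreal (\<Sum>j\<le>J. ?c j / rad j * length (cov j)) = (\<Sum>j\<le>J. ennreal (?c j / rad j * length (cov j)))"
    using r0 by (intro sum_ennreal[symmetric] mult_nonneg_nonneg divide_nonneg_nonneg) auto
  also have "\<dots> \<le> (\<Sum>j\<le>J. ennreal (1 + 1 / eps) * (ennreal (1 / rad j) * ?I j) + ennreal (?Y j / rad j))"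
    by (intro sum_mono step) simp
  also have "\<dots> = ennreal (1 + 1 / eps) * (\<Sum>j\<le>J. ennreal (1 / rad j) * ?I j) + ennreal (\<Sum>j\<le>J. ?Y j / rad j)"
    using Y0 rad_pos by (simp only: sum.distrib sum_distrib_left sum_ennreal divide_nonneg_pos)
  also have "\<dots> \<le> ennreal (1 + 1 / eps) * (ennreal 21 * ennreal V) + ennreal (\<Sum>j\<le>J. ?Y j / rad j)"
    by (intro add_right_mono mult_left_mono I) simp
  also have "\<dots> = ennreal (21 * (1 + 1 / eps) * V + (\<Sum>j\<le>J. ?Y j / rad j))"
  proof -
    have "ennreal (1 + 1 / eps) * (ennreal 21 * ennreal V) = ennreal (21 * (1 + 1 / eps) * V)"
    proof -
      have "ennreal 21 * ennreal V = ennreal (21 * V)" by (rule ennreal_mult[symmetric]) (use V0 in auto)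
      then have "ennreal (1 + 1 / eps) * (ennreal 21 * ennreal V) = ennreal ((1 + 1 / eps) * (21 * V))"
        using V0 eps by (simp only:) (rule ennreal_mult[symmetric], auto)
      then show ?thesis by (simp only: mult_ac)
    qed
    moreover have "(\<Sum>j\<le>J. ?Y j / rad j) \<ge> 0" by (rule sum_nonneg) (rule divide_nonneg_pos[OF Y0 rad_pos])
    ultimately show ?thesis using V0 eps by (simp only:) (rule ennreal_plus[symmetric], auto intro!: mult_nonneg_nonneg)
  qed
  finally have main: "(\<Sum>j\<le>J. ?c j / rad j * length (cov j)) \<le> 21 * (1 + 1 / eps) * V + (\<Sum>j\<le>J. ?Y j / rad j)"
  proof (subst (asm) ennreal_le_iff)
    show "0 \<le> 21 * (1 + 1 / eps) * V + (\<Sum>j\<le>J. ?Y j / rad j)"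
      using eps by (intro add_nonneg_nonneg mult_nonneg_nonneg[OF _ V0] sum_nonneg[OF divide_nonneg_pos[OF Y0 rad_pos]]) auto
  qed
  \<comment> \<open>1 / 2160000 is (1 / 200)^2 / 4 * (2 / 27).\<close>
  have lhs: "(\<Sum>j\<le>J. ?c j / rad j * length (cov j)) = 1 / 2160000 * (8 / 5 / sqrt k) ^ (k - 1) * (\<Sum>j\<le>J. P j)"
    unfolding sum_distrib_left
  proof (intro sum.cong refl)
    fix j
    define x where "x = rad j"
    have x: "x > 0" using rad_pos by (simp add: x_def)
    have 1: "(8 / 5 * x / sqrt k) ^ (k - 1) = (8 / 5 / sqrt k) ^ (k - 1) * x ^ (k - 1)"
      by (simp flip: power_mult_distrib)
    have 2: "x ^ k = x * x ^ (k - 1)" using k2 by (metis power_minus_mult mult.commute gr0I not_numeral_le_zero)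
    have "(x / 200)\<^sup>2 / 4 * (2 / 27 * (Q * Y)) / x * n = 1 / 2160000 * Q * (x * Y * n)" for Q Y n :: real
      using x by (simp add: power2_eq_square)
    then show "?c j / rad j * length (cov j) = 1 / 2160000 * (8 / 5 / sqrt k) ^ (k - 1) * P j"
      unfolding x_def[symmetric] 1 2 by blast
  qed
  have Yj: "?Y j / rad j \<le> 4 * (2 * eps) ^ k * (P j + longer j / rad j)" for j
  proof -
    have "?Y j = 2 * (2 * eps) ^ k * (\<Sum>x\<in>X. ?g j x ^ (k + 1))"
      unfolding sum_distrib_left by (intro sum.cong refl) (simp add: power_mult_distrib)
    also have "\<dots> \<le> 2 * (2 * eps) ^ k * (2 * rad j ^ (k + 1) * length (cov j) + 2 * longer j)"
      by (intro mult_left_mono euclid.sum_gap_le[OF cover less_imp_le[OF rad_pos]]) (use eps in auto)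
    finally have "?Y j / rad j \<le> 2 * (2 * eps) ^ k * (2 * rad j ^ (k + 1) * length (cov j) + 2 * longer j) / rad j"
      using rad_pos[of j] by (intro divide_right_mono) auto
    also have "\<dots> = 4 * (2 * eps) ^ k * (P j + longer j / rad j)"
    proof -
      have "2 * B * (2 * x ^ (k + 1) * n + 2 * L) / x = 4 * B * (x ^ k * n + L / x)" if "x > 0" for B x n L :: real
        using that by (simp add: field_simps)
      from this[OF rad_pos[of j]] show ?thesis .
    qed
    finally show ?thesis .
  qed
  have "(\<Sum>j\<le>J. ?Y j / rad j) \<le> (\<Sum>j\<le>J. 4 * (2 * eps) ^ k * (P j + longer j / rad j))"
    by (intro sum_mono Yj)
  also have "\<dots> = 4 * (2 * eps) ^ k * ((\<Sum>j\<le>J. P j) + (\<Sum>j\<le>J. longer j / rad j))"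
    by (simp only: sum_distrib_left[symmetric] sum.distrib)
  finally show ?thesis using main lhs by linarith
qed


text \<open>
  The edges of the covers enter the bound with the tiny factor \<open>(2 * eps) ^ k\<close>; since they are
  controlled by the sum on the left-hand side, they can be absorbed there.
\<close>

lemma absorb:
  assumes "4 * (2 * eps) ^ k * (1 + 5040 * (21/20) ^ k) \<le> 1 / 4320000 * (8 / 5 / sqrt k) ^ (k - 1)"
    and eps: "0 < eps" "eps \<le> 1"
  defines "\<gamma> \<equiv> 1 / 2160000 * (8 / 5 / sqrt k) ^ (k - 1)"
  shows "\<gamma> * (\<Sum>j\<le>J. P j) \<le> 42 * (1 + 1 / eps) * V + \<gamma> * lam 0 * card X"
proof -
  let ?A = "\<Sum>j\<le>J. P j" and ?L = "lam 0 * card X" and ?E = "4 * (2 * eps) ^ k"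
  have A0: "?A \<ge> 0" using P_nonneg by (intro sum_nonneg) auto
  have L0: "?L \<ge> 0" using r0 by simp
  have E0: "?E \<ge> 0" using eps by simp
  have M: "\<gamma> * ?A \<le> 21 * (1 + 1 / eps) * V + ?E * (?A + (\<Sum>j\<le>J. longer j / rad j))"
    unfolding \<gamma>_def by (rule measure_bound[OF eps])
  have "?E * (?A + (\<Sum>j\<le>J. longer j / rad j)) \<le> ?E * (?A + (21 * (21/20) ^ (k + 1) * ?L + 5040 * (21/20) ^ k * ?A))"
    using sum_longer_bound by (intro mult_left_mono add_left_mono E0) (simp add: mult.assoc)
  also have "\<dots> = ?E * (1 + 5040 * (21/20) ^ k) * ?A + ?E * (21 * (21/20) ^ (k + 1)) * ?L"
    by (simp add: algebra_simps)
  also have "\<dots> \<le> \<gamma> / 2 * ?A + \<gamma> / 2 * ?L"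
  proof (intro add_mono mult_right_mono A0 L0)
    show E: "?E * (1 + 5040 * (21/20) ^ k) \<le> \<gamma> / 2" using assms(1) by (simp add: \<gamma>_def)
    have "?E * (21 * (21/20) ^ (k + 1)) \<le> ?E * (1 + 5040 * (21/20) ^ k)"
      by (intro mult_left_mono E0) (simp add: add_increasing)
    then show "?E * (21 * (21/20) ^ (k + 1)) \<le> \<gamma> / 2" using E by linarith
  qed
  finally have **: "?E * (?A + (\<Sum>j\<le>J. longer j / rad j)) \<le> \<gamma> / 2 * ?A + \<gamma> / 2 * ?L" .
  have *: "\<gamma> * ?A \<le> 21 * (1 + 1 / eps) * V + (\<gamma> / 2 * ?A + \<gamma> / 2 * ?L)"
    by (rule order_trans[OF M add_left_mono[OF **]])
  have "x \<le> 2 * y + z" if "x \<le> y + (x / 2 + z / 2)" for x y z :: real using that by simp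
  from this[of "\<gamma> * ?A" "21 * (1 + 1 / eps) * V" "\<gamma> * ?L"] *
  have "\<gamma> * ?A \<le> 2 * (21 * (1 + 1 / eps) * V) + \<gamma> * ?L" by (simp only: times_divide_eq_left)
  then show ?thesis by (simp only: mult.assoc[symmetric])
qed

lemma top_cost: "cost J \<le> lam 0 * card X + (21/20) ^ k * (\<Sum>j\<le>J. P j)"
proof -
  have "cost J \<le> cost 0 + (21/20) ^ k * (\<Sum>l\<in>{0..<J}. P l)" using cost_diff[of 0 J] by simp
  moreover have "(\<Sum>l\<in>{0..<J}. P l) \<le> (\<Sum>j\<le>J. P j)" by (intro sum_mono2) (use P_nonneg in auto)
  then have "(21/20) ^ k * (\<Sum>l\<in>{0..<J}. P l) \<le> (21/20) ^ k * (\<Sum>j\<le>J. P j)" by (intro mult_left_mono) auto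
  ultimately show ?thesis using cost_0 by linarith
qed

end

section \<open>Choice of the constants\<close>

text \<open>For \<open>eps\<close> equal to 10^-6 / sqrt k the powers of sqrt k on the two sides
  differ by one favourable factor, and 2 * 10^-6 * 21/20 is small enough already for
  \<open>k = 2\<close>. On the other hand \<open>1 / eps\<close> grows only like sqrt k, which is
  harmless against an exponential gain.\<close>

lemma absorption_condition:
  assumes "k \<ge> 2"
  shows "4 * (2 * (1 / 10 ^ 6 / sqrt k)) ^ k * (1 + 5040 * (21/20) ^ k) \<le> 1 / 4320000 * (8 / 5 / sqrt k) ^ (k - 1)"
proof -
  obtain n where n: "k = Suc n" using assms by (cases k) auto
  have S: "sqrt k \<ge> 1" using assms by simp
  have "1 + 5040 * (21/20 :: real) ^ k \<le> 5041 * (21/20) ^ k" by simp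
  then have "4 * (2 / 10 ^ 6) ^ k * (1 + 5040 * (21/20) ^ k) \<le> 4 * (2 / 10 ^ 6) ^ k * (5041 * (21/20 :: real) ^ k)"
    by (intro mult_left_mono) auto
  also have "\<dots> = 20164 * (21 / 10 ^ 7) ^ k"
  proof -
    have "(2 / 10 ^ 6) ^ k * (21/20 :: real) ^ k = (21 / 10 ^ 7) ^ k" by (simp flip: power_mult_distrib)
    then show ?thesis by simp
  qed
  also have "\<dots> \<le> 20164 * (21 / 10 ^ 7)\<^sup>2" using assms by (intro mult_left_mono power_decreasing) auto
  also have "\<dots> \<le> 1 / 4320000 * 1" by (simp add: power2_eq_square)
  also have "\<dots> \<le> 1 / 4320000 * ((8 / 5) ^ n * sqrt k)"
    using mult_mono[of 1 "(8/5::real) ^ n" 1 "sqrt k"] S by (intro mult_left_mono) auto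
  finally have *: "4 * (2 / 10 ^ 6) ^ k * (1 + 5040 * (21/20) ^ k) \<le> 1 / 4320000 * ((8 / 5) ^ n * sqrt k)" .
  have "4 * (2 * (1 / 10 ^ 6 / sqrt k)) ^ k * (1 + 5040 * (21/20) ^ k)
     = 4 * (2 / 10 ^ 6) ^ k * (1 + 5040 * (21/20) ^ k) / sqrt k ^ k"
    by (simp add: power_divide)
  also have "\<dots> \<le> 1 / 4320000 * ((8 / 5) ^ n * sqrt k) / sqrt k ^ k"
    by (rule divide_right_mono[OF *]) simp
  also have "\<dots> = 1 / 4320000 * (8 / 5 / sqrt k) ^ (k - 1)"
    using S by (simp add: n power_divide)
  finally show ?thesis .
qed

text \<open>21/20 is the ratio of the scales, 187/125 = 1 + 1.6 * 0.31 the side of the enlarged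
  cube, and 5/8 * sqrt k the inverse of the box side 1.6 / sqrt k. Their product is 3927/4000 * sqrt
  k.\<close>

definition small_bound :: "nat \<Rightarrow> real" where
  "small_bound k = 44 * (21/20) ^ k * (1 + 10 ^ 6 * sqrt k) *
     ((187 / 125) ^ (k - 1) * (1 + 31 / 50 * sqrt k)) * (2160000 * (5 / 8 * sqrt k) ^ (k - 1))"

lemma small_cover:
  assumes k: "k \<ge> 2" and X: "X \<subseteq> unit_cube k" "finite X" "X \<noteq> {}"
  shows "\<exists>pss. opt_cover (\<lambda>x y. euclid_dist k x y ^ k) ((31 / 100 * sqrt k) ^ k) X pss \<and>
     cover_cost (\<lambda>x y. euclid_dist k x y ^ k) ((31 / 100 * sqrt k) ^ k) pss \<le> small_bound k"
proof -
  define R where "R = 31 / 100 * sqrt k"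
  have R: "R > 0" using k by (simp add: R_def)
  define V where "V = (1 + 8 / 5 * R / sqrt k) ^ (k - 1) * (1 + 2 * R)"
  define \<gamma> where "\<gamma> = 1 / 2160000 * (8 / 5 / sqrt k) ^ (k - 1)"
  have V0: "V > 0" using R by (simp add: V_def add_pos_nonneg)
  have g0: "\<gamma> > 0" using k by (simp add: \<gamma>_def)
  have n0: "card X > 0" using X by (simp add: card_gt_0_iff)
  \<comment> \<open>Going down \<open>J\<close> steps from \<open>R\<close> makes the cost of all
    single points, \<open>r0 ^ k * card X\<close>, at most \<open>V / \<gamma>\<close>.\<close>
  have "\<exists>J. ((20/21) ^ k) ^ J < V / \<gamma> / (R ^ k * card X)"
    by (rule real_arch_pow_inv) (use V0 g0 R n0 k in \<open>auto intro!: divide_pos_pos power_less_one_iff[THEN iffD2]\<close>)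
  then obtain J where J: "((20/21) ^ k) ^ J < V / \<gamma> / (R ^ k * card X)" ..
  define r0 where "r0 = R * (20/21) ^ J"
  have r0: "r0 > 0" using R by (simp add: r0_def)
  have RJ: "R = r0 * (21/20) ^ J"
  proof -
    have "(20/21) ^ J * (21/20 :: real) ^ J = 1" by (simp flip: power_mult_distrib)
    then show ?thesis by (simp add: r0_def)
  qed
  have L: "r0 ^ k * card X \<le> V / \<gamma>"
  proof -
    have "r0 ^ k = R ^ k * ((20/21) ^ k) ^ J"
      by (simp add: r0_def power_mult_distrib flip: power_mult) (simp add: mult.commute)
    moreover have "((20/21) ^ k) ^ J * (R ^ k * card X) < V / \<gamma>"
      using J R n0 by (subst (asm) pos_less_divide_eq) auto
    ultimately show ?thesis by (simp add: mult_ac)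
  qed
  have "\<exists>cov. \<forall>j. opt_cover (\<lambda>x y. euclid_dist k x y ^ k) ((r0 * (21/20) ^ j) ^ k) X (cov j)"
    using opt_cover_exists[OF X(2)] by (intro choice allI)
  then obtain cov where cov: "\<And>j. opt_cover (\<lambda>x y. euclid_dist k x y ^ k) ((r0 * (21/20) ^ j) ^ k) X (cov j)"
    by blast
  interpret scales k X J cov R r0
    by standard (use k X r0 RJ cov in auto)
  let ?eps = "1 / 10 ^ 6 / sqrt k"
  let ?A = "\<Sum>j\<le>J. P j"
  have S1: "sqrt k \<ge> 1" using k by simp
  have "?eps \<le> 1 / 10 ^ 6 / 1" by (intro divide_left_mono S1) (use k in auto)
  also have "\<dots> \<le> 1" by simp
  finally have "?eps \<le> 1" .
  moreover have "0 < ?eps" using k by simp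
  ultimately have eps: "0 < ?eps" "?eps \<le> 1" by blast+
  have inv: "1 / ?eps = 10 ^ 6 * sqrt k" by simp
  have lam0: "lam 0 = r0 ^ k" by simp
  have "\<gamma> * ?A \<le> 42 * (1 + 1 / ?eps) * V + \<gamma> * lam 0 * card X"
    unfolding V_def \<gamma>_def by (rule absorb[OF absorption_condition[OF k] eps])
  then have "\<gamma> * ?A \<le> 42 * (1 + 10 ^ 6 * sqrt k) * V + \<gamma> * (r0 ^ k * card X)"
    unfolding inv lam0 by (simp only: mult.assoc)
  then have "?A \<le> (42 * (1 + 10 ^ 6 * sqrt k) * V + \<gamma> * (r0 ^ k * card X)) / \<gamma>"
    using g0 by (simp only: pos_le_divide_eq mult.commute)
  also have "\<dots> = 42 * (1 + 10 ^ 6 * sqrt k) * (V / \<gamma>) + r0 ^ k * card X"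
    using g0 by (simp add: add_divide_distrib)
  finally have A: "?A \<le> 42 * (1 + 10 ^ 6 * sqrt k) * (V / \<gamma>) + V / \<gamma>" using L by linarith
  have q1: "(21/20 :: real) ^ k \<ge> 1" by simp
  have W0: "V / \<gamma> \<ge> 0" using V0 g0 by simp
  have "cost J \<le> V / \<gamma> + (21/20) ^ k * ?A" using top_cost L unfolding lam0 by linarith
  also have "\<dots> \<le> (21/20) ^ k * (V / \<gamma>) + (21/20) ^ k * (42 * (1 + 10 ^ 6 * sqrt k) * (V / \<gamma>) + V / \<gamma>)"
    using mult_right_mono[OF q1 W0] mult_left_mono[OF A, of "(21/20) ^ k"] by (intro add_mono) auto
  also have "\<dots> = (21/20) ^ k * (V / \<gamma>) * (42 * (1 + 10 ^ 6 * sqrt k) + 2)" by (simp add: algebra_simps)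
  also have "\<dots> \<le> (21/20) ^ k * (V / \<gamma>) * (44 * (1 + 10 ^ 6 * sqrt k))"
    using W0 S1 by (intro mult_left_mono mult_nonneg_nonneg) auto
  also have "\<dots> = small_bound k"
  proof -
    have "1 / \<gamma> = 2160000 * (5 / 8 * sqrt k) ^ (k - 1)"
      using k by (simp add: \<gamma>_def power_divide power_mult_distrib)
    moreover have "1 + 8 / 5 * R / sqrt k = 187 / 125" using k by (simp add: R_def)
    then have "V = (187 / 125) ^ (k - 1) * (1 + 31 / 50 * sqrt k)" by (simp only: V_def) (simp add: R_def)
    moreover have "V / \<gamma> = V * (1 / \<gamma>)" by simp
    ultimately have "(21/20) ^ k * (V / \<gamma>) * (44 * (1 + 10 ^ 6 * sqrt k)) = (21/20) ^ k *
       (((187 / 125) ^ (k - 1) * (1 + 31 / 50 * sqrt k)) * (2160000 * (5 / 8 * sqrt k) ^ (k - 1))) * (44 * (1 + 10 ^ 6 * sqrt k))"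
      by (simp only:)
    then show ?thesis unfolding small_bound_def by (simp only: mult_ac)
  qed
  finally have "cost J \<le> small_bound k" .
  moreover have "31 / 100 * sqrt k = r0 * (21/20) ^ J" using RJ by (simp only: R_def)
  ultimately show ?thesis using cov[of J] by auto
qed

section \<open>Joining the pieces\<close>

definition separated :: "('a \<Rightarrow> 'a \<Rightarrow> real) \<Rightarrow> real \<Rightarrow> 'a set \<Rightarrow> bool" where
  "separated d \<rho> S \<longleftrightarrow> (\<forall>x\<in>S. \<forall>y\<in>S. x \<noteq> y \<longrightarrow> \<rho> \<le> d x y)"

text \<open>Closest ends are joined first. If the length \<open>f\<close> of the first join is at
  least \<open>\<rho>\<close>, all n + 2 current ends are \<open>\<rho>\<close>-separated, which
  beats the n + 1 joins in total; if not, this join is not counted and the induction takes over. The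
  lengths need not be monotone, since a joined path brings a new end. Stating the sum for every
  \<open>c\<close> says that the joins and the old edges together are exactly the edges of the new
  path.\<close>

lemma (in semimetric) join_pieces:
  assumes "path_cover X pss" "length pss = Suc n"
  shows "\<exists>xs fs. distinct xs \<and> set xs = X \<and> length fs = n \<and>
    (\<forall>c. esum (\<lambda>x y. c (d x y)) xs = (\<Sum>p\<leftarrow>pss. esum (\<lambda>x y. c (d x y)) p) + (\<Sum>f\<leftarrow>fs. c f)) \<and>
    (\<forall>\<rho>. \<exists>S\<subseteq>X. separated d \<rho> S \<and> Suc (length (filter (\<lambda>f. f \<ge> \<rho>) fs)) \<le> card S)"
  using assms
proof (induction n arbitrary: pss)
  case 0
  then obtain p where p: "pss = [p]" by (metis length_0_conv length_Suc_conv One_nat_def)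
  then have "p \<noteq> []" "distinct p" "set p = X" using 0 by (auto simp: path_cover_def)
  then have "{hd p} \<subseteq> X" by auto
  then have "\<exists>S\<subseteq>X. separated d \<rho> S \<and> Suc 0 \<le> card S" for \<rho>
    by (intro exI[of _ "{hd p}"]) (auto simp: separated_def)
  then show ?case
    by (intro exI[of _ p] exI[of _ "[]"]) (use p \<open>distinct p\<close> \<open>set p = X\<close> in auto)
next
  case (Suc n)
  have dist: "distinct pss" by (rule distinct_path_cover[OF Suc.prems(1)])
  define Q where "Q = {(A, B). A \<in> set pss \<and> B \<in> set pss \<and> A \<noteq> B}"
  have finQ: "finite Q" by (rule finite_subset[of _ "set pss \<times> set pss"]) (auto simp: Q_def)
  have neQ: "Q \<noteq> {}"
  proof -
    obtain A B rest where "pss = A # B # rest" using Suc.prems(2) by (metis length_Suc_conv)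
    then have "(A, B) \<in> Q" using dist by (auto simp: Q_def)
    then show ?thesis by auto
  qed
  define w where "w = (\<lambda>(A, B). d (last A) (last B))"
  obtain A B where AB: "(A, B) \<in> Q" "\<And>A' B'. (A', B') \<in> Q \<Longrightarrow> w (A, B) \<le> w (A', B')"
    using arg_min_if_finite[OF finQ neQ, of w] by (metis not_le surj_pair)
  define f where "f = d (last A) (last B)"
  have A: "A \<in> set pss" and B: "B \<in> set pss" and nAB: "A \<noteq> B" using AB(1) by (auto simp: Q_def)
  have fmin: "f \<le> d (last A') (last B')" if "A' \<in> set pss" "B' \<in> set pss" "A' \<noteq> B'" for A' B'
    using AB(2)[of A' B'] that by (auto simp: Q_def w_def f_def)
  define rs where "rs = remove1 B (remove1 A pss)"
  have ms: "mset pss = mset (A # B # rs)"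
    unfolding rs_def by (rule mset_remove1_remove1[OF A B nAB])
  have cov: "path_cover X (A # B # rs)" by (rule path_cover_perm[OF ms Suc.prems(1)])
  then have cov': "path_cover X ((A @ rev B) # rs)" and ne: "A \<noteq> []" "B \<noteq> []"
    by (auto simp: path_cover_def)
  have len: "length ((A @ rev B) # rs) = Suc n"
  proof -
    have "length pss = length (A # B # rs)" using ms by (metis size_mset)
    then show ?thesis using Suc.prems(2) by simp
  qed
  obtain xs fs where xs: "distinct xs" "set xs = X" "length fs = n"
    "\<And>c. esum (\<lambda>x y. c (d x y)) xs = (\<Sum>p\<leftarrow>(A @ rev B) # rs. esum (\<lambda>x y. c (d x y)) p) + (\<Sum>f\<leftarrow>fs. c f)"
    "\<And>\<rho>. \<exists>S\<subseteq>X. separated d \<rho> S \<and> Suc (length (filter (\<lambda>f. f \<ge> \<rho>) fs)) \<le> card S"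
    using Suc.IH[OF cov' len] by blast
  have sums: "esum (\<lambda>x y. c (d x y)) xs = (\<Sum>p\<leftarrow>pss. esum (\<lambda>x y. c (d x y)) p) + (\<Sum>f\<leftarrow>f # fs. c f)" for c
  proof -
    let ?c = "\<lambda>x y. c (d x y)"
    have "esum ?c (A @ rev B) = esum ?c A + c f + esum ?c B"
      using esum_append[of A "rev B" ?c] ne esum_rev[of ?c B] d_sym by (simp add: f_def hd_rev)
    moreover have "(\<Sum>p\<leftarrow>pss. esum ?c p) = (\<Sum>p\<leftarrow>A # B # rs. esum ?c p)"
      unfolding sum_mset_sum_list[symmetric] mset_map ms ..
    ultimately show ?thesis using xs(4)[of c] by simp
  qed
  have sep: "\<exists>S\<subseteq>X. separated d \<rho> S \<and> Suc (length (filter (\<lambda>f. f \<ge> \<rho>) (f # fs))) \<le> card S" for \<rho>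
  proof (cases "\<rho> \<le> f")
    case False
    then show ?thesis using xs(5)[of \<rho>] by simp
  next
    case True
    have inj: "inj_on last (set pss)"
    proof (rule inj_onI, rule ccontr)
      fix p q assume pq: "p \<in> set pss" "q \<in> set pss" "last p = last q" "p \<noteq> q"
      have "last p \<in> set p" "last q \<in> set q" using path_cover_last_in(1)[OF Suc.prems(1)] pq(1,2) by auto
      moreover have "set p \<inter> set q = {}"
        using pq Suc.prems(1) unfolding path_cover_def distinct_concat_iff by blast
      ultimately show False using pq(3) by auto
    qed
    have "last ` set pss \<subseteq> X" using path_cover_last_in(2)[OF Suc.prems(1)] by auto
    moreover have "separated d \<rho> (last ` set pss)"
      unfolding separated_def using fmin True by (auto intro: order_trans)
    moreover have "card (last ` set pss) = Suc (Suc n)"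
      using inj dist Suc.prems(2) by (simp add: card_image distinct_card)
    moreover have "length (filter (\<lambda>f. f \<ge> \<rho>) (f # fs)) \<le> Suc n"
      using length_filter_le[of "\<lambda>f. f \<ge> \<rho>" "f # fs"] xs(3) by simp
    ultimately show ?thesis by (intro exI[of _ "last ` set pss"]) simp
  qed
  show ?case
    by (intro exI[of _ xs] exI[of _ "f # fs"]) (use xs(1-3) sums sep in auto)
qed

section \<open>Packing bounds in the cube\<close>

text \<open>Centred at \<open>c\<close>, the double sum is 2 N times the sum of squares minus twice
  the square of the sum; the latter is dropped.\<close>

lemma sum_square_diff_le:
  fixes f :: "'b \<Rightarrow> real"
  assumes "finite F" "\<And>x. x \<in> F \<Longrightarrow> \<bar>f x - c\<bar> \<le> w / 2"
  shows "(\<Sum>x\<in>F. \<Sum>y\<in>F. (f x - f y)\<^sup>2) \<le> (real (card F))\<^sup>2 * (w\<^sup>2 / 2)"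
proof -
  define a where "a = (\<lambda>x. f x - c)"
  let ?N = "real (card F)"
  have "(\<Sum>x\<in>F. \<Sum>y\<in>F. (f x - f y)\<^sup>2) = (\<Sum>x\<in>F. \<Sum>y\<in>F. (a x)\<^sup>2 + (a y)\<^sup>2 - 2 * (a x * a y))"
    by (intro sum.cong refl) (simp add: a_def power2_eq_square algebra_simps)
  also have "\<dots> = (\<Sum>x\<in>F. \<Sum>y\<in>F. (a x)\<^sup>2) + (\<Sum>x\<in>F. \<Sum>y\<in>F. (a y)\<^sup>2) - 2 * (\<Sum>x\<in>F. \<Sum>y\<in>F. a x * a y)"
    by (simp only: sum.distrib sum_subtractf sum_distrib_left[of "2::real"])
  also have "\<dots> = 2 * ?N * (\<Sum>x\<in>F. (a x)\<^sup>2) - 2 * (\<Sum>x\<in>F. a x)\<^sup>2"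
    by (simp add: power2_eq_square[of "sum a F"] sum_product sum_distrib_left[symmetric])
  also have "\<dots> \<le> 2 * ?N * (\<Sum>x\<in>F. (a x)\<^sup>2)" by simp
  also have "\<dots> \<le> 2 * ?N * (\<Sum>x\<in>F. (w / 2)\<^sup>2)"
  proof (intro mult_left_mono sum_mono)
    fix x assume "x \<in> F"
    then have "\<bar>a x\<bar>\<^sup>2 \<le> (w / 2)\<^sup>2" using assms(2) by (intro power_mono) (auto simp: a_def)
    then show "(a x)\<^sup>2 \<le> (w / 2)\<^sup>2" by simp
  qed simp
  also have "\<dots> = ?N\<^sup>2 * (w\<^sup>2 / 2)" by (simp add: power2_eq_square)
  finally show ?thesis .
qed

text \<open>Compare the sum of squared distances over ordered pairs: at least N (N - 1)
  \<open>\<rho>\<^sup>2\<close> by separation, at most N^2 (1 - g) \<open>\<rho>\<^sup>2\<close>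
  coordinate by coordinate.\<close>

lemma plotkin:
  assumes F: "finite F" "separated (euclid_dist k) \<rho> F" and \<rho>: "\<rho> > 0"
    and box: "\<And>x i. x \<in> F \<Longrightarrow> i < k \<Longrightarrow> \<bar>x i - c i\<bar> \<le> w i / 2"
    and g: "(\<Sum>i<k. (w i)\<^sup>2 / 2) \<le> (1 - g) * \<rho>\<^sup>2"
  shows "g * real (card F) \<le> 1"
proof (cases "F = {}")
  case False
  let ?N = "real (card F)"
  have N: "?N > 0" using False F(1) by (simp add: card_gt_0_iff)
  have sq: "(euclid_dist k x y)\<^sup>2 = (\<Sum>i<k. (x i - y i)\<^sup>2)" for x y
    by (simp add: euclid_dist_def L2_set_def sum_nonneg)
  have "?N * (?N - 1) * \<rho>\<^sup>2 = (\<Sum>x\<in>F. \<Sum>y\<in>F - {x}. \<rho>\<^sup>2)"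
    using F(1) N by (simp add: card_Diff_singleton of_nat_diff card_gt_0_iff Suc_leI)
  also have "\<dots> \<le> (\<Sum>x\<in>F. \<Sum>y\<in>F - {x}. (euclid_dist k x y)\<^sup>2)"
    using F(2) \<rho> by (intro sum_mono power_mono) (auto simp: separated_def)
  also have "\<dots> \<le> (\<Sum>x\<in>F. \<Sum>y\<in>F. (euclid_dist k x y)\<^sup>2)"
    using F(1) by (intro sum_mono sum_mono2) auto
  also have "\<dots> = (\<Sum>x\<in>F. \<Sum>i<k. \<Sum>y\<in>F. (x i - y i)\<^sup>2)"
    unfolding sq by (intro sum.cong refl sum.swap)
  also have "\<dots> = (\<Sum>i<k. \<Sum>x\<in>F. \<Sum>y\<in>F. (x i - y i)\<^sup>2)"
    by (rule sum.swap)
  also have "\<dots> \<le> (\<Sum>i<k. ?N\<^sup>2 * ((w i)\<^sup>2 / 2))"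
  proof (rule sum_mono)
    fix i assume "i \<in> {..<k}"
    then show "(\<Sum>x\<in>F. \<Sum>y\<in>F. (x i - y i)\<^sup>2) \<le> ?N\<^sup>2 * ((w i)\<^sup>2 / 2)"
      using sum_square_diff_le[OF F(1), of "\<lambda>x. x i" "c i" "w i"] box by simp
  qed
  also have "\<dots> = ?N\<^sup>2 * (\<Sum>i<k. (w i)\<^sup>2 / 2)" by (rule sum_distrib_left[symmetric])
  also have "\<dots> \<le> ?N\<^sup>2 * ((1 - g) * \<rho>\<^sup>2)" by (rule mult_left_mono[OF g]) simp
  finally have "(?N * \<rho>\<^sup>2) * (?N - 1) \<le> (?N * \<rho>\<^sup>2) * (?N * (1 - g))"
    by (simp add: power2_eq_square mult_ac)
  then have "?N - 1 \<le> ?N * (1 - g)" using N \<rho> by (subst (asm) mult_le_cancel_left_pos) auto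
  then show ?thesis by (simp add: algebra_simps)
qed simp

lemma packing_bound:
  fixes s :: "nat \<Rightarrow> nat"
  assumes S: "finite S" "S \<subseteq> unit_cube k" "separated (euclid_dist k) \<rho> S" and \<rho>: "\<rho> > 0"
    and s: "\<And>i. i < k \<Longrightarrow> s i \<ge> 1" and g: "(\<Sum>i<k. 1 / (2 * (real (s i))\<^sup>2)) \<le> (1 - g) * \<rho>\<^sup>2" "g > 0"
  shows "g * real (card S) \<le> (\<Prod>i<k. real (s i))"
proof -
  \<comment> \<open>The minimum puts the face \<open>x i = 1\<close> into the last part.\<close>
  define cell where "cell = (\<lambda>x. \<lambda>i\<in>{..<k}. min (nat \<lfloor>real (s i) * x i\<rfloor>) (s i - 1))"
  have im: "cell ` S \<subseteq> (\<Pi>\<^sub>E i\<in>{..<k}. {..<s i})"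
  proof
    fix c assume "c \<in> cell ` S"
    then obtain x where "c = cell x" by blast
    moreover have "min n (s i - 1) < s i" if "i < k" for n i using s[OF that] by simp
    ultimately show "c \<in> (\<Pi>\<^sub>E i\<in>{..<k}. {..<s i})" unfolding cell_def by simp
  qed
  have fin: "finite (\<Pi>\<^sub>E i\<in>{..<k}. {..<s i})" by (rule finite_PiE) auto
  have fibre: "g * real (card {x \<in> S. cell x = c}) \<le> 1" for c
  proof (rule plotkin[where k = k and \<rho> = \<rho> and c = "\<lambda>i. (real (c i) + 1 / 2) / s i" and w = "\<lambda>i. 1 / s i"])
    show "separated (euclid_dist k) \<rho> {x \<in> S. cell x = c}" using S(3) by (auto simp: separated_def)
    show "(\<Sum>i<k. (1 / real (s i))\<^sup>2 / 2) \<le> (1 - g) * \<rho>\<^sup>2"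
      using g(1) by (simp add: power_divide mult.commute)
    fix x i assume x: "x \<in> {x \<in> S. cell x = c}" and i: "i < k"
    then have xi: "0 \<le> x i" "x i \<le> 1" using S(2) by (auto simp: unit_cube_def PiE_iff)
    have si: "real (s i) \<ge> 1" using s[OF i] by simp
    have ci: "c i = min (nat \<lfloor>real (s i) * x i\<rfloor>) (s i - 1)" using x i by (auto simp: cell_def)
    have "real (c i) \<le> s i * x i \<and> s i * x i \<le> real (c i) + 1"
    proof (cases "nat \<lfloor>real (s i) * x i\<rfloor> \<le> s i - 1")
      case True
      then have "c i = nat \<lfloor>real (s i) * x i\<rfloor>" using ci by simp
      then have "real (c i) = of_int \<lfloor>real (s i) * x i\<rfloor>" using xi by simp
      then show ?thesis by linarith
    next
      case False
      then have "c i = s i - 1" using ci by simp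
      then have c: "real (c i) + 1 = s i" using s[OF i] by simp
      have "s i \<le> nat \<lfloor>real (s i) * x i\<rfloor>" using False by simp
      then have "real (s i) \<le> s i * x i" using xi by (simp add: le_nat_iff le_floor_iff)
      moreover have "s i * x i \<le> s i" using xi si by (simp add: mult_left_le)
      ultimately show ?thesis using c by linarith
    qed
    then have "\<bar>s i * x i - (real (c i) + 1 / 2)\<bar> \<le> 1 / 2" by linarith
    then have "\<bar>s i * x i - (real (c i) + 1 / 2)\<bar> / s i \<le> 1 / 2 / s i" using si by (intro divide_right_mono) auto
    moreover have "\<bar>s i * x i - (real (c i) + 1 / 2)\<bar> / s i = \<bar>(s i * x i - (real (c i) + 1 / 2)) / s i\<bar>" by simp
    moreover have "(s i * x i - (real (c i) + 1 / 2)) / s i = x i - (real (c i) + 1 / 2) / s i"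
      using si by (simp add: diff_divide_distrib)
    ultimately show "\<bar>x i - (real (c i) + 1 / 2) / s i\<bar> \<le> 1 / real (s i) / 2" by simp
  qed (use S(1) \<rho> in auto)
  have "real (card S) = (\<Sum>c\<in>cell ` S. real (card {x \<in> S. cell x = c}))"
    using sum.image_gen[OF S(1), of "\<lambda>_. 1 :: real" cell] by simp
  then have "g * real (card S) = (\<Sum>c\<in>cell ` S. g * real (card {x \<in> S. cell x = c}))"
    by (simp add: sum_distrib_left)
  also have "\<dots> \<le> (\<Sum>c\<in>cell ` S. 1)" by (intro sum_mono fibre)
  also have "\<dots> \<le> real (card (\<Pi>\<^sub>E i\<in>{..<k}. {..<s i}))" using card_mono[OF fin im] by simp
  also have "\<dots> = (\<Prod>i<k. real (s i))" by (simp add: card_PiE)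
  finally show ?thesis .
qed

text \<open>In each coordinate the three squared differences of numbers in [0,1] sum to at most 2,
  so some squared distance is at most 2 k / 3; and 0.86^2 > 2/3.\<close>

lemma three_points:
  assumes S: "finite S" "S \<subseteq> unit_cube k" "separated (euclid_dist k) \<rho> S" and \<rho>: "\<rho> \<ge> 0" "2 * real k < 3 * \<rho>\<^sup>2"
  shows "card S \<le> 2"
proof (rule ccontr)
  assume "\<not> card S \<le> 2"
  then have "3 \<le> card S" by simp
  then obtain T where T: "T \<subseteq> S" "card T = 3" by (metis obtain_subset_with_card_n)
  then obtain x y z where xyz: "T = {x, y, z}" "x \<noteq> y" "y \<noteq> z" "x \<noteq> z" by (auto simp: card_3_iff)
  have sq: "(euclid_dist k x y)\<^sup>2 = (\<Sum>i<k. (x i - y i)\<^sup>2)" for x y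
    by (simp add: euclid_dist_def L2_set_def sum_nonneg)
  have one: "(a - b)\<^sup>2 + (b - c)\<^sup>2 + (a - c)\<^sup>2 \<le> 2" if "0 \<le> a" "a \<le> 1" "0 \<le> b" "b \<le> 1" "0 \<le> c" "c \<le> 1" for a b c :: real
  proof -
    \<comment> \<open>For ordered numbers the squares of the two inner differences sum to at most
      the square of the outer one.\<close>
    have *: "(a - b)\<^sup>2 + (b - c)\<^sup>2 + (a - c)\<^sup>2 \<le> 2" if "0 \<le> a" "a \<le> b" "b \<le> c" "c \<le> 1" for a b c :: real
    proof -
      have "(c - a)\<^sup>2 = (b - a)\<^sup>2 + (c - b)\<^sup>2 + 2 * ((b - a) * (c - b))"
        by (simp add: power2_eq_square algebra_simps)
      moreover have "(b - a) * (c - b) \<ge> 0" using that by simp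
      moreover have "(c - a)\<^sup>2 \<le> 1" using that by (simp add: power_le_one)
      ultimately show ?thesis by (simp add: power2_commute[of a] power2_commute[of b c])
    qed
    show ?thesis
      using *[of a b c] *[of a c b] *[of b a c] *[of b c a] *[of c a b] *[of c b a] that
        power2_commute[of a b] power2_commute[of b c] power2_commute[of a c]
      by linarith
  qed
  have in01: "0 \<le> v i" "v i \<le> 1" if "v \<in> T" "i < k" for v i
    using that T(1) S(2) by (auto simp: unit_cube_def PiE_iff)
  have "3 * \<rho>\<^sup>2 \<le> (euclid_dist k x y)\<^sup>2 + (euclid_dist k y z)\<^sup>2 + (euclid_dist k x z)\<^sup>2"
  proof -
    have "\<rho>\<^sup>2 \<le> (euclid_dist k u v)\<^sup>2" if "u \<in> T" "v \<in> T" "u \<noteq> v" for u v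
      using that T(1) S(3) \<rho>(1) by (intro power_mono) (auto simp: separated_def)
    from this[of x y] this[of y z] this[of x z] show ?thesis using xyz by auto
  qed
  also have "\<dots> = (\<Sum>i<k. (x i - y i)\<^sup>2 + (y i - z i)\<^sup>2 + (x i - z i)\<^sup>2)"
    by (simp add: sq sum.distrib)
  also have "\<dots> \<le> (\<Sum>i<k. 2)" by (intro sum_mono one in01) (auto simp: xyz)
  finally show False using \<rho>(2) by simp
qed


section \<open>Counting long joining edges\<close>

text \<open>Subdivisions of period 4 imitate a fractional number of parts per coordinate. With the
  same number everywhere, two parts are useful only below 0.5 sqrt k and one part only above 0.71
  sqrt k, which leaves a hole.\<close>

lemma sum_mod_4_le:
  fixes f :: "nat \<Rightarrow> real"
  assumes "\<And>i. f i \<ge> 0"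
  shows "(\<Sum>i<k. f (i mod 4)) \<le> (real k / 4 + 1) * (f 0 + f 1 + f 2 + f 3)"
proof -
  have eq: "(\<Sum>i<4 * n. f (i mod 4)) = real n * (f 0 + f 1 + f 2 + f 3)" for n
  proof (induction n)
    case (Suc n)
    have "4 * Suc n = Suc (Suc (Suc (Suc (4 * n))))" by simp
    moreover have "Suc (4 * n) mod 4 = 1" "Suc (Suc (4 * n)) mod 4 = 2" "Suc (Suc (Suc (4 * n))) mod 4 = 3"
      by presburger+
    ultimately show ?case using Suc by (simp only: sum.lessThan_Suc) (simp add: algebra_simps)
  qed simp
  have "(\<Sum>i<k. f (i mod 4)) \<le> (\<Sum>i<4 * (k div 4 + 1). f (i mod 4))"
    by (intro sum_mono2) (use assms in auto)
  also have "\<dots> \<le> (real k / 4 + 1) * (f 0 + f 1 + f 2 + f 3)"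
  proof -
    have "4 * (k div 4) \<le> k" by simp
    then have "4 * real (k div 4) \<le> real k" by linarith
    then show ?thesis unfolding eq using assms by (intro mult_right_mono) auto
  qed
  finally show ?thesis .
qed

lemma prod_mod_4_le:
  fixes f :: "nat \<Rightarrow> real"
  assumes "\<And>i. f i \<ge> 1"
  shows "(\<Prod>i<k. f (i mod 4)) \<le> (f 0 * f 1 * f 2 * f 3) ^ (k div 4 + 1)"
proof -
  have eq: "(\<Prod>i<4 * n. f (i mod 4)) = (f 0 * f 1 * f 2 * f 3) ^ n" for n
  proof (induction n)
    case (Suc n)
    have "4 * Suc n = Suc (Suc (Suc (Suc (4 * n))))" by simp
    moreover have "Suc (4 * n) mod 4 = 1" "Suc (Suc (4 * n)) mod 4 = 2" "Suc (Suc (Suc (4 * n))) mod 4 = 3"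
      by presburger+
    ultimately show ?case using Suc by (simp only: prod.lessThan_Suc) (simp add: algebra_simps)
  qed simp
  have f0: "f i \<ge> 0" for i using assms[of i] by simp
  have "(\<Prod>i<k. f (i mod 4)) * 1 \<le> (\<Prod>i<k. f (i mod 4)) * (\<Prod>i\<in>{k..<4 * (k div 4 + 1)}. f (i mod 4))"
    by (intro mult_left_mono prod_ge_1 prod_nonneg) (use assms f0 in auto)
  also have "\<dots> = (\<Prod>i<4 * (k div 4 + 1). f (i mod 4))"
  proof -
    have "{..<4 * (k div 4 + 1)} = {..<k} \<union> {k..<4 * (k div 4 + 1)}" by auto
    then show ?thesis by (simp add: prod.union_disjoint[symmetric] ivl_disj_int)
  qed
  finally show ?thesis unfolding eq by simp
qed

text \<open>\<open>k \<ge> 100\<close> lets k / 100 absorb the incomplete period, and the Plotkin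
  slack 1 / 100 becomes the factor 100.\<close>

lemma window_card:
  fixes ss :: "nat \<Rightarrow> nat"
  defines "\<sigma> \<equiv> 1 / (2 * (real (ss 0))\<^sup>2) + 1 / (2 * (real (ss 1))\<^sup>2) + 1 / (2 * (real (ss 2))\<^sup>2) + 1 / (2 * (real (ss 3))\<^sup>2)"
  assumes S: "finite S" "S \<subseteq> unit_cube k" "separated (euclid_dist k) (lo * sqrt k) S"
    and k: "k \<ge> 100" and lo: "lo > 0" and ss: "\<And>i. ss i \<ge> 1" and \<sigma>: "(1 / 4 + 1 / 100) * \<sigma> \<le> 99 / 100 * lo\<^sup>2"
  shows "real (card S) \<le> 100 * (real (ss 0 * ss 1 * ss 2 * ss 3)) ^ (k div 4 + 1)"
proof -
  have "1 / 100 * real (card S) \<le> (\<Prod>i<k. real (ss (i mod 4)))"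
  proof (rule packing_bound[OF S])
    have "\<sigma> \<ge> 0" by (simp add: \<sigma>_def)
    have "(\<Sum>i<k. 1 / (2 * (real (ss (i mod 4)))\<^sup>2)) \<le> (real k / 4 + 1) * \<sigma>"
      unfolding \<sigma>_def by (rule sum_mod_4_le[of "\<lambda>i. 1 / (2 * (real (ss i))\<^sup>2)"]) simp
    also have "\<dots> \<le> (real k * (1 / 4 + 1 / 100)) * \<sigma>"
      using k \<open>\<sigma> \<ge> 0\<close> by (intro mult_right_mono) auto
    also have "\<dots> = real k * ((1 / 4 + 1 / 100) * \<sigma>)" by (rule mult.assoc)
    also have "\<dots> \<le> real k * (99 / 100 * lo\<^sup>2)" by (rule mult_left_mono[OF \<sigma>]) simp
    also have "\<dots> = (1 - 1 / 100) * (lo * sqrt k)\<^sup>2" by (simp add: power_mult_distrib)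
    finally show "(\<Sum>i<k. 1 / (2 * (real (ss (i mod 4)))\<^sup>2)) \<le> (1 - 1 / 100) * (lo * sqrt k)\<^sup>2" .
  qed (use k lo ss in auto)
  also have "\<dots> \<le> (real (ss 0) * real (ss 1) * real (ss 2) * real (ss 3)) ^ (k div 4 + 1)"
    by (rule prod_mod_4_le[of "\<lambda>i. real (ss i)"]) (use ss in simp)
  finally show ?thesis by simp
qed

section \<open>Joining edges by length\<close>

definition window_sum :: "nat \<Rightarrow> real list \<Rightarrow> real \<Rightarrow> real \<Rightarrow> real" where
  "window_sum k fs a b = (\<Sum>f\<leftarrow>filter (\<lambda>f. a \<le> f \<and> f < b) fs. f ^ k)"

lemma window_sum_split: "a \<le> b \<Longrightarrow> b \<le> c \<Longrightarrow> window_sum k fs a c = window_sum k fs a b + window_sum k fs b c"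
  unfolding window_sum_def by (induction fs) auto

lemma window_sum_le:
  assumes "0 \<le> a" "0 \<le> b"
  shows "window_sum k fs a b \<le> real (length (filter (\<lambda>f. f \<ge> a) fs)) * b ^ k"
  unfolding window_sum_def
proof (induction fs)
  case (Cons f fs)
  have "f ^ k \<le> b ^ k" if "a \<le> f" "f < b" using that assms by (intro power_mono) auto
  moreover have "b ^ k \<ge> 0" using assms by simp
  ultimately show ?case using Cons assms by (auto simp: algebra_simps intro: add_increasing)
qed simp

text \<open>The number of joins of length at least \<open>lo * sqrt k\<close> is taken with the
  longest length in the window. Per period of four coordinates this gives a factor of at most
  97/100; the one period rounded up costs at most 36, so 3600 = 100 * 36.\<close>

lemma window_bound:
  fixes ss :: "nat \<Rightarrow> nat"
  defines "\<sigma> \<equiv> 1 / (2 * (real (ss 0))\<^sup>2) + 1 / (2 * (real (ss 1))\<^sup>2) + 1 / (2 * (real (ss 2))\<^sup>2) + 1 / (2 * (real (ss 3))\<^sup>2)"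
  assumes sep: "\<And>\<rho>. \<exists>S\<subseteq>X. separated (euclid_dist k) \<rho> S \<and> Suc (length (filter (\<lambda>f. f \<ge> \<rho>) fs)) \<le> card S"
    and X: "finite X" "X \<subseteq> unit_cube k"
    and k: "k \<ge> 100" and lo: "lo > 0" and ss: "\<And>i. ss i \<ge> 1" and \<sigma>: "(1 / 4 + 1 / 100) * \<sigma> \<le> 99 / 100 * lo\<^sup>2"
    and hi: "0 \<le> hi" "hi \<le> 1" and G: "real (ss 0 * ss 1 * ss 2 * ss 3) \<le> 36"
      "real (ss 0 * ss 1 * ss 2 * ss 3) * hi ^ 4 \<le> 97 / 100"
  shows "window_sum k fs (lo * sqrt k) (hi * sqrt k) \<le> 3600 * (97 / 100) ^ (k div 4) * sqrt k ^ k"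
proof -
  let ?G = "real (ss 0 * ss 1 * ss 2 * ss 3)"
  obtain S where S: "S \<subseteq> X" "separated (euclid_dist k) (lo * sqrt k) S" "Suc (length (filter (\<lambda>f. f \<ge> lo * sqrt k) fs)) \<le> card S"
    using sep by blast
  have "real (card S) \<le> 100 * ?G ^ (k div 4 + 1)"
    by (rule window_card) (use S X k lo ss \<sigma> finite_subset in \<open>auto simp: \<sigma>_def\<close>)
  then have n: "real (length (filter (\<lambda>f. f \<ge> lo * sqrt k) fs)) \<le> 100 * ?G ^ (k div 4 + 1)" using S(3) by linarith
  have "window_sum k fs (lo * sqrt k) (hi * sqrt k) \<le> real (length (filter (\<lambda>f. f \<ge> lo * sqrt k) fs)) * (hi * sqrt k) ^ k"
    by (rule window_sum_le) (use lo hi in auto)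
  also have "\<dots> \<le> (100 * ?G ^ (k div 4 + 1)) * (hi * sqrt k) ^ k"
    by (rule mult_right_mono[OF n]) (use hi in simp)
  also have "\<dots> = 100 * ?G * (?G ^ (k div 4) * hi ^ k) * sqrt k ^ k"
    by (simp only: power_mult_distrib power_add power_one_right mult_ac)
  also have "\<dots> \<le> 100 * 36 * (97 / 100) ^ (k div 4) * sqrt k ^ k"
  proof (intro mult_right_mono mult_mono)
    have "hi ^ k \<le> hi ^ (4 * (k div 4))" using hi by (intro power_decreasing) auto
    then have "?G ^ (k div 4) * hi ^ k \<le> ?G ^ (k div 4) * hi ^ (4 * (k div 4))" by (intro mult_left_mono) auto
    also have "\<dots> = (?G * hi ^ 4) ^ (k div 4)" by (simp add: power_mult power_mult_distrib)
    also have "\<dots> \<le> (97 / 100) ^ (k div 4)" using hi by (intro power_mono G(2)) auto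
    finally show "?G ^ (k div 4) * hi ^ k \<le> (97 / 100) ^ (k div 4)" .
  qed (use G(1) hi in auto)
  finally show ?thesis by simp
qed

lemma esum_eq_0:
  assumes "\<And>x y. (x, y) \<in> set (zip xs (tl xs)) \<Longrightarrow> c x y = 0"
  shows "esum c xs = 0"
  using assms by (induction xs rule: induct_list012) auto

lemma joined_small_cover:
  assumes k: "k \<ge> 2" and X: "X \<subseteq> unit_cube k" "finite X" "X \<noteq> {}"
  obtains xs fs where "distinct xs" "set xs = X"
    "esum (\<lambda>x y. euclid_dist k x y ^ k) xs \<le> small_bound k + (\<Sum>f\<leftarrow>fs. f ^ k)"
    "length fs * (31 / 100 * sqrt k) ^ k \<le> small_bound k"
    "\<And>f M. f \<in> set fs \<Longrightarrow> (\<And>x y. (x, y) \<in> set (zip xs (tl xs)) \<Longrightarrow> euclid_dist k x y \<le> M) \<Longrightarrow> 0 \<le> f \<and> f \<le> M"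
    "\<And>\<rho>. \<exists>S\<subseteq>X. separated (euclid_dist k) \<rho> S \<and> Suc (length (filter (\<lambda>f. f \<ge> \<rho>) fs)) \<le> card S"
proof -
  let ?l = "(31 / 100 * sqrt k) ^ k"
  let ?pw = "\<lambda>x y. euclid_dist k x y ^ k"
  obtain pss where pss: "opt_cover ?pw ?l X pss" "cover_cost ?pw ?l pss \<le> small_bound k"
    using small_cover[OF assms] by blast
  have cov: "path_cover X pss" using pss(1) by (simp add: opt_cover_def)
  then have "pss \<noteq> []" using X(3) by (auto simp: path_cover_def)
  then obtain n where n: "length pss = Suc n" by (cases pss) auto
  obtain xs fs where xs: "distinct xs" "set xs = X" "length fs = n"
    "\<And>c. esum (\<lambda>x y. c (euclid_dist k x y)) xs = (\<Sum>p\<leftarrow>pss. esum (\<lambda>x y. c (euclid_dist k x y)) p) + (\<Sum>f\<leftarrow>fs. c f)"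
    "\<And>\<rho>. \<exists>S\<subseteq>X. separated (euclid_dist k) \<rho> S \<and> Suc (length (filter (\<lambda>f. f \<ge> \<rho>) fs)) \<le> card S"
    using euclid.join_pieces[OF cov n] by blast
  have cost: "(\<Sum>p\<leftarrow>pss. esum ?pw p) + ?l * Suc n \<le> small_bound k"
    using pss(2) unfolding cover_cost_split n .
  have e0: "(\<Sum>p\<leftarrow>pss. esum ?pw p) \<ge> 0"
    by (intro sum_list_nonneg) (auto intro!: esum_nonneg simp: euclid.d_nonneg)
  have l0: "?l \<ge> 0" by simp
  \<comment> \<open>The sum identity applied to the indicator of \<open>B\<close>: a property that
    no edge length of \<open>xs\<close> has is not shared by any join either. This places every join
    between 0 and the longest edge.\<close>
  have bad: "\<not> B f" if "f \<in> set fs" "\<And>x y. (x, y) \<in> set (zip xs (tl xs)) \<Longrightarrow> \<not> B (euclid_dist k x y)" for B f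
  proof -
    let ?c = "\<lambda>t. if B t then 1 else 0 :: real"
    have "esum (\<lambda>x y. ?c (euclid_dist k x y)) xs = 0" using that(2) by (intro esum_eq_0) auto
    moreover have "(\<Sum>p\<leftarrow>pss. esum (\<lambda>x y. ?c (euclid_dist k x y)) p) \<ge> 0"
      by (intro sum_list_nonneg) (auto intro!: esum_nonneg)
    ultimately have "(\<Sum>f\<leftarrow>fs. ?c f) \<le> 0" using xs(4)[of ?c] by linarith
    moreover have "?c f \<le> (\<Sum>f\<leftarrow>fs. ?c f)"
      by (rule member_le_sum_list) (use that(1) in auto)
    ultimately show ?thesis by (auto split: if_splits)
  qed
  show ?thesis
  proof
    show "esum ?pw xs \<le> small_bound k + (\<Sum>f\<leftarrow>fs. f ^ k)"
      using xs(4)[of "\<lambda>t. t ^ k"] cost mult_nonneg_nonneg[OF l0, of "real (Suc n)"] by linarith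
    have "?l * real n \<le> ?l * real (Suc n)" using l0 by (intro mult_left_mono) auto
    then show "length fs * ?l \<le> small_bound k" using cost e0 xs(3) by (simp add: mult.commute)
    show "0 \<le> f \<and> f \<le> M" if "f \<in> set fs" "\<And>x y. (x, y) \<in> set (zip xs (tl xs)) \<Longrightarrow> euclid_dist k x y \<le> M" for f M
      using bad[OF that(1), of "\<lambda>t. t < 0"] bad[OF that(1), of "\<lambda>t. M < t"] that(2) euclid.d_nonneg
      by (meson not_le)
  qed (use xs in auto)
qed

lemma window_sum_le_max:
  assumes "0 \<le> M" "\<And>f. f \<in> set fs \<Longrightarrow> 0 \<le> f \<and> f \<le> M"
  shows "window_sum k fs a b \<le> real (length (filter (\<lambda>f. f \<ge> a) fs)) * M ^ k"
  using assms(2) unfolding window_sum_def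
proof (induction fs)
  case (Cons f fs)
  have "f ^ k \<le> M ^ k" using Cons.prems[of f] by (intro power_mono) auto
  moreover have "M ^ k \<ge> 0" using assms(1) by simp
  ultimately show ?case using Cons by (auto simp: algebra_simps intro: add_increasing add_mono)
qed simp

text \<open>\<open>small_bound\<close> counts once for the edges of the cover and once for the joins
  below 0.31 sqrt k; 21600 = 6 * 3600 stands for the six windows up to 0.86 sqrt k.\<close>

definition remainder_bound :: "nat \<Rightarrow> real" where
  "remainder_bound k = 2 * small_bound k + 21600 * ((97 / 100) ^ (k div 4) * sqrt k ^ k)"

text \<open>The path is fixed before \<open>M\<close>. Taking the longest edge for \<open>M\<close>
  bounds the rest of the path by \<open>E\<close>; taking sqrt k bounds the whole path.\<close>

definition path_remainder_le :: "nat \<Rightarrow> real \<Rightarrow> bool" where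
  "path_remainder_le k E \<longleftrightarrow> (\<forall>X. X \<subseteq> unit_cube k \<and> finite X \<and> X \<noteq> {} \<longrightarrow>
     (\<exists>xs. distinct xs \<and> set xs = X \<and>
       (\<forall>M\<ge>0. (\<forall>(x, y)\<in>set (zip xs (tl xs)). euclid_dist k x y \<le> M) \<longrightarrow>
          esum (\<lambda>x y. euclid_dist k x y ^ k) xs \<le> E + M ^ k)))"

lemma path_remainder_large:
  assumes k: "k \<ge> 100"
  shows "path_remainder_le k (remainder_bound k)"
  unfolding path_remainder_le_def
proof (intro allI impI)
  fix X assume X: "X \<subseteq> unit_cube k \<and> finite X \<and> X \<noteq> {}"
  have k2: "k \<ge> 2" using k by simp
  let ?s = "sqrt (real k)"
  let ?T = "3600 * (97 / 100) ^ (k div 4) * ?s ^ k"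
  obtain xs fs where xs: "distinct xs" "set xs = X"
    "esum (\<lambda>x y. euclid_dist k x y ^ k) xs \<le> small_bound k + (\<Sum>f\<leftarrow>fs. f ^ k)"
    "length fs * (31 / 100 * ?s) ^ k \<le> small_bound k"
    "\<And>f M. f \<in> set fs \<Longrightarrow> (\<And>x y. (x, y) \<in> set (zip xs (tl xs)) \<Longrightarrow> euclid_dist k x y \<le> M) \<Longrightarrow> 0 \<le> f \<and> f \<le> M"
    and sep: "\<And>\<rho>. \<exists>S\<subseteq>X. separated (euclid_dist k) \<rho> S \<and> Suc (length (filter (\<lambda>f. f \<ge> \<rho>) fs)) \<le> card S"
    using joined_small_cover[OF k2, of X] X by blast
  have "esum (\<lambda>x y. euclid_dist k x y ^ k) xs \<le> remainder_bound k + M ^ k"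
    if M: "M \<ge> 0" "\<forall>(x, y)\<in>set (zip xs (tl xs)). euclid_dist k x y \<le> M" for M
  proof -
    have f: "0 \<le> f \<and> f \<le> M" if "f \<in> set fs" for f using xs(5)[OF that, of M] M(2) by auto
    \<comment> \<open>Windows are half open, so \<open>B\<close> must exceed every join strictly;
      the maximum also keeps it above the last breakpoint.\<close>
    define B where "B = max (M + 1) ?s"
    have all: "window_sum k fs 0 B = (\<Sum>f\<leftarrow>fs. f ^ k)"
    proof -
      have "filter (\<lambda>f. 0 \<le> f \<and> f < B) fs = fs" using f by (force simp: B_def filter_id_conv)
      then show ?thesis by (simp add: window_sum_def)
    qed
    have bot: "window_sum k fs 0 (31 / 100 * ?s) \<le> small_bound k"
    proof -
      have "window_sum k fs 0 (31 / 100 * ?s) \<le> real (length (filter (\<lambda>f. f \<ge> 0) fs)) * (31 / 100 * ?s) ^ k"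
        by (rule window_sum_le) auto
      also have "\<dots> \<le> real (length fs) * (31 / 100 * ?s) ^ k"
        by (intro mult_right_mono) auto
      finally show ?thesis using xs(4) by linarith
    qed
    note wb = window_bound[OF sep conjunct1[OF conjunct2[OF X]] conjunct1[OF X] k]
    (* ss i is the number of parts into which the coordinates congruent to i mod 4 are divided: enough
       for the Plotkin bound at the lower end of the window, few enough that (number of boxes) * hi^k
       decays exponentially at its upper end. *)
    have w1: "window_sum k fs (31/100 * ?s) (40/100 * ?s) \<le> ?T"
      by (rule wb[where ss = "\<lambda>i. if i = 0 \<or> i = 1 then 2 else 3"]) (auto simp: power2_eq_square power4_eq_xxxx)
    have w2: "window_sum k fs (40/100 * ?s) (49/100 * ?s) \<le> ?T"
      by (rule wb[where ss = "\<lambda>i. 2"]) (auto simp: power2_eq_square power4_eq_xxxx)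
    have w3: "window_sum k fs (49/100 * ?s) (59/100 * ?s) \<le> ?T"
      by (rule wb[where ss = "\<lambda>i. if i = 0 then 1 else 2"]) (auto simp: power2_eq_square power4_eq_xxxx)
    have w4: "window_sum k fs (59/100 * ?s) (70/100 * ?s) \<le> ?T"
      by (rule wb[where ss = "\<lambda>i. if i = 0 \<or> i = 1 then 1 else 2"]) (auto simp: power2_eq_square power4_eq_xxxx)
    have w5: "window_sum k fs (70/100 * ?s) (83/100 * ?s) \<le> ?T"
      by (rule wb[where ss = "\<lambda>i. if i = 0 then 2 else 1"]) (auto simp: power2_eq_square power4_eq_xxxx)
    have w6: "window_sum k fs (83/100 * ?s) (86/100 * ?s) \<le> ?T"
      by (rule wb[where ss = "\<lambda>i. 1"]) (auto simp: power2_eq_square power4_eq_xxxx)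
    \<comment> \<open>One join more than allowed would yield three points too far apart, so at most
      one join is this long; it is bounded by \<open>M\<close> itself.\<close>
    have top: "window_sum k fs (86/100 * ?s) B \<le> M ^ k"
    proof -
      obtain S where S: "S \<subseteq> X" "separated (euclid_dist k) (86/100 * ?s) S"
        "Suc (length (filter (\<lambda>f. f \<ge> 86/100 * ?s) fs)) \<le> card S"
        using sep by blast
      have "card S \<le> 2"
        by (rule three_points[of S k "86/100 * ?s"])
          (use S X k finite_subset in \<open>auto simp: power_mult_distrib power2_eq_square\<close>)
      then have "length (filter (\<lambda>f. f \<ge> 86/100 * ?s) fs) \<le> 1" using S(3) by simp
      then have "real (length (filter (\<lambda>f. f \<ge> 86/100 * ?s) fs)) * M ^ k \<le> 1 * M ^ k"
        using M(1) by (intro mult_right_mono) auto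
      then show ?thesis using window_sum_le_max[where k = k and a = "86/100 * ?s" and b = B and fs = fs, OF M(1) f] by linarith
    qed
    have B: "86/100 * ?s \<le> B" by (simp add: B_def le_max_iff_disj)
    have le: "a * ?s \<le> b * ?s" if "a \<le> b" for a b using that by (intro mult_right_mono) auto
    have "window_sum k fs 0 B = window_sum k fs 0 (31/100 * ?s) + window_sum k fs (31/100 * ?s) B"
      "window_sum k fs (31/100 * ?s) B = window_sum k fs (31/100 * ?s) (40/100 * ?s) + window_sum k fs (40/100 * ?s) B"
      "window_sum k fs (40/100 * ?s) B = window_sum k fs (40/100 * ?s) (49/100 * ?s) + window_sum k fs (49/100 * ?s) B"
      "window_sum k fs (49/100 * ?s) B = window_sum k fs (49/100 * ?s) (59/100 * ?s) + window_sum k fs (59/100 * ?s) B"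
      "window_sum k fs (59/100 * ?s) B = window_sum k fs (59/100 * ?s) (70/100 * ?s) + window_sum k fs (70/100 * ?s) B"
      "window_sum k fs (70/100 * ?s) B = window_sum k fs (70/100 * ?s) (83/100 * ?s) + window_sum k fs (83/100 * ?s) B"
      "window_sum k fs (83/100 * ?s) B = window_sum k fs (83/100 * ?s) (86/100 * ?s) + window_sum k fs (86/100 * ?s) B"
      by (rule window_sum_split; (rule le; simp | rule order_trans[OF le B]; simp | simp))+
    then have "(\<Sum>f\<leftarrow>fs. f ^ k) \<le> small_bound k + 6 * ?T + M ^ k"
      using all bot w1 w2 w3 w4 w5 w6 top by linarith
    moreover have "6 * ?T = 21600 * ((97 / 100) ^ (k div 4) * ?s ^ k)" by simp
    ultimately show ?thesis using xs(3) unfolding remainder_bound_def by linarith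
  qed
  then show "\<exists>xs. distinct xs \<and> set xs = X \<and>
       (\<forall>M\<ge>0. (\<forall>(x, y)\<in>set (zip xs (tl xs)). euclid_dist k x y \<le> M) \<longrightarrow>
          esum (\<lambda>x y. euclid_dist k x y ^ k) xs \<le> remainder_bound k + M ^ k)"
    using xs(1,2) by blast
qed

lemma euclid_dist_le_sqrt:
  assumes "x \<in> unit_cube k" "y \<in> unit_cube k"
  shows "euclid_dist k x y \<le> sqrt k"
proof -
  have "(\<Sum>i<k. (x i - y i)\<^sup>2) \<le> (\<Sum>i<k. 1)"
  proof (rule sum_mono)
    fix i assume "i \<in> {..<k}"
    then have "x i \<in> {0..1}" "y i \<in> {0..1}" using assms by (auto simp: unit_cube_def PiE_iff)
    then have "\<bar>x i - y i\<bar> \<le> 1" by auto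
    then show "(x i - y i)\<^sup>2 \<le> 1" by (simp add: abs_square_le_1)
  qed
  then show ?thesis by (simp add: euclid_dist_def L2_set_def)
qed

lemma zip_tl_in_set: "(x, y) \<in> set (zip xs (tl xs)) \<Longrightarrow> x \<in> set xs \<and> y \<in> set xs"
  by (cases xs) (auto dest: set_zip_leftD set_zip_rightD)

text \<open>For the finitely many small \<open>k\<close> any bound uniform in X suffices. The charge
  per path limits the number of joins, and each is at most sqrt k long.\<close>

lemma path_remainder_small:
  assumes k: "k \<ge> 2"
  shows "\<exists>E\<ge>0. path_remainder_le k E"
proof -
  let ?l = "(31 / 100 * sqrt k) ^ k"
  have l: "?l > 0" using k by simp
  define E where "E = \<bar>small_bound k\<bar> + \<bar>small_bound k\<bar> / ?l * sqrt k ^ k"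
  have "path_remainder_le k E"
    unfolding path_remainder_le_def
  proof (intro allI impI)
    fix X assume X: "X \<subseteq> unit_cube k \<and> finite X \<and> X \<noteq> {}"
    obtain xs fs where xs: "distinct xs" "set xs = X"
      "esum (\<lambda>x y. euclid_dist k x y ^ k) xs \<le> small_bound k + (\<Sum>f\<leftarrow>fs. f ^ k)"
      "length fs * ?l \<le> small_bound k"
      "\<And>f M. f \<in> set fs \<Longrightarrow> (\<And>x y. (x, y) \<in> set (zip xs (tl xs)) \<Longrightarrow> euclid_dist k x y \<le> M) \<Longrightarrow> 0 \<le> f \<and> f \<le> M"
      "\<And>\<rho>. \<exists>S\<subseteq>X. separated (euclid_dist k) \<rho> S \<and> Suc (length (filter (\<lambda>f. f \<ge> \<rho>) fs)) \<le> card S"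
      using joined_small_cover[OF k, of X] X by blast
    have f: "0 \<le> f \<and> f \<le> sqrt k" if "f \<in> set fs" for f
    proof (rule xs(5)[OF that])
      fix x y assume "(x, y) \<in> set (zip xs (tl xs))"
      then have "x \<in> X" "y \<in> X" using zip_tl_in_set[of x y xs] xs(2) by auto
      then show "euclid_dist k x y \<le> sqrt k" using X by (intro euclid_dist_le_sqrt) auto
    qed
    have "(\<Sum>f\<leftarrow>fs. f ^ k) \<le> (\<Sum>f\<leftarrow>fs. sqrt k ^ k)"
      using f by (intro sum_list_mono power_mono) auto
    also have "\<dots> = length fs * sqrt k ^ k" by (simp add: sum_list_triv)
    also have "\<dots> \<le> \<bar>small_bound k\<bar> / ?l * sqrt k ^ k"
      using xs(4) l by (intro mult_right_mono) (auto simp: pos_le_divide_eq)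
    finally have "esum (\<lambda>x y. euclid_dist k x y ^ k) xs \<le> E" using xs(3) by (simp add: E_def)
    then show "\<exists>xs. distinct xs \<and> set xs = X \<and>
       (\<forall>M\<ge>0. (\<forall>(x, y)\<in>set (zip xs (tl xs)). euclid_dist k x y \<le> M) \<longrightarrow>
          esum (\<lambda>x y. euclid_dist k x y ^ k) xs \<le> E + M ^ k)"
      using xs(1,2) by (intro exI[of _ xs]) (auto intro: add_increasing2)
  qed
  moreover have "E \<ge> 0" using l by (simp add: E_def)
  ultimately show ?thesis by blast
qed

section \<open>The limit\<close>

lemma esum_sorted:
  fixes f :: "'b \<Rightarrow> real"
  shows "sorted (map f xs) \<Longrightarrow> xs \<noteq> [] \<Longrightarrow> esum (\<lambda>x y. \<bar>f x - f y\<bar>) xs = f (last xs) - f (hd xs)"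
  by (induction xs rule: induct_list012) auto

text \<open>The cover argument starts at \<open>k = 2\<close>; in dimension 1 the points are visited
  in order, and the lengths telescope.\<close>

lemma path_remainder_1: "path_remainder_le 1 1"
  unfolding path_remainder_le_def
proof (intro allI impI)
  fix X assume X: "X \<subseteq> unit_cube 1 \<and> finite X \<and> X \<noteq> {}"
  obtain ys where ys: "distinct ys" "set ys = X" using finite_distinct_list X by blast
  let ?f = "\<lambda>x :: nat \<Rightarrow> real. x 0"
  define xs where "xs = sort_key ?f ys"
  have xs: "distinct xs" "set xs = X" "sorted (map ?f xs)" using ys by (auto simp: xs_def)
  have ne: "xs \<noteq> []" using xs(2) X by auto
  then have "last xs \<in> unit_cube 1" "hd xs \<in> unit_cube 1" using xs(2) X by auto
  then have "?f (last xs) - ?f (hd xs) \<le> 1" by (force simp: unit_cube_def PiE_iff)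
  moreover have "euclid_dist 1 x y ^ 1 = \<bar>?f x - ?f y\<bar>" for x y
    by (simp add: euclid_dist_def L2_set_def)
  ultimately have "esum (\<lambda>x y. euclid_dist 1 x y ^ 1) xs \<le> 1"
    using esum_sorted[OF xs(3) ne] by presburger
  then show "\<exists>xs. distinct xs \<and> set xs = X \<and>
       (\<forall>M\<ge>0. (\<forall>(x, y)\<in>set (zip xs (tl xs)). euclid_dist 1 x y \<le> M) \<longrightarrow>
          esum (\<lambda>x y. euclid_dist 1 x y ^ 1) xs \<le> 1 + M ^ 1)"
    using xs(1,2) by (intro exI[of _ xs]) (auto intro: add_increasing2)
qed

lemma path_edges_Cons: "path_edges (x # y # ys) = insert {x, y} (path_edges (y # ys))"
proof -
  have "path_edges (x # y # ys) = (\<lambda>i. {(x # y # ys) ! i, (x # y # ys) ! Suc i}) ` {i. Suc i < length (x # y # ys)}" 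
    by (auto simp: path_edges_def)
  also have "{i. Suc i < length (x # y # ys)} = insert 0 (Suc ` {i. Suc i < length (y # ys)})"
    by (auto simp: image_iff) (metis Suc_less_eq not0_implies_Suc)
  finally show ?thesis by (auto simp: path_edges_def image_image)
qed

lemma path_edges_short [simp]: "path_edges [] = {}" "path_edges [x] = {}"
  by (auto simp: path_edges_def)

lemma path_edges_zip: "path_edges xs = (\<lambda>(x, y). {x, y}) ` set (zip xs (tl xs))"
  by (induction xs rule: induct_list012) (auto simp: path_edges_Cons)

lemma finite_path_edges: "finite (path_edges xs)"
  by (simp add: path_edges_zip)

text \<open>Without repeated vertices no two positions give the same unordered pair, so the sum over
  the set of edges loses nothing.\<close>

lemma edge_power_sum_path:
  "distinct xs \<Longrightarrow> edge_power_sum k t (path_edges xs) = esum (\<lambda>x y. euclid_dist k x y ^ t) xs"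
proof (induction xs rule: induct_list012)
  case (3 x y zs)
  have "path_edges (y # zs) \<subseteq> Pow (set (y # zs))"
    unfolding path_edges_zip using zip_tl_in_set[of _ _ "y # zs"] by auto
  then have "{x, y} \<notin> path_edges (y # zs)" using 3 by auto
  then show ?case using 3 finite_path_edges[of "y # zs"]
    by (simp add: path_edges_Cons edge_power_sum_def edge_length_doubleton)
qed (auto simp: edge_power_sum_def)

lemma path_remainder_leD:
  assumes "path_remainder_le k E" "X \<subseteq> unit_cube k" "finite X" "X \<noteq> {}"
  obtains P where "is_hamiltonian_path X P"
    "\<And>e\<^sub>1. e\<^sub>1 \<in> P \<Longrightarrow> (\<And>e. e \<in> P \<Longrightarrow> edge_length k e \<le> edge_length k e\<^sub>1) \<Longrightarrow>
       (\<Sum>e\<in>P - {e\<^sub>1}. edge_length k e ^ k) \<le> E"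
    "edge_power_sum k k P \<le> E + sqrt k ^ k"
proof -
  obtain xs where xs: "distinct xs" "set xs = X"
    "\<And>M. M \<ge> 0 \<Longrightarrow> (\<And>x y. (x, y) \<in> set (zip xs (tl xs)) \<Longrightarrow> euclid_dist k x y \<le> M) \<Longrightarrow>
          esum (\<lambda>x y. euclid_dist k x y ^ k) xs \<le> E + M ^ k"
    using assms unfolding path_remainder_le_def by (metis (no_types, lifting) case_prodI2)
  let ?P = "path_edges xs"
  have sum: "edge_power_sum k k ?P = esum (\<lambda>x y. euclid_dist k x y ^ k) xs" by (rule edge_power_sum_path[OF xs(1)])
  show ?thesis
  proof
    show "is_hamiltonian_path X ?P" using xs by (auto simp: is_hamiltonian_path_def)
    show "edge_power_sum k k ?P \<le> E + sqrt k ^ k"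
      unfolding sum
    proof (rule xs(3))
      fix x y assume "(x, y) \<in> set (zip xs (tl xs))"
      then show "euclid_dist k x y \<le> sqrt k"
        using euclid_dist_le_sqrt zip_tl_in_set[of x y xs] xs(2) assms(2) by blast
    qed simp
    fix e1 assume e1: "e1 \<in> ?P" "\<And>e. e \<in> ?P \<Longrightarrow> edge_length k e \<le> edge_length k e1"
    have "edge_length k e1 \<ge> 0" using e1(1) by (auto simp: path_edges_zip edge_length_doubleton euclid.d_nonneg)
    moreover have "euclid_dist k x y \<le> edge_length k e1" if "(x, y) \<in> set (zip xs (tl xs))" for x y
    proof -
      have "{x, y} \<in> ?P" using that by (auto simp: path_edges_zip)
      then show ?thesis using e1(2)[of "{x, y}"] by (simp add: edge_length_doubleton)
    qed
    ultimately have "edge_power_sum k k ?P \<le> E + edge_length k e1 ^ k" unfolding sum by (rule xs(3))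
    then show "(\<Sum>e\<in>?P - {e1}. edge_length k e ^ k) \<le> E"
      using sum.remove[OF finite_path_edges e1(1), of "\<lambda>e. edge_length k e ^ k"] by (simp add: edge_power_sum_def)
  qed
qed

lemma sqrt_power_eq_powr: "k \<ge> 1 \<Longrightarrow> sqrt (real k) ^ k = real k powr (real k / 2)"
  by (simp add: powr_half_sqrt[symmetric] powr_realpow[symmetric] powr_powr)

lemma S_HP_lower:
  assumes "k \<ge> 1"
  shows "ereal (sqrt k ^ k) \<le> S_HP k"
proof -
  define a b :: "nat \<Rightarrow> real" where "a = (\<lambda>i\<in>{..<k}. 0)" and "b = (\<lambda>i\<in>{..<k}. 1)"
  have ab: "a \<noteq> b"
  proof
    assume "a = b"
    then have "a 0 = b 0" by simp
    then show False using assms by (simp add: a_def b_def)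
  qed
  have "euclid_dist k a b = sqrt k" by (simp add: euclid_dist_def L2_set_def a_def b_def)
  moreover have "euclid_dist k b a = sqrt k" by (simp add: euclid_dist_def L2_set_def a_def b_def)
  ultimately have val: "edge_power_sum k k P = sqrt k ^ k" if P: "is_hamiltonian_path {a, b} P" for P
  proof -
    obtain xs where xs: "distinct xs" "set xs = {a, b}" "P = path_edges xs" using P by (auto simp: is_hamiltonian_path_def)
    have "length xs = 2" using distinct_card[OF xs(1)] xs(2) ab by simp
    then obtain x y where "xs = [x, y]" by (auto simp: length_Suc_conv numeral_2_eq_2)
    then have "xs = [a, b] \<or> xs = [b, a]" using xs(1,2) by (auto simp: doubleton_eq_iff)
    then show ?thesis
      using \<open>euclid_dist k a b = sqrt k\<close> \<open>euclid_dist k b a = sqrt k\<close> xs(1,3) edge_power_sum_path[of xs k k] by auto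
  qed
  have "edge_power_sum k k ` {P. is_hamiltonian_path {a, b} P} = {sqrt k ^ k}"
    using val hamiltonian_paths_nonempty[of "{a, b}"] by auto
  then have S: "S_HP_of k {a, b} = sqrt k ^ k" by (simp add: S_HP_of_def)
  have "{a, b} \<in> {X. X \<subseteq> unit_cube k \<and> finite X \<and> X \<noteq> {}}"
    by (auto simp: a_def b_def unit_cube_def)
  from SUP_upper[OF this, of "\<lambda>X. ereal (S_HP_of k X)"] have "ereal (S_HP_of k {a, b}) \<le> S_HP k"
    unfolding S_HP_def .
  then show ?thesis by (simp only: S)
qed

lemma S_HP_upper:
  assumes "path_remainder_le k E"
  shows "S_HP k \<le> ereal (E + sqrt k ^ k)"
  unfolding S_HP_def
proof (rule SUP_least)
  fix X assume "X \<in> {X. X \<subseteq> unit_cube k \<and> finite X \<and> X \<noteq> {}}"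
  then have X: "X \<subseteq> unit_cube k" "finite X" "X \<noteq> {}" by auto
  obtain P where P: "is_hamiltonian_path X P" "edge_power_sum k k P \<le> E + sqrt k ^ k"
    by (rule path_remainder_leD[OF assms X])
  have "S_HP_of k X \<le> edge_power_sum k k P"
    unfolding S_HP_of_def using P(1) finite_hamiltonian_paths[OF X(2)] by (intro Min_le) auto
  then show "ereal (S_HP_of k X) \<le> ereal (E + sqrt k ^ k)" using P(2) by simp
qed

text \<open>Raising the exponents \<open>k - 1\<close> to \<open>k\<close> produces the factor
  200/187 and a spare 1 / sqrt k, which is estimated by 1.\<close>

lemma small_bound_ratio:
  assumes "k \<ge> 1"
  shows "small_bound k / sqrt k ^ k
    \<le> 44 * 2160000 * (1 + 10 ^ 6 * sqrt k) * (1 + 31 / 50 * sqrt k) * (200 / 187) * (3927 / 4000) ^ k"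
proof -
  obtain n where n: "k = Suc n" using assms by (cases k) auto
  define S where "S = sqrt (real k)"
  have S: "S \<ge> 1" using assms by (simp add: S_def)
  define c where "c = 44 * 2160000 * (1 + 10 ^ 6 * S) * (1 + 31 / 50 * S)"
  have c: "c \<ge> 0" using S by (simp add: c_def)
  have "small_bound k = c * ((21/20) ^ k * ((187 / 125) ^ n * (5 / 8) ^ n) * S ^ n)"
    by (simp only: small_bound_def c_def n S_def power_mult_distrib diff_Suc_1) (simp only: mult_ac)
  also have "(21/20) ^ k * ((187 / 125) ^ n * (5 / 8) ^ n) = 200 / 187 * (3927 / 4000 :: real) ^ k"
  proof -
    have "(187 / 125) ^ n * (5 / 8 :: real) ^ n = (187 / 200) ^ n" by (simp flip: power_mult_distrib)
    also have "\<dots> = 200 / 187 * (187 / 200) ^ k" by (simp add: n)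
    also have "(21/20) ^ k * \<dots> = 200 / 187 * ((21/20) ^ k * (187 / 200 :: real) ^ k)" by simp
    also have "(21/20) ^ k * (187 / 200 :: real) ^ k = (3927 / 4000) ^ k" by (simp flip: power_mult_distrib)
    finally show ?thesis by (simp only: \<open>(187 / 125) ^ n * (5 / 8 :: real) ^ n = (187 / 200) ^ n\<close>)
  qed
  finally have "small_bound k = c * (200 / 187) * (3927 / 4000) ^ k * S ^ n" by (simp only: mult.assoc)
  then have "small_bound k / S ^ k = c * (200 / 187) * (3927 / 4000) ^ k * (S ^ n / S ^ k)"
    by (simp only: times_divide_eq_right)
  also have "S ^ n / S ^ k = 1 / S" using S by (simp add: n)
  also have "c * (200 / 187) * (3927 / 4000) ^ k * (1 / S) \<le> c * (200 / 187) * (3927 / 4000) ^ k * 1"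
    using S c by (intro mult_left_mono) auto
  finally show ?thesis by (simp add: c_def S_def)
qed

lemma remainder_bound_tendsto: "(\<lambda>k. remainder_bound k / sqrt k ^ k) \<longlonglongrightarrow> 0"
proof -
  let ?u = "\<lambda>k. 2 * (44 * 2160000 * (1 + 10 ^ 6 * sqrt (real k)) * (1 + 31 / 50 * sqrt k) * (200 / 187) * (3927 / 4000) ^ k) + 21600 * (97 / 100) ^ (k div 4)"
  have 1: "(\<lambda>k::nat. 2 * (44 * 2160000 * (1 + 10 ^ 6 * sqrt (real k)) * (1 + 31 / 50 * sqrt k) * (200 / 187) * (3927 / 4000) ^ k)) \<longlonglongrightarrow> 0"
    by real_asymp
  have "(\<lambda>n. (97 / 100 :: real) ^ n) \<longlonglongrightarrow> 0" by (rule LIMSEQ_power_zero) simp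
  from filterlim_compose[OF this filterlim_at_top_div_const_nat[of 4]]
  have "(\<lambda>k. 21600 * (97 / 100 :: real) ^ (k div 4)) \<longlonglongrightarrow> 21600 * 0" by (intro tendsto_mult) auto
  from tendsto_add[OF 1 this] have lim: "?u \<longlonglongrightarrow> 0" by simp
  have sb: "small_bound k \<ge> 0" for k by (simp add: small_bound_def)
  show ?thesis
  proof (rule tendsto_sandwich[OF _ _ tendsto_const lim])
    show "\<forall>\<^sub>F k in sequentially. 0 \<le> remainder_bound k / sqrt k ^ k"
      using sb by (auto intro!: always_eventually simp: remainder_bound_def)
    show "\<forall>\<^sub>F k in sequentially. remainder_bound k / sqrt k ^ k \<le> ?u k"
      using eventually_ge_at_top[of 1]
    proof eventually_elim
      case (elim k)
      have "remainder_bound k / sqrt k ^ k = 2 * (small_bound k / sqrt k ^ k) + 21600 * (97 / 100) ^ (k div 4)"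
        using elim by (simp add: remainder_bound_def field_simps)
      then show ?case using small_bound_ratio[OF elim] by simp
    qed
  qed
qed

theorem theorem1p8:
  "(\<exists>\<epsilon> :: nat \<Rightarrow> real.
      (\<forall>k\<ge>1. \<epsilon> k \<ge> 0) \<and> \<epsilon> \<longlonglongrightarrow> 0 \<and>
      (\<forall>k\<ge>1. \<forall>X. X \<subseteq> unit_cube k \<and> finite X \<and> X \<noteq> {} \<longrightarrow>
        (\<exists>P. is_hamiltonian_path X P \<and>
          (\<forall>e\<^sub>1\<in>P. (\<forall>e\<in>P. edge_length k e \<le> edge_length k e\<^sub>1) \<longrightarrow>
            (\<Sum>e\<in>P - {e\<^sub>1}. edge_length k e ^ k) \<le> \<epsilon> k * real k powr (real k / 2)) \<and>
          edge_power_sum k k P \<le> real k powr (real k / 2) * (1 + \<epsilon> k)))) \<and>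
   (\<lambda>k. S_HP k / ereal (real k powr (real k / 2))) \<longlonglongrightarrow> 1"
proof -
  \<comment> \<open>Below 100 the value only has to be uniform in X; from 100 on it is pinned to
    \<open>remainder_bound\<close>, which decides the limit.\<close>
  have "\<exists>E\<ge>0. path_remainder_le k E \<and> (k \<ge> 100 \<longrightarrow> E = remainder_bound k)" if "k \<ge> 1" for k
  proof (cases "k \<ge> 100")
    case True
    have "remainder_bound k \<ge> 0" by (simp add: remainder_bound_def small_bound_def)
    then show ?thesis using path_remainder_large[OF True] by blast
  next
    case False
    have "\<exists>E\<ge>0. path_remainder_le k E"
      
    proof (cases "k = 1")
      case True
      show ?thesis using path_remainder_1 unfolding True by (intro exI[of _ 1]) simp
    next
      case False
      then show ?thesis using path_remainder_small[of k] that by simp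
    qed
    then show ?thesis using False by auto
  qed
  then have "\<forall>k. \<exists>E. k \<ge> 1 \<longrightarrow> E \<ge> 0 \<and> path_remainder_le k E \<and> (k \<ge> 100 \<longrightarrow> E = remainder_bound k)"
    by blast
  from choice[OF this] obtain E where
    E': "\<forall>k. k \<ge> 1 \<longrightarrow> E k \<ge> 0 \<and> path_remainder_le k (E k) \<and> (k \<ge> 100 \<longrightarrow> E k = remainder_bound k)" ..
  have E: "E k \<ge> 0" "path_remainder_le k (E k)" if "k \<ge> 1" for k using E' that by auto
  have E3: "E k = remainder_bound k" if "k \<ge> 100" for k using E'[rule_format, of k] that by simp
  define \<epsilon> where "\<epsilon> = (\<lambda>k. E k / sqrt (real k) ^ k)"
  have N: "sqrt (real k) ^ k > 0" if "k \<ge> 1" for k using that by simp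
  have Ek: "E k = \<epsilon> k * sqrt (real k) ^ k" if "k \<ge> 1" for k using N[OF that] by (simp add: \<epsilon>_def)
  have \<epsilon>0: "\<epsilon> k \<ge> 0" if "k \<ge> 1" for k using E(1)[OF that] by (simp add: \<epsilon>_def)
  have lim: "\<epsilon> \<longlonglongrightarrow> 0"
  proof (rule Lim_transform_eventually[OF remainder_bound_tendsto])
    show "\<forall>\<^sub>F k in sequentially. remainder_bound k / sqrt k ^ k = \<epsilon> k"
      using eventually_ge_at_top[of 100] by eventually_elim (simp add: \<epsilon>_def E3)
  qed
  have paths: "\<exists>P. is_hamiltonian_path X P \<and>
          (\<forall>e\<^sub>1\<in>P. (\<forall>e\<in>P. edge_length k e \<le> edge_length k e\<^sub>1) \<longrightarrow>
            (\<Sum>e\<in>P - {e\<^sub>1}. edge_length k e ^ k) \<le> \<epsilon> k * real k powr (real k / 2)) \<and>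
          edge_power_sum k k P \<le> real k powr (real k / 2) * (1 + \<epsilon> k)"
    if k: "k \<ge> 1" and X: "X \<subseteq> unit_cube k" "finite X" "X \<noteq> {}" for k X
  proof -
    obtain P where P: "is_hamiltonian_path X P"
      "\<And>e\<^sub>1. e\<^sub>1 \<in> P \<Longrightarrow> (\<And>e. e \<in> P \<Longrightarrow> edge_length k e \<le> edge_length k e\<^sub>1) \<Longrightarrow>
        (\<Sum>e\<in>P - {e\<^sub>1}. edge_length k e ^ k) \<le> E k"
      "edge_power_sum k k P \<le> E k + sqrt k ^ k"
      by (rule path_remainder_leD[OF E(2)[OF k] X]) blast
    then show ?thesis
      unfolding sqrt_power_eq_powr[OF k, symmetric] Ek[OF k]
      by (intro exI[of _ P]) (auto simp: algebra_simps)
  qed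
  have "(\<lambda>k. S_HP k / ereal (real k powr (real k / 2))) \<longlonglongrightarrow> 1"
  proof (rule tendsto_sandwich[where f = "\<lambda>_. 1" and h = "\<lambda>k. ereal (1 + \<epsilon> k)"])
    have "(\<lambda>k. ereal (1 + \<epsilon> k)) \<longlonglongrightarrow> ereal (1 + 0)"
      using lim by (intro tendsto_ereal tendsto_add tendsto_const)
    then show "(\<lambda>k. ereal (1 + \<epsilon> k)) \<longlonglongrightarrow> 1" by (simp add: one_ereal_def)
    have bounds: "1 \<le> S_HP k / ereal (real k powr (real k / 2)) \<and> S_HP k / ereal (real k powr (real k / 2)) \<le> ereal (1 + \<epsilon> k)"
      if k: "k \<ge> 1" for k
    proof -
      have low: "ereal (sqrt k ^ k) \<le> S_HP k" by (rule S_HP_lower[OF k])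
      have up: "S_HP k \<le> ereal (E k + sqrt k ^ k)" by (rule S_HP_upper[OF E(2)[OF k]])
      obtain s where s: "S_HP k = ereal s" using low up by (cases "S_HP k") auto
      have "sqrt k ^ k \<le> s" "s \<le> (1 + \<epsilon> k) * sqrt k ^ k" using low up Ek[OF k] by (auto simp: s algebra_simps)
      then have "1 \<le> s / sqrt k ^ k" "s / sqrt k ^ k \<le> 1 + \<epsilon> k" using N[OF k] by (auto simp: field_simps)
      then show ?thesis unfolding sqrt_power_eq_powr[OF k, symmetric] s using k by (simp add: one_ereal_def)
    qed
    show "\<forall>\<^sub>F k in sequentially. 1 \<le> S_HP k / ereal (real k powr (real k / 2))"
      using eventually_ge_at_top[of 1] by eventually_elim (use bounds in blast)
    show "\<forall>\<^sub>F k in sequentially. S_HP k / ereal (real k powr (real k / 2)) \<le> ereal (1 + \<epsilon> k)"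
      using eventually_ge_at_top[of 1] by eventually_elim (use bounds in blast)
  qed (rule tendsto_const)
  then show ?thesis using \<epsilon>0 lim paths by blast
qed

end
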